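(* Let $\nabla^{nl}$ be an almost standard connection on the non-linear analytic fiber bundle $E\to U\times \mathrm{Spf}(\mathbb{C}[[t]])$. Assume that on $U$ we have $\delta=(\delta_i)_{1\le i\le n}=0$ and $\alpha_i=0$ for $1\le i\le n$. Then $\nabla^{nl}$ is gauge equivalent over formal series in $t$ to the standard connection $\nabla^{nl,st}$. The corresponding gauge equivalence is unique.
   Context: Let $\Gamma\simeq\mathbb{Z}^n$ be a free abelian group of rank $n$ with a fixed basis, and $U\subset\mathrm{Hom}(\Gamma,\mathbb{C})=\mathbb{C}^n$ a domain of holomorphy, with coordinate functions $Z_1,\dots,Z_n$. Let $(\mathbb{C}^* )^n=\mathrm{Hom}(\Gamma,\mathbb{C}^* )$ have coordinates $z_1,\dots,z_n$. Denote by $\mathfrak{g}^{an}=\mathcal{O}^{an}(U)\widehat\otimes \mathrm{Vect}_{(\mathbb{C}^* )^n}$ the Lie algebra of analytic vector fields along the fiber $(\mathbb{C}^* )^n$ depending analytically on a point of $U$, i.e. $\sum_i f_i(Z,z)z_i\partial_{z_i}$ with $f_i$ holomorphic on $U\times(\mathbb{C}^* )^n$. It is graded (in the completed sense, via Laurent expansion) by $\gamma\in\mathbb{Z}^n$, the degree $\gamma$ part being spanned over $\mathcal{O}^{an}(U)$ by $z^\gamma z_i\partial_{z_i}$, $1\le i\le n$. Let $\pi:E\to U\times\mathrm{Spf}(\mathbb{C}[[t]])$ be a non-linear analytic fiber bundle (analytic along $U$, formal in $t$) with an isomorphism $\psi_0:\pi^{-1}(U\times\{0\})\simeq U\times(\mathbb{C}^*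 )^n$ commuting with $\pi$, and with a non-linear flat (Ehresmann) connection $\nabla^{nl}$ with pole of finite order at $t=0$; choose a trivialization $\psi:E\simeq(\mathbb{C}^* )^n\times(U\times\mathrm{Spf}(\mathbb{C}[[t]]))$ extending $\psi_0$. The connection is given by lifts $\nabla^{nl}_{\partial_t},\nabla^{nl}_{\partial_{Z_j}}$ of $\partial_t,\partial_{Z_j}$; flatness means these lifts pairwise commute. It is called almost standard if in the trivialization $\psi$ $$\nabla^{nl}_{\partial_t}=\partial_t+t^{-2}\sum_{1\le i\le n}Z_iz_i\partial_{z_i}+t^{-1}v_{-1}+\sum_{m\ge0}t^mv_m,\qquad \nabla^{nl}_{\partial_{Z_j}}=\partial_{Z_j}-\frac1t z_j\partial_{z_j}+\sum_{m\ge0}t^mw^{(j)}_m,\ 1\le j\le n,$$ with $v_m,w_m^{(j)}\in\mathfrak{g}^{an}$. This property does not depend on $\psi$. Write the degree $0$ part of $v_{-1}$ as $\sum_i\delta_iz_i\partial_{z_i}$ and the degree $0$ part of $w_0^{(j)}$ as $\sum_ia_{ij}z_i\partial_{z_i}$, with $\delta_i,a_{ij}\in\mathcal{O}^{an}(U)$; put $\alpha_i=\sum_{1\le j\le n}a_{ij}\,dZ_j$ (closed $1$-forms on $U$). The $\delta_i$ and $\alpha_i$ do not depend on $\psi$. The standard connection $\nabla^{nl,st}$ is $\nabla^{nl,st}_{\partial_t}=\partial_t+\sum_i\frac{Z_i}{t^2}z_i\partial_{z_i}$, $\nabla^{nl,st}_{\partial_{Z_j}}=\partial_{Z_j}-\frac1tz_j\partial_{z_j}$.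 Gauge transformations (over formal series in $t$) are elements of the pronilpotent group $H$ with Lie algebra $\mathrm{Lie}(H)=\{\sum_{l\ge1}t^lh_l\mid h_l\in\mathfrak{g}^{an}\}$, i.e. changes of trivialization extending $\psi_0$. *)

theory Defs
  imports "HOL-Complex_Analysis.Complex_Analysis" "HOL-Library.Function_Algebras"
begin

text \<open>
  A point of the total space over \<open>t = 0\<close> is a pair \<open>(Z, z)\<close> with \<open>Z\<close> in \<open>U\<close>
  and \<open>z\<close> in the torus. Formal series in \<open>t\<close> whose coefficients are functions of
  \<open>(Z, z)\<close> are Laurent series \<^typ>\<open>'a fls\<close> over the ring of functions with pointwise
  operations; the formal variable is \<open>t\<close>. A vertical vector field is given by
  its coefficients with respect to the frame \<open>z\<^sub>i \<partial>/\<partial>z\<^sub>i\<close>.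
\<close>

no_notation fps_nth (infixl "$" 75)

type_synonym 'n pt = "(complex^'n) \<times> (complex^'n)"
type_synonym 'n fn = "'n pt \<Rightarrow> complex"
type_synonym 'n vfield = "('n fn)^'n"
type_synonym 'n vseries = "('n fn fls)^'n"

section \<open>Holomorphic functions of several variables\<close>

text \<open>Complex differentiability at each point; for open sets this is holomorphy.\<close>

definition holomorphic_vec_on :: "(complex^'n \<Rightarrow> complex) \<Rightarrow> (complex^'n) set \<Rightarrow> bool" where
  "holomorphic_vec_on f S \<longleftrightarrow>
     (\<forall>x\<in>S. \<exists>a. (f has_derivative (\<lambda>h. \<Sum>i\<in>UNIV. a i * h $ i)) (at x))"

definition holomorphic_pair_on :: "'n fn \<Rightarrow> 'n::finite pt set \<Rightarrow> bool" where
  "holomorphic_pair_on f S \<longleftrightarrow>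
     (\<forall>x\<in>S. \<exists>a b. (f has_derivative
        (\<lambda>h. (\<Sum>i\<in>UNIV. a i * fst h $ i) + (\<Sum>i\<in>UNIV. b i * snd h $ i))) (at x))"

text \<open>
  No pair of open sets \<open>V \<subseteq> W\<close> witnesses simultaneous holomorphic continuation of all
  holomorphic functions on \<open>U\<close> to a connected set leaving \<open>U\<close>.
\<close>

definition domain_of_holomorphy :: "(complex^'n) set \<Rightarrow> bool" where
  "domain_of_holomorphy U \<longleftrightarrow> open U \<and> connected U \<and> U \<noteq> {} \<and>
     \<not> (\<exists>V W. open V \<and> V \<noteq> {} \<and> V \<subseteq> U \<inter> W \<and> open W \<and> connected W \<and> \<not> W \<subseteq> U \<and>
          (\<forall>f. holomorphic_vec_on f U \<longrightarrow>
             (\<exists>g. holomorphic_vec_on g W \<and> (\<forall>x\<in>V. g x = f x))))"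

section \<open>Vector fields along the fibre\<close>

definition total_space :: "(complex^'n) set \<Rightarrow> 'n pt set" where
  "total_space U = U \<times> {z. \<forall>i. z $ i \<noteq> 0}"

text \<open>
  Functions on the total space are made into HOL functions by the value \<open>0\<close> outside it,
  so that equality of such functions is equality on the total space.
\<close>

definition O_an :: "(complex^'n) set \<Rightarrow> 'n fn set" where
  "O_an U = {f. holomorphic_pair_on f (total_space U) \<and> (\<forall>p. p \<notin> total_space U \<longrightarrow> f p = 0)}"

definition g_an :: "(complex^'n) set \<Rightarrow> 'n vfield set" where
  "g_an U = {v. \<forall>i. v $ i \<in> O_an U}"

text \<open>The operators \<open>z\<^sub>i \<partial>/\<partial>z\<^sub>i\<close> and \<open>\<partial>/\<partial>Z\<^sub>j\<close> on functions.\<close>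

definition euler :: "(complex^'n) set \<Rightarrow> 'n \<Rightarrow> 'n fn \<Rightarrow> 'n fn" where
  "euler U i f = (\<lambda>(Z, z). if (Z, z) \<in> total_space U
     then z $ i * deriv (\<lambda>s. f (Z, (\<chi> k. if k = i then s else z $ k))) (z $ i) else 0)"

definition partial_Z :: "(complex^'n) set \<Rightarrow> 'n \<Rightarrow> 'n fn \<Rightarrow> 'n fn" where
  "partial_Z U j f = (\<lambda>(Z, z). if (Z, z) \<in> total_space U
     then deriv (\<lambda>s. f ((\<chi> k. if k = j then s else Z $ k), z)) (Z $ j) else 0)"

text \<open>Coefficientwise application, for maps fixing \<open>0\<close>.\<close>

definition fls_map :: "('a::zero \<Rightarrow> 'b::zero) \<Rightarrow> 'a fls \<Rightarrow> 'b fls" where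
  "fls_map \<phi> F = Abs_fls (\<lambda>k. \<phi> (fls_nth F k))"

lemma fls_map_nth:
  assumes "\<phi> 0 = 0"
  shows "fls_nth (fls_map \<phi> F) k = \<phi> (fls_nth F k)"
  unfolding fls_map_def
  by (rule nth_Abs_fls_lower_bound[of "fls_subdegree F"]) (simp add: assms fls_eq0_below_subdegree)

definition formal_functions :: "(complex^'n) set \<Rightarrow> 'n fn fls set" where
  "formal_functions U = {F. \<forall>k. fls_nth F k \<in> O_an U}"

definition vact :: "(complex^'n) set \<Rightarrow> 'n vseries \<Rightarrow> 'n fn fls \<Rightarrow> 'n fn fls" where
  "vact U X F = (\<Sum>i\<in>UNIV. X $ i * fls_map (euler U i) F)"

section \<open>Connections\<close>

text \<open>
  The fibre bundle is described in a trivialization extending the given one at \<open>t = 0\<close>; functions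
  on it (with poles at \<open>t = 0\<close>) are the formal functions, and vector fields are derivations of them.
  A connection is the family of lifts \<open>\<partial>\<^sub>t + vert_t\<close> and
  \<open>\<partial>/\<partial>Z\<^sub>j + vert_Z j\<close> with vertical parts having a pole of finite order in \<open>t\<close>.
\<close>

record 'n connection =
  vert_t :: "'n vseries"
  vert_Z :: "'n \<Rightarrow> 'n vseries"

definition nabla_t :: "(complex^'n) set \<Rightarrow> 'n connection \<Rightarrow> 'n fn fls \<Rightarrow> 'n fn fls" where
  "nabla_t U C F = fls_deriv F + vact U (vert_t C) F"

definition nabla_Z :: "(complex^'n) set \<Rightarrow> 'n connection \<Rightarrow> 'n \<Rightarrow> 'n fn fls \<Rightarrow> 'n fn fls" where
  "nabla_Z U C j F = fls_map (partial_Z U j) F + vact U (vert_Z C j) F"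

definition flat_connection :: "(complex^'n) set \<Rightarrow> 'n connection \<Rightarrow> bool" where
  "flat_connection U C \<longleftrightarrow> (\<forall>F\<in>formal_functions U.
     (\<forall>j. nabla_t U C (nabla_Z U C j F) = nabla_Z U C j (nabla_t U C F)) \<and>
     (\<forall>i j. nabla_Z U C i (nabla_Z U C j F) = nabla_Z U C j (nabla_Z U C i F)))"

definition standard_connection :: "'n::finite connection" where
  "standard_connection =
     \<lparr> vert_t = (\<chi> i. fls_X_intpow (-2) * fls_const (\<lambda>(Z, z). Z $ i)),
       vert_Z = (\<lambda>j. \<chi> i. if i = j then - fls_X_intpow (-1) else 0) \<rparr>"

definition vfield_series :: "(nat \<Rightarrow> 'n::finite vfield) \<Rightarrow> 'n vseries" where
  "vfield_series v = (\<chi> i. fps_to_fls (Abs_fps (\<lambda>m. v m $ i)))"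

definition almost_standard :: "(complex^'n) set \<Rightarrow> 'n connection \<Rightarrow> bool" where
  "almost_standard U C \<longleftrightarrow> (\<exists>u v w. u \<in> g_an U \<and> (\<forall>m. v m \<in> g_an U) \<and> (\<forall>j m. w j m \<in> g_an U) \<and>
     vert_t C = vert_t standard_connection
       + (\<chi> i. fls_X_intpow (-1) * fls_const (u $ i)) + vfield_series v \<and>
     (\<forall>j. vert_Z C j = vert_Z standard_connection j + vfield_series (w j)))"

section \<open>The grading and the invariants\<close>

text \<open>
  Coefficient of \<open>z\<^sup>\<gamma>\<close> in the Laurent expansion of \<open>f (Z, \<cdot>)\<close>, by Cauchy's formula on the unit
  torus, parametrized by \<open>z\<^sub>k = cis (2 * pi * \<theta> k)\<close> so that \<open>dz\<^sub>k / (2 \<pi> \<i> z\<^sub>k) = d\<theta>\<^sub>k\<close>.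
\<close>

definition torus_pt :: "('n \<Rightarrow> real) \<Rightarrow> complex^'n" where
  "torus_pt \<theta> = (\<chi> k. cis (2 * pi * \<theta> k))"

definition laurent_monom :: "('n \<Rightarrow> int) \<Rightarrow> complex^'n \<Rightarrow> complex" where
  "laurent_monom \<gamma> z = (\<Prod>k\<in>UNIV. (z $ k) powi (\<gamma> k))"

definition laurent_coeff :: "'n::finite fn \<Rightarrow> ('n \<Rightarrow> int) \<Rightarrow> complex^'n \<Rightarrow> complex" where
  "laurent_coeff f \<gamma> Z =
     (LINT \<theta> | (\<Pi>\<^sub>M k\<in>UNIV. restrict_space lborel {0..1}).
        f (Z, torus_pt \<theta>) * laurent_monom (- \<gamma>) (torus_pt \<theta>))"

text \<open>Any convergent Laurent expansion has these coefficients.\<close>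

lemma laurent_coeff_unique:
  fixes c :: "('n::finite \<Rightarrow> int) \<Rightarrow> complex" and f :: "'n fn"
  assumes sum: "\<And>z. (\<forall>i. z $ i \<noteq> 0) \<Longrightarrow> ((\<lambda>\<gamma>. c \<gamma> * laurent_monom \<gamma> z) has_sum f (Z, z)) UNIV"
  shows "laurent_coeff f \<gamma> Z = c \<gamma>"
proof -
  define M :: "real measure" where "M = restrict_space lborel {0..1}"
  define P where "P = (\<Pi>\<^sub>M k\<in>(UNIV::'n set). M)"
  have spM: "emeasure M (space M) = 1"
    by (simp add: M_def space_restrict_space emeasure_restrict_space)
  interpret M: finite_measure M
    by standard (simp add: spM)
  interpret PM: product_sigma_finite "\<lambda>_::'n. M"
    by standard
  have spP: "emeasure P (space P) = 1"
    unfolding P_def space_PiM by (subst PM.emeasure_PiM) (auto simp: spM)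
  then have spP': "measure P (space P) = 1"
    by (simp add: measure_def)
  define e where "e = (\<lambda>(m::int) x. cis (2 * pi * x) powi m)"
  have e_eq: "e m x = cis (2 * pi * of_int m * x)" for m x
    by (simp add: e_def cis_power_int mult_ac)
  have cont: "continuous_on A (e m)" for A m
    unfolding e_eq by (intro continuous_intros)
  have e_meas: "e m \<in> borel_measurable M" for m
    unfolding M_def by (rule measurable_restrict_space1) (simp add: borel_measurable_continuous_onI cont)
  have e_int: "integrable M (e m)" for m
    by (rule M.integrable_const_bound[where B=1]) (auto simp: e_eq e_meas)
  have e_val: "integral\<^sup>L M (e m) = (if m = 0 then 1 else 0)" for m
  proof (cases "m = 0")
    case True
    then show ?thesis using spM by (simp add: e_def measure_def)
  next
    case False
    define F where "F = (\<lambda>x::real. cis (2 * pi * of_int m * x) / (2 * pi * of_int m * \<i>))"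
    have "(e m has_integral (F 1 - F 0)) {0..1}"
    proof (rule fundamental_theorem_of_calculus)
      fix x :: real
      show "(F has_vector_derivative e m x) (at x within {0..1})"
        unfolding F_def e_eq cis_conv_exp using False
        by (auto intro!: derivative_eq_intros has_vector_derivative_real_field simp: field_simps)
    qed simp
    moreover have "F 1 - F 0 = 0"
      using cis_multiple_2pi[of "of_int m"] by (simp add: F_def mult_ac)
    moreover have "set_integrable lborel {0..1} (e m)"
      unfolding set_integrable_def by (intro borel_integrable_compact cont) auto
    ultimately have "(LINT x:{0..1}|lborel. e m x) = 0"
      using set_borel_integral_eq_integral(2) by (metis integral_unique)
    then show ?thesis using False
      by (simp add: M_def integral_restrict_space set_lebesgue_integral_def)
  qed
  define E where "E = (\<lambda>(\<mu>::'n \<Rightarrow> int) (\<theta>::'n \<Rightarrow> real). \<Prod>k\<in>UNIV. e (\<mu> k) (\<theta> k))"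
  have E_eq: "laurent_monom \<mu> (torus_pt \<theta>) = E \<mu> \<theta>" for \<mu> \<theta>
    by (simp add: laurent_monom_def torus_pt_def E_def e_def)
  have E_int: "integrable P (E \<mu>)" for \<mu>
    unfolding P_def E_def by (rule PM.product_integrable_prod) (auto intro: e_int)
  have E_val: "integral\<^sup>L P (E \<mu>) = (if \<mu> = 0 then 1 else 0)" for \<mu>
  proof -
    have "integral\<^sup>L P (E \<mu>) = (\<Prod>k\<in>UNIV. integral\<^sup>L M (e (\<mu> k)))"
      unfolding P_def E_def by (rule PM.product_integral_prod) (auto intro: e_int)
    also have "\<dots> = (if \<mu> = 0 then 1 else 0)"
      by (auto simp: e_val fun_eq_iff)
    finally show ?thesis .
  qed
  have E_mult: "E \<mu> \<theta> * E \<nu> \<theta> = E (\<mu> + \<nu>) \<theta>" for \<mu> \<nu> \<theta>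
    by (simp add: E_def e_def prod.distrib[symmetric] power_int_add)
  have E_norm: "norm (E \<mu> \<theta>) = 1" for \<mu> \<theta>
    by (simp add: E_def e_eq prod_norm[symmetric])
  have nz: "\<forall>i. torus_pt \<theta> $ i \<noteq> 0" for \<theta> :: "'n \<Rightarrow> real"
    by (simp add: torus_pt_def)
  have sumE: "((\<lambda>\<mu>. c \<mu> * E \<mu> \<theta>) has_sum f (Z, torus_pt \<theta>)) UNIV" for \<theta>
    using sum[OF nz, of \<theta>] by (simp add: E_eq)
  have "E \<mu> 0 = 1" for \<mu> by (simp add: E_def e_eq)
  then have "c summable_on UNIV"
    using sumE[of 0] by (auto simp: summable_on_def)
  then have abs: "(\<lambda>\<mu>. norm (c \<mu>)) summable_on UNIV"
    by (simp add: summable_on_iff_abs_summable_on_complex)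
  have inf: "infinite (UNIV :: ('n \<Rightarrow> int) set)"
    by (simp add: finite_UNIV_fun)
  define b where "b = from_nat_into (UNIV :: ('n \<Rightarrow> int) set)"
  have b: "bij b"
    unfolding b_def using bij_betw_from_nat_into[OF _ inf] by simp
  have s1: "summable (\<lambda>k. norm (c (b k)))"
    using abs summable_on_reindex_bij_betw[OF b, of "\<lambda>\<mu>. norm (c \<mu>)"]
    by (auto intro: summable_on_imp_summable)
  have s2: "(\<lambda>k. c (b k) * E (b k) \<theta>) sums f (Z, torus_pt \<theta>)" for \<theta>
    using sumE[of \<theta>] has_sum_reindex_bij_betw[OF b, of "\<lambda>\<mu>. c \<mu> * E \<mu> \<theta>"]
    by (auto intro: has_sum_imp_sums)
  define G where "G = (\<lambda>k \<theta>. c (b k) * E (b k - \<gamma>) \<theta>)"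
  have "(\<lambda>k. c (b k) * E (b k) \<theta> * E (- \<gamma>) \<theta>) sums (f (Z, torus_pt \<theta>) * E (- \<gamma>) \<theta>)" for \<theta>
    by (rule sums_mult2[OF s2])
  then have G: "(\<lambda>k. G k \<theta>) sums (f (Z, torus_pt \<theta>) * E (- \<gamma>) \<theta>)" for \<theta>
    by (simp add: G_def mult.assoc E_mult)
  have Gint: "integrable P (G k)" for k
    unfolding G_def using E_int by simp
  have Gnorm: "norm (G k \<theta>) = norm (c (b k))" for k \<theta>
    by (simp add: G_def norm_mult E_norm)
  have "laurent_coeff f \<gamma> Z = (LINT \<theta>|P. (\<Sum>k. G k \<theta>))"
    unfolding laurent_coeff_def P_def M_def E_eq using G by (simp add: sums_iff)
  also have "\<dots> = (\<Sum>k. integral\<^sup>L P (G k))"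
    by (rule integral_suminf) (auto simp: Gint Gnorm s1 spP')
  also have "\<dots> = (\<Sum>k. if k = inv b \<gamma> then c \<gamma> else 0)"
  proof (rule suminf_cong)
    fix k
    have "b k - \<gamma> = 0 \<longleftrightarrow> k = inv b \<gamma>"
      using b by (metis bij_inv_eq_iff eq_iff_diff_eq_0)
    then show "integral\<^sup>L P (G k) = (if k = inv b \<gamma> then c \<gamma> else 0)"
      using b by (auto simp: G_def E_val bij_is_surj surj_f_inv_f)
  qed
  also have "\<dots> = c \<gamma>"
    using sums_unique[OF sums_single[of "inv b \<gamma>" "\<lambda>_. c \<gamma>"]] by simp
  finally show ?thesis .
qed

text \<open>The degree \<open>0\<close> parts of the \<open>t\<^sup>-\<^sup>1\<close> term of \<open>\<nabla>\<^sub>t\<close> and of the \<open>t\<^sup>0\<close> term of \<open>\<nabla>\<^sub>Z\<^sub>j\<close>.\<close>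

definition delta :: "'n::finite connection \<Rightarrow> 'n \<Rightarrow> complex^'n \<Rightarrow> complex" where
  "delta C i Z = laurent_coeff (fls_nth (vert_t C $ i) (-1)) 0 Z"

definition a_coeff :: "'n::finite connection \<Rightarrow> 'n \<Rightarrow> 'n \<Rightarrow> complex^'n \<Rightarrow> complex" where
  "a_coeff C i j Z = laurent_coeff (fls_nth (vert_Z C j $ i) 0) 0 Z"

text \<open>A \<open>1\<close>-form on \<open>U\<close> assigns to each point a linear form on the tangent space.\<close>

definition alpha :: "'n::finite connection \<Rightarrow> 'n \<Rightarrow> complex^'n \<Rightarrow> (complex^'n \<Rightarrow> complex)" where
  "alpha C i Z = (\<lambda>h. \<Sum>j\<in>UNIV. a_coeff C i j Z * h $ j)"

section \<open>Gauge transformations\<close>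

definition Lie_H :: "(complex^'n) set \<Rightarrow> 'n vseries set" where
  "Lie_H U = {vfield_series h |h. h 0 = 0 \<and> (\<forall>l\<ge>1. h l \<in> g_an U)}"

text \<open>
  The exponential series converges in the \<open>t\<close>-adic metric of \<^typ>\<open>'a fls\<close>. The pronilpotent group
  consists of the automorphisms \<open>exp h\<close> of the algebra of formal functions, i.e. the changes of
  trivialization that are the identity at \<open>t = 0\<close>; they are made extensional so that their equality is equality on formal functions.
\<close>

definition vexp :: "(complex^'n) set \<Rightarrow> 'n vseries \<Rightarrow> 'n fn fls \<Rightarrow> 'n fn fls" where
  "vexp U h F = (\<Sum>k. fls_const (\<lambda>_. 1 / fact k) * (vact U h ^^ k) F)"

lemma euler_0: "euler U i 0 = 0"
  by (auto simp: euler_def fun_eq_iff zero_fun_def)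


lemma vact_nth_eq_0:
  assumes h: "h \<in> Lie_H U" and F: "\<And>k. k < d \<Longrightarrow> fls_nth F k = 0" and m: "m < d + 1"
  shows "fls_nth (vact U h F) m = 0"
proof -
  have "fls_nth (h $ i * fls_map (euler U i) F) m = 0" for i
  proof (cases "h $ i = 0 \<or> fls_map (euler U i) F = 0")
    case False
    have "fls_subdegree (h $ i) \<ge> 1"
      using h False by (intro fls_subdegree_geI) (auto simp: Lie_H_def vfield_series_def)
    moreover have "fls_subdegree (fls_map (euler U i) F) \<ge> d"
      using False F by (intro fls_subdegree_geI) (auto simp: fls_map_nth euler_0)
    ultimately show ?thesis
      using m by (intro fls_times_nth_eq0) linarith
  qed auto
  then show ?thesis
    by (simp add: vact_def fls_nth_sum)
qed

lemma vact_funpow_nth_eq_0: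
  assumes "h \<in> Lie_H U" "m < fls_subdegree F + int k"
  shows "fls_nth ((vact U h ^^ k) F) m = 0"
  using assms(2)
proof (induction k arbitrary: m)
  case 0
  then show ?case by simp
next
  case (Suc k)
  have "fls_nth (vact U h ((vact U h ^^ k) F)) m = 0"
    by (rule vact_nth_eq_0[OF assms(1) Suc.IH]) (use Suc.prems in auto)
  then show ?case by (simp only: funpow.simps o_apply)
qed

lemma sums_flsI:
  fixes f :: "nat \<Rightarrow> 'a::ab_group_add fls"
  assumes "\<And>m k. k \<ge> N m \<Longrightarrow> (\<Sum>j<k. fls_nth (f j) m) = fls_nth L m"
    and "\<And>m m'. m \<le> m' \<Longrightarrow> N m \<le> N m'"
  shows "f sums L"
  unfolding sums_def
proof (rule metric_LIMSEQ_I)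
  fix r :: real assume "r > 0"
  then obtain p where p: "(1/2) ^ p < r"
    using real_arch_pow_inv[of r "1/2"] by auto
  have "dist (sum f {..<k}) L < r" if k: "k \<ge> N (int p)" for k
  proof (cases "sum f {..<k} = L")
    case False
    have "fls_subdegree (sum f {..<k} - L) \<ge> int p"
    proof (rule fls_subdegree_geI)
      fix m assume "m < int p"
      then have "k \<ge> N m" using assms(2)[of m "int p"] k by simp
      then show "fls_nth (sum f {..<k} - L) m = 0"
        using assms(1) by (simp add: fls_nth_sum)
    qed (use False in simp)
    then have sd: "fls_subdegree (sum f {..<k} - L) \<ge> 0"
      "nat (fls_subdegree (sum f {..<k} - L)) \<ge> p" by linarith+
    then have "dist (sum f {..<k}) L \<le> (1/2) ^ p"
      using False power_increasing[OF sd(2), of "2::real"]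
      by (simp add: dist_fls_def power_one_over inverse_eq_divide frac_le)
    then show ?thesis using p by simp
  qed (use \<open>r > 0\<close> in simp)
  then show "\<exists>no. \<forall>n\<ge>no. dist (sum f {..<n}) L < r" by blast
qed

lemma
  assumes h: "h \<in> Lie_H U"
  shows vexp_sums: "(\<lambda>k. fls_const (\<lambda>_. 1 / fact k) * (vact U h ^^ k) F) sums vexp U h F"
    and vexp_nth: "int N > m - fls_subdegree F \<Longrightarrow>
      fls_nth (vexp U h F) m = (\<Sum>k<N. (\<lambda>p. fls_nth ((vact U h ^^ k) F) m p / fact k))"
proof -
  define f where "f = (\<lambda>k. fls_const (\<lambda>_::'a pt. 1 / fact k :: complex) * (vact U h ^^ k) F)"
  have f_nth: "fls_nth (f k) m = (\<lambda>p. fls_nth ((vact U h ^^ k) F) m p / fact k)" for k m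
    by (simp add: f_def fun_eq_iff)
  have f0: "fls_nth (f k) m = 0" if "m < fls_subdegree F + int k" for k m
    unfolding f_nth using vact_funpow_nth_eq_0[OF h that] by (simp add: fun_eq_iff)
  define N' where "N' = (\<lambda>m. nat (m - fls_subdegree F + 1))"
  define L where "L = Abs_fls (\<lambda>m. \<Sum>k<N' m. fls_nth (f k) m)"
  have tail: "(\<Sum>j<k. fls_nth (f j) m) = (\<Sum>j<N' m. fls_nth (f j) m)" if "k \<ge> N' m" for k m
    using that f0 by (intro sum.mono_neutral_right) (auto simp: N'_def)
  have L: "fls_nth L m = (\<Sum>k<N' m. fls_nth (f k) m)" for m
    unfolding L_def by (rule nth_Abs_fls_lower_bound[of "fls_subdegree F"]) (auto simp: N'_def)
  have "f sums L"
  proof (rule sums_flsI[where N = N'])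
    show "(\<Sum>j<k. fls_nth (f j) m) = fls_nth L m" if "k \<ge> N' m" for m k
      unfolding L by (rule tail[OF that])
  qed (auto simp: N'_def)
  then have "f sums vexp U h F" "vexp U h F = L"
    by (auto simp: vexp_def f_def sums_iff)
  then show "(\<lambda>k. fls_const (\<lambda>_. 1 / fact k) * (vact U h ^^ k) F) sums vexp U h F"
    by (simp add: f_def)
  show "fls_nth (vexp U h F) m = (\<Sum>k<N. (\<lambda>p. fls_nth ((vact U h ^^ k) F) m p / fact k))"
    if "int N > m - fls_subdegree F"
  proof -
    have "N' m \<le> N" using that by (simp add: N'_def)
    from tail[OF this] show ?thesis
      unfolding \<open>vexp U h F = L\<close> L f_nth by simp
  qed
qed

definition gauge_group :: "(complex^'n) set \<Rightarrow> ('n fn fls \<Rightarrow> 'n fn fls) set" where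
  "gauge_group U = {restrict (vexp U h) (formal_functions U) |h. h \<in> Lie_H U}"

text \<open>\<open>g \<circ> \<nabla> \<circ> g\<^sup>-\<^sup>1 = \<nabla>'\<close>\<close>

definition gauge_transforms ::
  "(complex^'n) set \<Rightarrow> ('n fn fls \<Rightarrow> 'n fn fls) \<Rightarrow> 'n connection \<Rightarrow> 'n connection \<Rightarrow> bool" where
  "gauge_transforms U g C C' \<longleftrightarrow> (\<forall>F\<in>formal_functions U.
     g (nabla_t U C F) = nabla_t U C' (g F) \<and>
     (\<forall>j. g (nabla_Z U C j F) = nabla_Z U C' j (g F)))"

end

theory Submission
  imports Defs
begin

text \<open>
  A gauge transformation \<open>g\<close> from \<open>\<nabla>\<close> to the standard connection is determined by the formal functions
  \<open>g\<^sup>-\<^sup>1 z\<^sub>i = z\<^sub>i u\<^sub>i\<close>, on which \<open>\<nabla>\<close> acts as the standard connection acts on \<open>z\<^sub>i\<close>. For each \<open>i\<close> this is a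
  compatible system of scalar linear equations \<open>T u = 0\<close>, \<open>S\<^sub>j u = 0\<close> for \<open>u = u\<^sub>i = 1 + O(t)\<close>, which is solved
  order by order in \<open>t\<close>: the part of the residual that depends on \<open>z\<close> is removed by a primitive of a closed
  family of functions under the operators \<open>z\<^sub>j \<partial>/\<partial>z\<^sub>j\<close>, the rest by integrating in \<open>t\<close>, and the only
  obstructions are the means \<open>\<delta>\<^sub>i\<close> and \<open>a\<^sub>i\<^sub>j\<close> at the lowest order. The same analysis of leading terms shows
  that the solution is unique.

  Primitives are obtained without Laurent expansions, by integrating over circles in the fibre against
  \<open>\<theta> - 1/2\<close>. There is exactly one vertical \<open>\<eta> = O(t)\<close> with \<open>exp \<eta> z\<^sub>i = z\<^sub>i u\<^sub>i\<close> for all \<open>i\<close>; the conjugate of the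
  standard connection by \<open>exp \<eta>\<close> is again a connection, and it agrees with \<open>\<nabla>\<close> on the \<open>z\<^sub>i u\<^sub>i\<close>, hence
  everywhere.
\<close>

text \<open>In terms of \<open>h\<close>, conjugation by \<open>exp h\<close> is a non-linear
  problem. In terms of the images of the coordinates it is linear, and the systems for the different
  u_i decouple. Flatness enters as commutation of T and S_j: it makes the leading residuals of the
  S_j a closed family, and the primitive of this family also removes the part of the leading
  residual of T that depends on z. Adding c t^m with c independent of z changes the leading residual
  of T by m c up to a term of mean zero. For m \<ge> 1 this is invertible, which gives both
  solvability and uniqueness. For m = 0 there is no such freedom, since u is normalized to 1 at t =
  0; hence the invariants obstruct at the lowest order only. Dividing a Laurent series by its
  exponents would require a proof that the new series is again holomorphic. Integral operators avoid
  this, since they can be differentiated under the integral sign. Holomorphy is given only as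
  complex differentiability at each point, so even the continuity of derivatives has to be drawn
  from Cauchy's formula.\<close>

declare split_paired_All [simp del] split_paired_Ex [simp del]

section \<open>Holomorphic functions on the total space\<close>

lemma sum_times_if_eq:
  fixes f :: "'a::finite \<Rightarrow> complex"
  shows "(\<Sum>i\<in>UNIV. f i * (if i = j then x else 0)) = f j * x"
  by (simp add: if_distrib[of "\<lambda>y. _ * y"] sum.delta cong: if_cong)

lemma bounded_linear_axis: "bounded_linear (axis j :: complex \<Rightarrow> complex^'n)"
  unfolding linear_conv_bounded_linear[symmetric]
  by (rule linearI) (auto simp: axis_def vec_eq_iff)

lemma has_derivative_line_Z:
  fixes Z z :: "complex^'n"
  shows "((\<lambda>s. ((\<chi> k. if k = j then s else Z $ k), z)) has_derivative
    (\<lambda>s. ((\<chi> k. if k = j then s else 0), 0))) (at s0)"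
proof (rule has_derivative_Pair)
  have "((\<lambda>s. axis j s + (\<chi> k. if k = j then 0 else Z $ k)) has_derivative (\<lambda>s. axis j s)) (at s0)"
    by (rule has_derivative_add_const[OF bounded_linear_imp_has_derivative[OF bounded_linear_axis]])
  moreover have "(\<lambda>s. axis j s + (\<chi> k. if k = j then 0 else Z $ k)) = (\<lambda>s. \<chi> k. if k = j then s else Z $ k)"
    by (auto simp: fun_eq_iff vec_eq_iff axis_def)
  moreover have "(\<lambda>s::complex. axis j s) = (\<lambda>s. \<chi> k. if k = j then s else 0)"
    by (auto simp: fun_eq_iff vec_eq_iff axis_def)
  ultimately show "((\<lambda>s. \<chi> k. if k = j then s else Z $ k) has_derivative
    (\<lambda>s. \<chi> k. if k = j then s else 0)) (at s0)" by simp
qed (simp)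

lemma has_derivative_line_z:
  fixes Z z :: "complex^'n"
  shows "((\<lambda>s. (Z, (\<chi> k. if k = j then s else z $ k))) has_derivative
    (\<lambda>s. (0, (\<chi> k. if k = j then s else 0)))) (at s0)"
proof -
  have "((\<lambda>p. (snd p, fst p)) \<circ> (\<lambda>s. ((\<chi> k. if k = j then s else z $ k), Z)) has_derivative
     (\<lambda>p. (snd p, fst p)) \<circ> (\<lambda>s. ((\<chi> k. if k = j then s else 0), 0))) (at s0)"
    by (rule diff_chain_at[OF has_derivative_line_Z])
      (auto intro!: derivative_eq_intros)
  then show ?thesis by (simp add: o_def)
qed

text \<open>The complex differential at a point of the total space; \<open>b\<close> holds the
  ordinary derivatives in z_i, so Euler derivatives enter it divided by z_i.\<close>

definition pair_form :: "('n::finite \<Rightarrow> complex) \<Rightarrow> ('n \<Rightarrow> complex) \<Rightarrow> 'n pt \<Rightarrow> complex" where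
  "pair_form a b h = (\<Sum>i\<in>UNIV. a i * fst h $ i) + (\<Sum>i\<in>UNIV. b i * snd h $ i)"

lemma bounded_linear_pair_form: "bounded_linear (pair_form a b)"
  unfolding pair_form_def
  by (intro bounded_linear_add bounded_linear_sum bounded_linear_const_mult
      bounded_linear_compose[OF bounded_linear_vec_nth] bounded_linear_fst bounded_linear_snd)

lemma pair_form_add: "pair_form a b h + pair_form a' b' h = pair_form (\<lambda>i. a i + a' i) (\<lambda>i. b i + b' i) h"
  and pair_form_mult: "c * pair_form a b h = pair_form (\<lambda>i. c * a i) (\<lambda>i. c * b i) h"
  by (simp_all add: pair_form_def sum_distrib_left sum.distrib sum_subtractf algebra_simps)

locale open_base =
  fixes U :: "(complex^'n::finite) set"
  assumes open_U: "open U"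
begin

abbreviation "TS \<equiv> total_space U"
abbreviation "OU \<equiv> O_an U"
abbreviation "eu \<equiv> euler U"
abbreviation "pz \<equiv> partial_Z U"

lemma open_TS: "open TS"
proof -
  have "open {z::complex^'n. \<forall>i. z $ i \<noteq> 0}"
    unfolding Collect_all_eq by (intro open_INT ballI open_Collect_neq continuous_intros) simp
  then show ?thesis
    unfolding total_space_def using open_U by (rule open_Times[rotated])
qed

lemma TS_iff: "(Z, z) \<in> TS \<longleftrightarrow> Z \<in> U \<and> (\<forall>i. z $ i \<noteq> 0)"
  by (auto simp: total_space_def)

lemma TS_nz: "p \<in> TS \<Longrightarrow> snd p $ i \<noteq> 0"
  by (cases p) (auto simp: TS_iff)

lemma pair_form_derivs:
  assumes p: "p \<in> TS" and d: "(f has_derivative pair_form a b) (at p)"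
  shows "pz j f p = a j" "eu j f p = snd p $ j * b j"
proof -
  obtain Z z where pe: "p = (Z, z)" by (cases p)
  have ZZ: "(\<chi> k. if k = j then Z $ j else Z $ k) = Z" "(\<chi> k. if k = j then z $ j else z $ k) = z"
    by (auto simp: vec_eq_iff)
  have "(f has_derivative pair_form a b) (at ((\<chi> k. if k = j then Z $ j else Z $ k), z))"
    using d by (simp add: pe ZZ)
  from has_derivative_compose[OF has_derivative_line_Z this]
  have "((\<lambda>s. f ((\<chi> k. if k = j then s else Z $ k), z)) has_derivative (\<lambda>s. a j * s)) (at (Z $ j))"
    by (simp add: pair_form_def sum_times_if_eq)
  then have "((\<lambda>s. f ((\<chi> k. if k = j then s else Z $ k), z)) has_field_derivative a j) (at (Z $ j))"
    by (simp add: has_field_derivative_def)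
  then show "pz j f p = a j"
    using p by (auto simp: partial_Z_def pe DERIV_imp_deriv)
  have "(f has_derivative pair_form a b) (at (Z, (\<chi> k. if k = j then z $ j else z $ k)))"
    using d by (simp add: pe ZZ)
  from has_derivative_compose[OF has_derivative_line_z this]
  have "((\<lambda>s. f (Z, (\<chi> k. if k = j then s else z $ k))) has_derivative (\<lambda>s. b j * s)) (at (z $ j))"
    by (simp add: pair_form_def sum_times_if_eq)
  then have "((\<lambda>s. f (Z, (\<chi> k. if k = j then s else z $ k))) has_field_derivative b j) (at (z $ j))"
    by (simp add: has_field_derivative_def)
  then show "eu j f p = snd p $ j * b j"
    using p by (auto simp: euler_def pe DERIV_imp_deriv)
qed

lemma O_an_I:
  assumes "\<And>p. p \<in> TS \<Longrightarrow> \<exists>a b. (f has_derivative pair_form a b) (at p)"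
    and "\<And>p. p \<notin> TS \<Longrightarrow> f p = 0"
  shows "f \<in> OU"
proof -
  have "\<exists>a b. (f has_derivative
        (\<lambda>h. (\<Sum>i\<in>UNIV. a i * fst h $ i) + (\<Sum>i\<in>UNIV. b i * snd h $ i))) (at p)" if "p \<in> TS" for p
    using assms(1)[OF that] unfolding pair_form_def[abs_def] .
  then show ?thesis
    using assms(2) by (simp add: O_an_def holomorphic_pair_on_def)
qed

lemma O_an_zero: "f \<in> OU \<Longrightarrow> p \<notin> TS \<Longrightarrow> f p = 0"
  unfolding O_an_def by blast

text \<open>A normal form for the differential: sums, products and integrals are then differentiated
  by comparing coefficients of \<open>pair_form\<close>.\<close>

lemma O_an_deriv:
  assumes "f \<in> OU" "p \<in> TS"
  shows "(f has_derivative pair_form (\<lambda>i. pz i f p) (\<lambda>i. eu i f p / snd p $ i)) (at p)"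
proof -
  obtain a b where d: "(f has_derivative pair_form a b) (at p)"
    using assms unfolding O_an_def holomorphic_pair_on_def pair_form_def[abs_def] by blast
  have "(\<lambda>i. pz i f p) = a" "(\<lambda>i. eu i f p / snd p $ i) = b"
    using pair_form_derivs[OF assms(2) d] TS_nz[OF assms(2)] by (auto simp: fun_eq_iff)
  with d show ?thesis by simp
qed

lemma eu_zero: "p \<notin> TS \<Longrightarrow> eu i f p = 0"
  and pz_zero: "p \<notin> TS \<Longrightarrow> pz i f p = 0"
  by (cases p; auto simp: euler_def partial_Z_def)+

lemma fn_eqI:
  assumes "\<And>p. p \<in> TS \<Longrightarrow> f p = g p" "\<And>p. p \<notin> TS \<Longrightarrow> f p = 0" "\<And>p. p \<notin> TS \<Longrightarrow> g p = 0"
  shows "f = g"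
  using assms by (metis ext)

lemma O_an_cont: "f \<in> OU \<Longrightarrow> continuous_on TS f"
  by (meson O_an_deriv continuous_at_imp_continuous_on has_derivative_continuous)

lemma O_an_add:
  assumes "f \<in> OU" "g \<in> OU"
  shows "f + g \<in> OU" "eu i (f + g) = eu i f + eu i g" "pz i (f + g) = pz i f + pz i g"
proof -
  have d: "(f + g has_derivative pair_form (\<lambda>i. pz i f p + pz i g p)
     (\<lambda>i. eu i f p / snd p $ i + eu i g p / snd p $ i)) (at p)" if "p \<in> TS" for p
    using has_derivative_add[OF O_an_deriv[OF assms(1) that] O_an_deriv[OF assms(2) that]]
    by (simp add: pair_form_add plus_fun_def)
  show "f + g \<in> OU" by (rule O_an_I) (use d O_an_zero[OF assms(1)] O_an_zero[OF assms(2)] in \<open>auto simp del: split_paired_All\<close>)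
  show "eu i (f + g) = eu i f + eu i g"
  proof
    fix p show "eu i (f + g) p = (eu i f + eu i g) p"
      by (cases "p \<in> TS") (auto simp: eu_zero pair_form_derivs(2)[OF _ d] TS_nz field_simps)
  qed
  show "pz i (f + g) = pz i f + pz i g"
  proof
    fix p show "pz i (f + g) p = (pz i f + pz i g) p"
      by (cases "p \<in> TS") (auto simp: pz_zero pair_form_derivs(1)[OF _ d])
  qed
qed

lemma O_an_mult:
  assumes "f \<in> OU" "g \<in> OU"
  shows "f * g \<in> OU" "eu i (f * g) = f * eu i g + eu i f * g" "pz i (f * g) = f * pz i g + pz i f * g"
proof -
  have d: "(f * g has_derivative pair_form (\<lambda>i. f p * pz i g p + g p * pz i f p)
     (\<lambda>i. f p * (eu i g p / snd p $ i) + g p * (eu i f p / snd p $ i))) (at p)" if "p \<in> TS" for p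
    using has_derivative_mult[OF O_an_deriv[OF assms(1) that] O_an_deriv[OF assms(2) that]]
    by (simp add: pair_form_add pair_form_mult times_fun_def mult.commute[of "pair_form _ _ _"])
  show "f * g \<in> OU" by (rule O_an_I) (use d O_an_zero[OF assms(1)] O_an_zero[OF assms(2)] in \<open>auto simp del: split_paired_All\<close>)
  show "eu i (f * g) = f * eu i g + eu i f * g"
  proof
    fix p show "eu i (f * g) p = (f * eu i g + eu i f * g) p"
      by (cases "p \<in> TS") (auto simp: eu_zero pair_form_derivs(2)[OF _ d] TS_nz field_simps)
  qed
  show "pz i (f * g) = f * pz i g + pz i f * g"
  proof
    fix p show "pz i (f * g) p = (f * pz i g + pz i f * g) p"
      by (cases "p \<in> TS") (auto simp: pz_zero pair_form_derivs(1)[OF _ d])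
  qed
qed

text \<open>Elements of \<open>OU\<close> vanish off the total space, so the constant function 1 is
  not among them; \<open>unit_fun\<close> is the unit element of this ring.\<close>

definition unit_fun :: "'n fn" where "unit_fun p = (if p \<in> TS then 1 else 0)"

definition Z_coord :: "'n \<Rightarrow> 'n fn" where "Z_coord i p = (if p \<in> TS then fst p $ i else 0)"
definition z_coord :: "'n \<Rightarrow> 'n fn" where "z_coord i p = (if p \<in> TS then snd p $ i else 0)"
definition z_inv :: "'n \<Rightarrow> 'n fn" where "z_inv i p = (if p \<in> TS then inverse (snd p $ i) else 0)"
definition const_fun :: "complex \<Rightarrow> 'n fn" where "const_fun c p = (if p \<in> TS then c else 0)"

text \<open>The total space is open, so extension by 0 does not affect derivatives at its
  points.\<close>

lemma O_an_on_TS: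
  assumes "\<And>p. p \<in> TS \<Longrightarrow> (g has_derivative pair_form (a p) (b p)) (at p)"
  defines "f \<equiv> \<lambda>p. if p \<in> TS then g p else 0"
  shows "f \<in> OU" "p \<in> TS \<Longrightarrow> eu i f p = snd p $ i * b p i" "p \<in> TS \<Longrightarrow> pz i f p = a p i"
proof -
  have d: "(f has_derivative pair_form (a p) (b p)) (at p)" if "p \<in> TS" for p
    by (rule has_derivative_transform_within_open[OF assms(1)[OF that] open_TS that]) (simp add: f_def)
  show "f \<in> OU" by (rule O_an_I) (use d in \<open>auto simp: f_def\<close>)
  show "p \<in> TS \<Longrightarrow> eu i f p = snd p $ i * b p i" "p \<in> TS \<Longrightarrow> pz i f p = a p i"
    by (simp_all only: pair_form_derivs[OF _ d])
qed

lemma const_fun_props: "const_fun c \<in> OU" "eu i (const_fun c) = 0" "pz i (const_fun c) = 0"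
proof -
  have d: "((\<lambda>_. c) has_derivative pair_form (\<lambda>_. 0) (\<lambda>_. 0)) (at p)" for p :: "'n pt"
    by (simp add: pair_form_def[abs_def])
  have eq: "const_fun c = (\<lambda>p. if p \<in> TS then c else 0)" by (simp add: const_fun_def fun_eq_iff)
  note * = O_an_on_TS[of "\<lambda>_. c", OF d, folded eq]
  show "const_fun c \<in> OU" by (rule *(1))
  show "eu i (const_fun c) = 0" "pz i (const_fun c) = 0"
    by (rule fn_eqI, simp_all add: * eu_zero pz_zero)+
qed

lemma unit_fun_cst: "unit_fun = const_fun 1" by (auto simp: unit_fun_def const_fun_def)

lemma unit_fun_props: "unit_fun \<in> OU" "eu i unit_fun = 0" "pz i unit_fun = 0"
  using const_fun_props[where c=1] by (simp_all add: unit_fun_cst)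

lemma zero_O: "0 \<in> OU"
  by (rule O_an_I) (auto intro!: exI[of _ "\<lambda>_. 0"] simp: pair_form_def[abs_def] zero_fun_def)

lemma Z_coord_props: "Z_coord j \<in> OU" "eu i (Z_coord j) = 0" "pz i (Z_coord j) = (if i = j then unit_fun else 0)"
proof -
  have d: "((\<lambda>p. fst p $ j) has_derivative pair_form (\<lambda>i. if i = j then 1 else 0) (\<lambda>_. 0)) (at p)" for p :: "'n pt"
  proof -
    have "pair_form (\<lambda>i. if i = j then 1 else 0) (\<lambda>_. 0) = (\<lambda>p :: 'n pt. fst p $ j)"
      by (auto simp: pair_form_def fun_eq_iff if_distrib[of "\<lambda>y. y * _"] cong: if_cong)
    then show ?thesis
      by (auto intro!: bounded_linear_imp_has_derivative bounded_linear_compose[OF bounded_linear_vec_nth] bounded_linear_fst)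
  qed
  have eq: "Z_coord j = (\<lambda>p. if p \<in> TS then fst p $ j else 0)" by (simp add: Z_coord_def fun_eq_iff)
  note * = O_an_on_TS[of "\<lambda>p. fst p $ j", OF d, folded eq]
  show "Z_coord j \<in> OU" by (rule *(1))
  show "eu i (Z_coord j) = 0" "pz i (Z_coord j) = (if i = j then unit_fun else 0)"
    by (rule fn_eqI, auto simp add: * eu_zero pz_zero unit_fun_def)+
qed

lemma z_coord_props: "z_coord j \<in> OU" "eu i (z_coord j) = (if i = j then z_coord j else 0)" "pz i (z_coord j) = 0"
proof -
  have d: "((\<lambda>p. snd p $ j) has_derivative pair_form (\<lambda>_. 0) (\<lambda>i. if i = j then 1 else 0)) (at p)" for p :: "'n pt"
  proof -
    have "pair_form (\<lambda>_. 0) (\<lambda>i. if i = j then 1 else 0) = (\<lambda>p :: 'n pt. snd p $ j)"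
      by (auto simp: pair_form_def fun_eq_iff if_distrib[of "\<lambda>y. y * _"] cong: if_cong)
    then show ?thesis
      by (auto intro!: bounded_linear_imp_has_derivative bounded_linear_compose[OF bounded_linear_vec_nth] bounded_linear_snd)
  qed
  have eq: "z_coord j = (\<lambda>p. if p \<in> TS then snd p $ j else 0)" by (simp add: z_coord_def fun_eq_iff)
  note * = O_an_on_TS[of "\<lambda>p. snd p $ j", OF d, folded eq]
  show "z_coord j \<in> OU" by (rule *(1))
  show "eu i (z_coord j) = (if i = j then z_coord j else 0)" "pz i (z_coord j) = 0"
    by (rule fn_eqI, auto simp add: * eu_zero pz_zero z_coord_def)+
qed

lemma z_inv_O: "z_inv j \<in> OU"
proof -
  have d: "((\<lambda>p. inverse (snd p $ j)) has_derivative
     pair_form (\<lambda>_. 0) (\<lambda>i. if i = j then - (inverse (snd p $ j) * inverse (snd p $ j)) else 0)) (at p)"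
    if "p \<in> TS" for p
  proof -
    have "pair_form (\<lambda>_. 0) (\<lambda>i. if i = j then c else 0) = (\<lambda>p :: 'n pt. c * snd p $ j)" for c
      by (auto simp: pair_form_def fun_eq_iff if_distrib[of "\<lambda>y. y * _"] cong: if_cong)
    moreover have "((\<lambda>p::'n pt. snd p $ j) has_derivative (\<lambda>p. snd p $ j)) (at p)"
      by (auto intro!: bounded_linear_imp_has_derivative bounded_linear_compose[OF bounded_linear_vec_nth] bounded_linear_snd)
    from Deriv.has_derivative_inverse[OF TS_nz[OF that, of j] this]
    have "((\<lambda>p. inverse (snd p $ j)) has_derivative (\<lambda>h. - (inverse (snd p $ j) * snd h $ j * inverse (snd p $ j)))) (at p)" .
    ultimately show ?thesis by (simp add: mult_ac)
  qed
  show ?thesis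
    using O_an_on_TS(1)[of "\<lambda>p. inverse (snd p $ j)", OF d] by (simp add: z_inv_def[abs_def])
qed

lemma z_inv_zc: "z_inv j * z_coord j = unit_fun" "z_coord j * z_inv j = unit_fun"
  by (rule fn_eqI, simp_all add: z_inv_def z_coord_def unit_fun_def TS_nz)+

lemma unit_fun_mult: "f \<in> OU \<Longrightarrow> unit_fun * f = f" "f \<in> OU \<Longrightarrow> f * unit_fun = f"
  by (rule fn_eqI, simp_all add: unit_fun_def O_an_zero)+

lemma const_fun_mult_O:
  assumes "f \<in> OU"
  shows "(\<lambda>p. c * f p) \<in> OU" "eu i (\<lambda>p. c * f p) = (\<lambda>p. c * eu i f p)" "pz i (\<lambda>p. c * f p) = (\<lambda>p. c * pz i f p)"
proof -
  have *: "const_fun c * f = (\<lambda>p. c * f p)"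
    by (rule fn_eqI) (simp_all add: const_fun_def O_an_zero[OF assms])
  have "(const_fun c * eu i f) = (\<lambda>p. c * eu i f p)" "(const_fun c * pz i f) = (\<lambda>p. c * pz i f p)"
    by (rule fn_eqI, simp_all add: const_fun_def eu_zero pz_zero)+
  then show "(\<lambda>p. c * f p) \<in> OU" "eu i (\<lambda>p. c * f p) = (\<lambda>p. c * eu i f p)" "pz i (\<lambda>p. c * f p) = (\<lambda>p. c * pz i f p)"
    using O_an_mult[OF const_fun_props(1)[where c=c] assms] by (simp_all add: * const_fun_props)
qed

end

section \<open>Parametric integrals and derivatives\<close>

definition move :: "complex^'n \<Rightarrow> complex^'n \<Rightarrow> 'n::finite pt \<Rightarrow> 'n pt" where
  "move a c p = (fst p + a, \<chi> i. c $ i * snd p $ i)"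

text \<open>A weighted average over translates in Z and rescalings in z. Cauchy's formula for either
  derivative and the means over circles in the fibre all have this form, so one differentiation
  lemma serves them all.\<close>

definition int_op :: "(real \<Rightarrow> complex) \<Rightarrow> (real \<Rightarrow> complex^'n) \<Rightarrow> (real \<Rightarrow> complex^'n) \<Rightarrow> 'n::finite fn \<Rightarrow> 'n fn" where
  "int_op \<phi> a c f p = integral {0..1} (\<lambda>\<theta>. \<phi> \<theta> * f (move (a \<theta>) (c \<theta>) p))"

lemma has_derivative_move:
  fixes p :: "'n::finite pt"
  shows "(move a c has_derivative (\<lambda>h. (fst h, \<chi> i. c $ i * snd h $ i))) (at p)"
proof -
  have "bounded_linear (\<lambda>h::'n pt. \<chi> i. c $ i * snd h $ i)"
    by (subst linear_conv_bounded_linear[symmetric])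
      (auto intro!: linearI simp: vec_eq_iff algebra_simps)
  then show ?thesis
    unfolding move_def[abs_def]
    by (intro has_derivative_Pair has_derivative_add_const bounded_linear_imp_has_derivative bounded_linear_fst)
qed

context open_base begin

text \<open>\<open>S\<close> is only a local domain because translation in Z may leave U, while
  rescaling by nonzero factors is possible on the whole total space.\<close>

definition admissible :: "(real \<Rightarrow> complex) \<Rightarrow> (real \<Rightarrow> complex^'n) \<Rightarrow> (real \<Rightarrow> complex^'n) \<Rightarrow> 'n pt set \<Rightarrow> bool" where
  "admissible \<phi> a c S \<longleftrightarrow> continuous_on {0..1} \<phi> \<and> continuous_on {0..1} a \<and> continuous_on {0..1} c \<and>
     open S \<and> S \<subseteq> TS \<and> (\<forall>p\<in>S. \<forall>\<theta>\<in>{0..1}. move (a \<theta>) (c \<theta>) p \<in> TS)"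

lemma continuous_on_integrand:
  assumes ad: "admissible \<phi> a c S" and f: "continuous_on TS f"
  shows "continuous_on (S \<times> {0..1}) (\<lambda>x. \<phi> (snd x) * f (move (a (snd x)) (c (snd x)) (fst x)))"
proof -
  have cs: "continuous_on (S \<times> {0..1}) (\<lambda>x. g (snd x))" if "continuous_on {0..1} g"
    for g :: "real \<Rightarrow> 'b::topological_space"
    by (rule continuous_on_compose2[OF that continuous_on_snd[OF continuous_on_id]]) auto
  have m: "continuous_on (S \<times> {0..1}) (\<lambda>x. move (a (snd x)) (c (snd x)) (fst x))"
    using ad unfolding move_def admissible_def
    by (intro continuous_intros cs) auto
  show ?thesis
    by (intro continuous_on_mult cs continuous_on_compose2[OF f m])
      (use ad in \<open>auto simp: admissible_def\<close>)
qed

lemma continuous_on_integrand1: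
  assumes ad: "admissible \<phi> a c S" and f: "continuous_on TS f" and p: "p \<in> S"
  shows "continuous_on {0..1} (\<lambda>\<theta>. \<phi> \<theta> * f (move (a \<theta>) (c \<theta>) p))"
proof -
  have "continuous_on {0..1} (\<lambda>\<theta>. (p, \<theta>))" by (intro continuous_intros)
  from continuous_on_compose2[OF continuous_on_integrand[OF ad f] this] p
  show ?thesis by auto
qed

lemma int_op_cont:
  assumes "admissible \<phi> a c S" "continuous_on TS f"
  shows "continuous_on S (int_op \<phi> a c f)"
proof -
  have "continuous_on (S \<times> cbox 0 1) (\<lambda>(x, t). \<phi> t * f (move (a t) (c t) x))"
    using continuous_on_integrand[OF assms] by (simp add: case_prod_unfold)
  from integral_continuous_on_param[OF this]
  show ?thesis by (simp add: int_op_def[abs_def])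
qed

text \<open>Rescaling by c_i multiplies the ordinary derivative in z_i by c_i and the coordinate of
  the point of evaluation by the same factor, so Euler derivatives pass through the integral
  unchanged. \<open>A\<close> and \<open>B\<close> stand for the derivatives \<open>pz i f\<close>
  and \<open>eu i f\<close>, whose continuity is an assumption here and is supplied later from
  Cauchy's formula.\<close>

lemma int_op_deriv:
  assumes ad: "admissible \<phi> a c S" and p0: "p0 \<in> S"
    and f: "\<And>q. q \<in> TS \<Longrightarrow> (f has_derivative pair_form (\<lambda>i. A i q) (\<lambda>i. B i q / snd q $ i)) (at q)"
    and A: "\<And>i. continuous_on TS (A i)" and B: "\<And>i. continuous_on TS (B i)"
  shows "(int_op \<phi> a c f has_derivative
    pair_form (\<lambda>i. int_op \<phi> a c (A i) p0) (\<lambda>i. int_op \<phi> a c (B i) p0 / snd p0 $ i)) (at p0)"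
proof -
  obtain e where e: "e > 0" "ball p0 e \<subseteq> S"
    using ad p0 unfolding admissible_def by (meson open_contains_ball)
  define mv where "mv = (\<lambda>x t. move (a t) (c t) x)"
  define D where "D = (\<lambda>x t. pair_form (\<lambda>i. \<phi> t * A i (mv x t)) (\<lambda>i. \<phi> t * B i (mv x t) / snd x $ i))"
  define fx where "fx = (\<lambda>x t. Blinfun (D x t))"
  have fx: "blinfun_apply (fx x t) = D x t" for x t
    unfolding fx_def D_def by (rule bounded_linear_Blinfun_apply[OF bounded_linear_pair_form])
  have STS: "S \<subseteq> TS" and mvTS: "\<And>x t. x \<in> S \<Longrightarrow> t \<in> {0..1} \<Longrightarrow> mv x t \<in> TS"
    using ad by (auto simp: admissible_def mv_def)
  have der: "((\<lambda>x. \<phi> t * f (mv x t)) has_derivative D x t) (at x)" if x: "x \<in> S" and t: "t \<in> {0..1}" for x t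
  proof -
    have nz: "c t $ i \<noteq> 0" for i
      using TS_nz[OF mvTS[OF x t], of i] by (auto simp: mv_def move_def)
    have "(f has_derivative pair_form (\<lambda>i. A i (mv x t)) (\<lambda>i. B i (mv x t) / snd (mv x t) $ i)) (at (move (a t) (c t) x))"
      using f[OF mvTS[OF x t]] by (simp add: mv_def)
    from has_derivative_compose[OF has_derivative_move this]
    have "((\<lambda>x. f (mv x t)) has_derivative (\<lambda>h. pair_form (\<lambda>i. A i (mv x t)) (\<lambda>i. B i (mv x t) / snd x $ i) h)) (at x)"
      using nz by (simp add: pair_form_def mv_def move_def)
    from has_derivative_mult_right[OF this, of "\<phi> t"]
    show ?thesis by (simp add: pair_form_mult D_def)
  qed
  have c1: "continuous_on {0..1} (\<lambda>t. \<phi> t * A i (mv x t))" "continuous_on {0..1} (\<lambda>t. \<phi> t * B i (mv x t))"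
    if "x \<in> S" for x i
    using continuous_on_integrand1[OF ad A that] continuous_on_integrand1[OF ad B that] by (simp_all add: mv_def)
  have cf: "continuous_on {0..1} (\<lambda>t. \<phi> t * f (mv x t))" if "x \<in> S" for x
    unfolding mv_def using f
    by (intro continuous_on_integrand1[OF ad _ that])
       (meson continuous_at_imp_continuous_on has_derivative_continuous)
  have cfx: "continuous_on (S \<times> {0..1}) (\<lambda>x. fx (fst x) (snd x))"
  proof (rule continuous_on_blinfun_componentwise)
    fix b :: "'n pt"
    have "continuous_on (S \<times> {0..1}) (\<lambda>x. \<phi> (snd x) * A i (mv (fst x) (snd x)))" 
      "continuous_on (S \<times> {0..1}) (\<lambda>x. \<phi> (snd x) * B i (mv (fst x) (snd x)))" for i
      using continuous_on_integrand[OF ad A, of i] continuous_on_integrand[OF ad B, of i] by (simp_all add: mv_def)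
    moreover have nz: "snd x $ i \<noteq> 0" if "x \<in> S" for x i
      using TS_nz STS that by blast
    ultimately show "continuous_on (S \<times> {0..1}) (\<lambda>x. fx (fst x) (snd x) b)"
      unfolding fx D_def pair_form_def 
      by (intro continuous_on_add continuous_on_sum continuous_on_mult_right continuous_on_divide
          continuous_on_component continuous_on_snd continuous_on_fst continuous_on_id)
        (simp_all add: nz mem_Times_iff)
  qed
  have "((\<lambda>x. integral (cbox 0 1) (\<lambda>t. \<phi> t * f (mv x t))) has_derivative
     blinfun_apply (integral (cbox 0 1) (fx p0))) (at p0 within ball p0 e)"
  proof (rule leibniz_rule)
    show "((\<lambda>x. \<phi> t * f (mv x t)) has_derivative blinfun_apply (fx x t)) (at x within ball p0 e)"
      if "x \<in> ball p0 e" "t \<in> cbox 0 1" for x t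
      unfolding fx by (rule has_derivative_at_withinI[OF der]) (use that e in auto)
    show "(\<lambda>t. \<phi> t * f (mv x t)) integrable_on cbox 0 1" if "x \<in> ball p0 e" for x
      using cf[of x] that e by (intro integrable_continuous) auto
    show "continuous_on (ball p0 e \<times> cbox 0 1) (\<lambda>(x, t). fx x t)"
      using continuous_on_subset[OF cfx, of "ball p0 e \<times> {0..1}"] e by (auto simp: case_prod_unfold)
  qed (use e in auto)
  then have "(int_op \<phi> a c f has_derivative blinfun_apply (integral (cbox 0 1) (fx p0))) (at p0)"
    using e at_within_open[of p0 "ball p0 e"] by (simp add: int_op_def[abs_def] mv_def)
  moreover have "blinfun_apply (integral (cbox 0 1) (fx p0)) =
     pair_form (\<lambda>i. int_op \<phi> a c (A i) p0) (\<lambda>i. int_op \<phi> a c (B i) p0 / snd p0 $ i)"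
  proof
    fix h
    have fxi: "fx p0 integrable_on cbox 0 1"
    proof (rule integrable_continuous)
      have "continuous_on {0..1} (\<lambda>\<theta>. (p0, \<theta>))" by (intro continuous_intros)
      from continuous_on_compose2[OF cfx this] p0
      show "continuous_on (cbox 0 1) (fx p0)" by auto
    qed
    note iA = integrable_continuous_interval[OF c1(1)[OF p0]]
    note iB = integrable_continuous_interval[OF c1(2)[OF p0]]
    have "blinfun_apply (integral (cbox 0 1) (fx p0)) h = integral {0..1} (\<lambda>t. D p0 t h)"
      using blinfun_apply_integral[OF fxi, of h] by (simp add: fx)
    also have "\<dots> = integral {0..1} (\<lambda>t. (\<Sum>i\<in>UNIV. fst h $ i * (\<phi> t * A i (mv p0 t)))
        + (\<Sum>i\<in>UNIV. (snd h $ i / snd p0 $ i) * (\<phi> t * B i (mv p0 t))))"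
      by (simp add: D_def pair_form_def mult_ac)
    also have "\<dots> = (\<Sum>i\<in>UNIV. fst h $ i * integral {0..1} (\<lambda>t. \<phi> t * A i (mv p0 t)))
        + (\<Sum>i\<in>UNIV. (snd h $ i / snd p0 $ i) * integral {0..1} (\<lambda>t. \<phi> t * B i (mv p0 t)))"
      by (subst Henstock_Kurzweil_Integration.integral_add,
          (intro integrable_sum integrable_on_mult_right iA iB finite)+,
          subst (1 2) Henstock_Kurzweil_Integration.integral_sum)
        (simp_all only: Henstock_Kurzweil_Integration.integral_mult_right integrable_on_mult_right iA iB finite)
    also have "\<dots> = pair_form (\<lambda>i. int_op \<phi> a c (A i) p0) (\<lambda>i. int_op \<phi> a c (B i) p0 / snd p0 $ i) h"
      by (simp add: pair_form_def int_op_def mv_def mult_ac)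
    finally show "blinfun_apply (integral (cbox 0 1) (fx p0)) h = \<dots>" .
  qed
  ultimately show ?thesis by simp
qed

end

text \<open>Cauchy's formula for the derivative with u = z + r cis (2 pi x), where du / (u - z)^2 =
  2 pi i dx / (u - z).\<close>

lemma deriv_circle_integral:
  assumes r: "r > 0" and cont: "continuous_on (cball z r) f" and hol: "f holomorphic_on ball z r"
  shows "deriv f z = integral {0..1} (\<lambda>x. 1 / (of_real r * cis (2 * pi * x)) * f (z + of_real r * cis (2 * pi * x)))"
proof -
  have "deriv f z = 1 / (2 * of_real pi * \<i>) * contour_integral (circlepath z r) (\<lambda>u. f u / (u-z)^2)"
    by (rule DERIV_imp_deriv, rule Cauchy_derivative_integral_circlepath(2)[OF cont hol]) (use r in auto)
  also have "contour_integral (circlepath z r) (\<lambda>u. f u / (u-z)^2) =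
     integral {0..1} (\<lambda>x. f (circlepath z r x) / (circlepath z r x - z)^2 * vector_derivative (circlepath z r) (at x))"
    by (rule contour_integral_integral)
  also have "(\<lambda>x. f (circlepath z r x) / (circlepath z r x - z)^2 * vector_derivative (circlepath z r) (at x)) =
     (\<lambda>x. (2 * of_real pi * \<i>) * (1 / (of_real r * cis (2 * pi * x)) * f (z + of_real r * cis (2 * pi * x))))"
    unfolding vector_derivative_circlepath using r
    by (auto simp: circlepath cis_conv_exp power2_eq_square field_simps fun_eq_iff)
  finally show ?thesis
    by (simp only: Henstock_Kurzweil_Integration.integral_mult_right) simp
qed

text \<open>The flow of the i-th Euler field with multiplicative time; \<open>shift\<close> is the
  flow of d/dZ_i. Both are instances of \<open>move\<close>, so averages along them are instances of
  \<open>int_op\<close>.\<close>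

definition scale :: "'n \<Rightarrow> complex \<Rightarrow> 'n::finite pt \<Rightarrow> 'n pt" where
  "scale i \<sigma> = move 0 (\<chi> k. if k = i then \<sigma> else 1)"

definition shift :: "'n \<Rightarrow> complex \<Rightarrow> 'n::finite pt \<Rightarrow> 'n pt" where
  "shift i s = move (axis i s) 1"

lemma axis_norm: "norm (axis i s :: complex^'n::finite) = norm s"
  by (simp add: norm_vec_def L2_set_def axis_def if_distrib[of "\<lambda>x. (norm x)\<^sup>2"] cong: if_cong)

lemma scale_1 [simp]: "scale i 1 p = p"
  by (simp add: scale_def move_def)

lemma shift_0 [simp]: "shift i 0 p = p"
  by (simp add: shift_def move_def vec_eq_iff prod_eq_iff axis_def)

context open_base begin

lemma scale_TS: "p \<in> TS \<Longrightarrow> \<sigma> \<noteq> 0 \<Longrightarrow> scale i \<sigma> p \<in> TS"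
  by (auto simp: total_space_def scale_def move_def)

lemma DERIV_scale:
  assumes f: "f \<in> OU" and p: "p \<in> TS" and s: "\<sigma> \<noteq> 0"
  shows "((\<lambda>\<sigma>. f (scale i \<sigma> p)) has_field_derivative eu i f (scale i \<sigma> p) / \<sigma>) (at \<sigma>)"
proof -
  define q where "q = scale i \<sigma> p"
  have q: "q \<in> TS" using scale_TS[OF p s] by (simp add: q_def)
  have "((\<lambda>s. (fst p, \<chi> k. if k = i then s else snd p $ k)) has_derivative
    (\<lambda>s. (0, (\<chi> k. if k = i then s else 0)))) (at (\<sigma> * snd p $ i))"
    by (rule has_derivative_line_z)
  moreover have "((\<lambda>\<sigma>. \<sigma> * snd p $ i) has_derivative (\<lambda>s. s * snd p $ i)) (at \<sigma>)"
    by (auto intro!: derivative_eq_intros)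
  ultimately have "((\<lambda>\<sigma>. (fst p, \<chi> k. if k = i then \<sigma> * snd p $ i else snd p $ k)) has_derivative
    (\<lambda>s. (0, (\<chi> k. if k = i then s * snd p $ i else 0)))) (at \<sigma>)"
    by (rule has_derivative_compose[rotated])
  moreover have eq: "(fst p, \<chi> k. if k = i then \<sigma> * snd p $ i else snd p $ k) = scale i \<sigma> p" for \<sigma>
    by (auto simp: scale_def move_def vec_eq_iff)
  ultimately have "(scale i) \<sigma> p = q" "((\<lambda>\<sigma>. scale i \<sigma> p) has_derivative
    (\<lambda>s. (0, (\<chi> k. if k = i then s * snd p $ i else 0)))) (at \<sigma>)"
    by (simp_all add: q_def)
  from has_derivative_compose[OF this(2)] O_an_deriv[OF f q] this(1)
  have "((\<lambda>\<sigma>. f (scale i \<sigma> p)) has_derivative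
    (\<lambda>s. pair_form (\<lambda>i. pz i f q) (\<lambda>i. eu i f q / snd q $ i) (0, (\<chi> k. if k = i then s * snd p $ i else 0)))) (at \<sigma>)"
    by simp
  moreover have "pair_form (\<lambda>i. pz i f q) (\<lambda>i. eu i f q / snd q $ i) (0, (\<chi> k. if k = i then s * snd p $ i else 0))
     = eu i f q / \<sigma> * s" for s
    using TS_nz[OF p, of i] \<open>\<sigma> \<noteq> 0\<close>
    by (simp add: pair_form_def sum_times_if_eq del: times_divide_eq_left) (simp add: q_def scale_def move_def)
  ultimately show ?thesis unfolding has_field_derivative_def q_def by (simp only:)
qed

lemma DERIV_shift:
  assumes f: "f \<in> OU" and q: "shift i s p \<in> TS"
  shows "((\<lambda>s. f (shift i s p)) has_field_derivative pz i f (shift i s p)) (at s)"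
proof -
  define q where "q = shift i s p"
  have "((\<lambda>s. (axis i s + fst p, snd p)) has_derivative (\<lambda>s. (axis i s, 0))) (at s)"
    by (intro has_derivative_Pair has_derivative_add_const bounded_linear_imp_has_derivative[OF bounded_linear_axis]) simp
  moreover have "(axis i s + fst p, snd p) = shift i s p" for s
    by (simp add: shift_def move_def add.commute)
  ultimately have "((\<lambda>s. shift i s p) has_derivative (\<lambda>s. (axis i s, 0))) (at s)" by simp
  from has_derivative_compose[OF this O_an_deriv[OF f q]]
  have "((\<lambda>s. f (shift i s p)) has_derivative
    (\<lambda>s. pair_form (\<lambda>i. pz i f q) (\<lambda>i. eu i f q / snd q $ i) (axis i s, 0))) (at s)"
    by (simp add: q_def)
  moreover have "pair_form (\<lambda>i. pz i f q) (\<lambda>i. eu i f q / snd q $ i) (axis i s, 0) = pz i f q * s" for s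
    by (simp add: pair_form_def axis_def sum_times_if_eq)
  ultimately show ?thesis by (simp add: has_field_derivative_def q_def)
qed

text \<open>By Cauchy's formula the derivatives \<open>eu\<close> and \<open>pz\<close> are locally given by averages over
  translates, as are the means over circles, so that all these operators preserve holomorphy and commute.\<close>

definition integral_rep :: "('n fn \<Rightarrow> 'n fn) \<Rightarrow> bool" where
  "integral_rep Q \<longleftrightarrow> (\<forall>f p. p \<notin> TS \<longrightarrow> Q f p = 0) \<and> (\<forall>p0\<in>TS. \<exists>\<phi> a c S. admissible \<phi> a c S \<and> p0 \<in> S \<and>
     (\<forall>f\<in>OU. \<forall>p\<in>S. Q f p = int_op \<phi> a c f p))"

text \<open>For \<open>Q = eu i\<close> and \<open>Q = pz i\<close> this is the continuity of
  derivatives demanded by \<open>int_op_deriv\<close>; holomorphy as defined gives only pointwise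
  differentiability.\<close>

lemma integral_rep_cont:
  assumes "integral_rep Q" "f \<in> OU"
  shows "continuous_on TS (Q f)"
proof -
  have "isCont (Q f) p0" if p0: "p0 \<in> TS" for p0
  proof -
    obtain \<phi> a c S where *: "admissible \<phi> a c S" "p0 \<in> S" "\<forall>f\<in>OU. \<forall>p\<in>S. Q f p = int_op \<phi> a c f p"
      using assms(1) p0 unfolding integral_rep_def by blast
    have "continuous_on S (Q f)"
      using int_op_cont[OF *(1) O_an_cont[OF assms(2)]] *(3) assms(2) by (simp cong: continuous_on_cong)
    moreover have "open S" using *(1) by (simp add: admissible_def)
    ultimately show ?thesis using *(2) by (simp add: continuous_on_eq_continuous_at)
  qed
  then show ?thesis by (simp add: continuous_at_imp_continuous_on)
qed

lemma integral_rep_eu: "integral_rep (eu i)"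
proof -
  \<comment> \<open>Cauchy's formula will be applied at \<sigma> = 1 to the function
    \<open>f (scale i \<sigma> p)\<close> of \<sigma>. The radius 1/2 keeps the closed disc away
    from \<sigma> = 0, so one formula holds on the whole total space.\<close>
  define c where "c = (\<lambda>\<theta>::real. (\<chi> k. if k = i then 1 + of_real (1/2) * cis (2 * pi * \<theta>) else 1))"
  define \<phi> where "\<phi> = (\<lambda>\<theta>::real. 1 / (of_real (1/2) * cis (2 * pi * \<theta>)))"
  have nz: "1 + of_real (1/2) * cis x \<noteq> 0" for x
  proof
    assume "1 + of_real (1/2) * cis x = 0"
    then have "of_real (1/2) * cis x = -1" by (simp add: add_eq_0_iff)
    then have "norm (of_real (1/2) * cis x) = norm (-1::complex)" by (rule arg_cong)
    then show False by (simp add: norm_mult)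
  qed
  have mv: "move 0 (c \<theta>) p = scale i (1 + of_real (1/2) * cis (2 * pi * \<theta>)) p" for \<theta> p
    by (simp only: c_def scale_def)
  have "continuous_on {0..1} (\<lambda>\<theta>. if k = i then 1 + of_real (1/2) * cis (2 * pi * \<theta>) else 1)" for k
    by (cases "k = i") (auto intro!: continuous_intros)
  then have "continuous_on {0..1} c"
    unfolding c_def by (intro continuous_on_vec_lambda)
  moreover have "continuous_on {0..1} \<phi>"
    unfolding \<phi>_def by (intro continuous_intros) auto
  ultimately have ad: "admissible \<phi> (\<lambda>_. 0) c TS"
    unfolding admissible_def mv using open_TS scale_TS nz by auto
  have "eu i f p = int_op \<phi> (\<lambda>_. 0) c f p" if f: "f \<in> OU" and p: "p \<in> TS" for f p
  proof -
    define F where "F = (\<lambda>\<sigma>. f (scale i \<sigma> p))"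
    have F: "(F has_field_derivative eu i f (scale i \<sigma> p) / \<sigma>) (at \<sigma>)" if "\<sigma> \<noteq> 0" for \<sigma>
      unfolding F_def by (rule DERIV_scale[OF f p that])
    have nz: "\<sigma> \<noteq> 0" if "\<sigma> \<in> cball 1 (1/2)" for \<sigma> :: complex
      using that by auto
    have "deriv F 1 = eu i f p"
      using DERIV_imp_deriv[OF F[of 1]] by simp
    moreover have "deriv F 1 = integral {0..1} (\<lambda>x. 1 / (of_real (1/2) * cis (2 * pi * x)) * F (1 + of_real (1/2) * cis (2 * pi * x)))"
    proof (rule deriv_circle_integral)
      show "continuous_on (cball 1 (1/2)) F"
        using nz F by (meson DERIV_isCont continuous_at_imp_continuous_on)
      show "F holomorphic_on ball 1 (1/2)"
        unfolding holomorphic_on_def field_differentiable_def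
        using nz F by (meson has_field_derivative_at_within ball_subset_cball subsetD)
    qed simp
    ultimately show ?thesis
      by (simp add: int_op_def \<phi>_def mv F_def)
  qed
  then show ?thesis
    using ad eu_zero unfolding integral_rep_def by blast
qed

lemma integral_rep_pz: "integral_rep (pz j)"
  unfolding integral_rep_def
proof (intro conjI ballI allI impI)
  show "pz j f p = 0" if "p \<notin> TS" for f p using pz_zero[OF that] .
next
  fix p0 assume p0: "p0 \<in> TS"
  then have "fst p0 \<in> U" by (auto simp: total_space_def)
  then obtain e where e: "e > 0" "ball (fst p0) e \<subseteq> U"
    using open_U by (meson open_contains_ball)
  \<comment> \<open>Half of e goes to the distance from the centre and half to the translation, so
    shifted points stay in the ball of radius e.\<close>
  define r where "r = e / 2"
  have r: "r > 0" using e by (simp add: r_def)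
  define S where "S = TS \<inter> (ball (fst p0) r \<times> UNIV)"
  define a where "a = (\<lambda>\<theta>::real. axis j (of_real r * cis (2 * pi * \<theta>)) :: complex^'n)"
  define \<phi> where "\<phi> = (\<lambda>\<theta>::real. 1 / (of_real r * cis (2 * pi * \<theta>)))"
  have mv: "move (a \<theta>) 1 p = shift j (of_real r * cis (2 * pi * \<theta>)) p" for \<theta> p
    by (simp add: a_def shift_def)
  have sh: "shift j s p \<in> TS" if "p \<in> S" "norm s \<le> r" for s p
  proof -
    have "dist (fst p0) (fst p + axis j s) \<le> dist (fst p0) (fst p) + norm (axis j s)"
      by (metis dist_norm dist_triangle add_diff_cancel_left' dist_commute)
    also have "\<dots> < r + r" using that by (auto simp: S_def axis_norm)
    finally have "fst p + axis j s \<in> U" using e by (auto simp: r_def)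
    then show ?thesis using that by (auto simp: S_def total_space_def shift_def move_def)
  qed
  have "continuous_on {0..1} a"
    unfolding a_def by (intro bounded_linear.continuous_on[OF bounded_linear_axis] continuous_intros)
  moreover have "continuous_on {0..1} \<phi>"
    unfolding \<phi>_def using r by (intro continuous_intros) auto
  moreover have "open S" unfolding S_def by (intro open_Int open_TS open_Times) auto
  ultimately have ad: "admissible \<phi> a (\<lambda>_. 1) S"
    unfolding admissible_def mv using sh r by (auto simp: S_def norm_mult)
  have "pz j f p = int_op \<phi> a (\<lambda>_. 1) f p" if f: "f \<in> OU" and p: "p \<in> S" for f p
  proof -
    define F where "F = (\<lambda>s. f (shift j s p))"
    have F: "(F has_field_derivative pz j f (shift j s p)) (at s)" if "s \<in> cball 0 r" for s
      unfolding F_def by (rule DERIV_shift[OF f sh[OF p]]) (use that in auto)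
    have "deriv F 0 = pz j f p"
      using DERIV_imp_deriv[OF F[of 0]] r by simp
    moreover have "deriv F 0 = integral {0..1} (\<lambda>x. 1 / (of_real r * cis (2 * pi * x)) * F (0 + of_real r * cis (2 * pi * x)))"
    proof (rule deriv_circle_integral[OF r])
      show "continuous_on (cball 0 r) F"
        using F by (meson DERIV_isCont continuous_at_imp_continuous_on)
      show "F holomorphic_on ball 0 r"
        unfolding holomorphic_on_def field_differentiable_def
        using F by (meson has_field_derivative_at_within ball_subset_cball subsetD)
    qed
    ultimately show ?thesis
      by (simp add: int_op_def \<phi>_def mv F_def)
  qed
  then show "\<exists>\<phi> a c S. admissible \<phi> a c S \<and> p0 \<in> S \<and> (\<forall>f\<in>OU. \<forall>p\<in>S. pz j f p = int_op \<phi> a c f p)"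
    using ad p0 r by (intro exI[of _ \<phi>] exI[of _ a] exI[of _ "\<lambda>_. 1"] exI[of _ S]) (auto simp: S_def mem_Times_iff)
qed

lemma integral_rep_deriv:
  assumes Q: "integral_rep Q" and f: "f \<in> OU" and p0: "p0 \<in> TS"
  obtains \<phi> a c S where "admissible \<phi> a c S" "p0 \<in> S" "\<forall>f\<in>OU. \<forall>p\<in>S. Q f p = int_op \<phi> a c f p"
    "(Q f has_derivative pair_form (\<lambda>i. int_op \<phi> a c (pz i f) p0) (\<lambda>i. int_op \<phi> a c (eu i f) p0 / snd p0 $ i)) (at p0)"
proof -
  obtain \<phi> a c S where *: "admissible \<phi> a c S" "p0 \<in> S" "\<forall>f\<in>OU. \<forall>p\<in>S. Q f p = int_op \<phi> a c f p"
    using assms unfolding integral_rep_def by blast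
  have "(int_op \<phi> a c f has_derivative pair_form (\<lambda>i. int_op \<phi> a c (pz i f) p0)
    (\<lambda>i. int_op \<phi> a c (eu i f) p0 / snd p0 $ i)) (at p0)"
    by (rule int_op_deriv[OF *(1,2)])
      (auto intro: O_an_deriv f integral_rep_cont integral_rep_eu integral_rep_pz)
  then have "(Q f has_derivative pair_form (\<lambda>i. int_op \<phi> a c (pz i f) p0)
    (\<lambda>i. int_op \<phi> a c (eu i f) p0 / snd p0 $ i)) (at p0)"
    by (rule has_derivative_transform_within_open[of _ _ _ UNIV S])
      (use * f in \<open>auto simp: admissible_def\<close>)
  with * show ?thesis by (rule that)
qed

lemma integral_rep_O: "integral_rep Q \<Longrightarrow> f \<in> OU \<Longrightarrow> Q f \<in> OU"
  by (rule O_an_I) (blast elim: integral_rep_deriv, simp add: integral_rep_def)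

lemma eu_O: "f \<in> OU \<Longrightarrow> eu i f \<in> OU" and pz_O: "f \<in> OU \<Longrightarrow> pz i f \<in> OU"
  by (simp_all add: integral_rep_O integral_rep_eu integral_rep_pz)

text \<open>The differential of \<open>Q f\<close> was found by integrating \<open>pz i f\<close>
  and \<open>eu i f\<close> against the same kernel. These lie in \<open>OU\<close> again, so the
  integrals are \<open>Q (pz i f)\<close> and \<open>Q (eu i f)\<close>.\<close>

lemma integral_rep_comm:
  assumes Q: "integral_rep Q" and f: "f \<in> OU"
  shows "eu i (Q f) = Q (eu i f)" "pz i (Q f) = Q (pz i f)"
proof -
  have "eu i (Q f) p = Q (eu i f) p \<and> pz i (Q f) p = Q (pz i f) p" if p: "p \<in> TS" for p
  proof -
    obtain \<phi> a c S where *: "admissible \<phi> a c S" "p \<in> S" "\<forall>f\<in>OU. \<forall>p\<in>S. Q f p = int_op \<phi> a c f p"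
      "(Q f has_derivative pair_form (\<lambda>i. int_op \<phi> a c (pz i f) p) (\<lambda>i. int_op \<phi> a c (eu i f) p / snd p $ i)) (at p)"
      by (rule integral_rep_deriv[OF Q f p])
    from pair_form_derivs[OF p *(4), of i] show ?thesis
      using *(2,3) TS_nz[OF p] eu_O[OF f] pz_O[OF f] by simp
  qed
  then show "eu i (Q f) = Q (eu i f)" "pz i (Q f) = Q (pz i f)"
    by (auto intro!: fn_eqI simp: eu_zero pz_zero Q[unfolded integral_rep_def])
qed

lemma eu_eu: "f \<in> OU \<Longrightarrow> eu i (eu j f) = eu j (eu i f)"
  and pz_eu: "f \<in> OU \<Longrightarrow> pz i (eu j f) = eu j (pz i f)"
  by (rule integral_rep_comm[OF integral_rep_eu], assumption)+


section \<open>Fibrewise averages and primitives\<close>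

definition circle_int :: "(real \<Rightarrow> complex) \<Rightarrow> 'n \<Rightarrow> 'n fn \<Rightarrow> 'n fn" where
  "circle_int \<phi> i f p = (if p \<in> TS then integral {0..1} (\<lambda>\<theta>. \<phi> \<theta> * f (scale i (cis (2 * pi * \<theta>)) p)) else 0)"

abbreviation "avg \<equiv> circle_int (\<lambda>_. 1)"

lemma circle_int_admissible:
  assumes "continuous_on {0..1} \<phi>"
  shows "admissible \<phi> (\<lambda>_. 0) (\<lambda>\<theta>. \<chi> k. if k = i then cis (2 * pi * \<theta>) else 1) TS"
proof -
  have "continuous_on {0..1} (\<lambda>\<theta>. if k = i then cis (2 * pi * \<theta>) else 1)" for k
    by (cases "k = i") (auto intro!: continuous_intros)
  then have "continuous_on {0..1} (\<lambda>\<theta>. \<chi> k. if k = i then cis (2 * pi * \<theta>) else 1)"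
    by (intro continuous_on_vec_lambda)
  then show ?thesis
    using assms open_TS scale_TS[of _ "cis x" for x] unfolding admissible_def scale_def by auto
qed

lemma integral_rep_circ:
  assumes "continuous_on {0..1} \<phi>"
  shows "integral_rep (circle_int \<phi> i)"
  unfolding integral_rep_def
  using circle_int_admissible[OF assms, of i] by (auto simp: circle_int_def int_op_def scale_def)

lemma circle_int_integrable:
  assumes "continuous_on {0..1} \<phi>" "f \<in> OU" "p \<in> TS"
  shows "(\<lambda>\<theta>. \<phi> \<theta> * f (scale i (cis (2 * pi * \<theta>)) p)) integrable_on {0..1}"
  unfolding scale_def
  by (rule integrable_continuous_interval, rule continuous_on_integrand1[OF circle_int_admissible[OF assms(1)] O_an_cont[OF assms(2)] assms(3)])

lemma circle_int_add:
  assumes "continuous_on {0..1} \<phi>" "f \<in> OU" "g \<in> OU"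
  shows "circle_int \<phi> i (f + g) = circle_int \<phi> i f + circle_int \<phi> i g"
  using circle_int_integrable[OF assms(1,2)] circle_int_integrable[OF assms(1,3)]
  by (intro fn_eqI) (auto simp: circle_int_def distrib_left Henstock_Kurzweil_Integration.integral_add)

lemma circle_int_mult_invariant:
  assumes "\<And>p \<theta>. p \<in> TS \<Longrightarrow> c (scale i (cis \<theta>) p) = c p"
  shows "circle_int \<phi> i (c * f) = c * circle_int \<phi> i f"
proof (rule fn_eqI)
  fix p assume p: "p \<in> TS"
  have "circle_int \<phi> i (c * f) p = integral {0..1} (\<lambda>\<theta>. c p * (\<phi> \<theta> * f (scale i (cis (2 * pi * \<theta>)) p)))"
    using p by (simp add: circle_int_def assms mult_ac)
  also have "\<dots> = c p * circle_int \<phi> i f p"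
    using p by (simp add: circle_int_def)
  finally show "circle_int \<phi> i (c * f) p = (c * circle_int \<phi> i f) p" by simp
qed (auto simp: circle_int_def)

lemma vector_derivative_rotate:
  assumes "f \<in> OU" "p \<in> TS"
  shows "((\<lambda>\<theta>. f (scale i (cis (2 * pi * \<theta>)) p)) has_vector_derivative
     (2 * pi * \<i>) * eu i f (scale i (cis (2 * pi * \<theta>)) p)) (at \<theta> within A)"
proof -
  have "((\<lambda>\<theta>. cis (2 * pi * \<theta>)) has_vector_derivative (2 * pi * \<i>) * cis (2 * pi * \<theta>)) (at \<theta>)"
    unfolding cis_conv_exp
    by (auto intro!: derivative_eq_intros has_vector_derivative_real_field)
  from field_vector_diff_chain_at[OF this DERIV_scale[OF assms, of "cis (2 * pi * \<theta>)" i]]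
  have "((\<lambda>\<theta>. f (scale i (cis (2 * pi * \<theta>)) p)) has_vector_derivative
     (2 * pi * \<i>) * eu i f (scale i (cis (2 * pi * \<theta>)) p)) (at \<theta>)"
    by (simp add: o_def field_simps)
  then show ?thesis by (rule has_vector_derivative_at_within)
qed

text \<open>Up to the factor 2 pi i, \<open>eu i f\<close> is the derivative of f along the circle,
  and a closed loop has no boundary.\<close>

lemma avg_eu:
  assumes f: "f \<in> OU"
  shows "avg i (eu i f) = 0"
proof (rule fn_eqI)
  fix p assume p: "p \<in> TS"
  have "((\<lambda>\<theta>. (2 * pi * \<i>) * eu i f (scale i (cis (2 * pi * \<theta>)) p)) has_integral
     f (scale i (cis (2 * pi * 1)) p) - f (scale i (cis (2 * pi * 0)) p)) {0..1}"
    by (intro fundamental_theorem_of_calculus vector_derivative_rotate f p) simp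
  from integral_unique[OF this]
  have "2 * pi * \<i> * integral {0..1} (\<lambda>\<theta>. eu i f (scale i (cis (2 * pi * \<theta>)) p)) = 0"
    by (simp only: Henstock_Kurzweil_Integration.integral_mult_right) simp
  then have "integral {0..1} (\<lambda>\<theta>. eu i f (scale i (cis (2 * pi * \<theta>)) p)) = 0"
    by simp
  then show "avg i (eu i f) p = 0 p" using p by (simp add: circle_int_def)
qed (auto simp: circle_int_def)

definition antieu :: "'n \<Rightarrow> 'n fn \<Rightarrow> 'n fn" where
  "antieu = circle_int (\<lambda>\<theta>. 2 * pi * \<i> * (of_real \<theta> - 1/2))"

text \<open>Integration by parts over the circle against \<open>\<theta> - 1/2\<close>; on Laurent monomials this is
  division by the exponent.\<close>

lemma antieu_eu:
  assumes f: "f \<in> OU"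
  shows "antieu i (eu i f) + avg i f = f"
proof (rule fn_eqI)
  fix p assume p: "p \<in> TS"
  define g where "g \<theta> = f (scale i (cis (2 * pi * \<theta>)) p)" for \<theta>
  define g' where "g' \<theta> = 2 * pi * \<i> * eu i f (scale i (cis (2 * pi * \<theta>)) p)" for \<theta>
  have g: "(g has_vector_derivative g' \<theta>) (at \<theta> within {0..1})" for \<theta>
    unfolding g_def g'_def by (rule vector_derivative_rotate[OF f p])
  have "((\<lambda>\<theta>. of_real \<theta> - 1/2 :: complex) has_vector_derivative 1) (at \<theta> within {0..1})" for \<theta>
    by (auto intro!: derivative_eq_intros has_vector_derivative_real_field)
  from has_vector_derivative_mult[OF this g]
  have "((\<lambda>\<theta>. (of_real \<theta> - 1/2) * g \<theta>) has_vector_derivative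
      (of_real \<theta> - 1/2) * g' \<theta> + 1 * g \<theta>) (at \<theta> within {0..1})" for \<theta> .
  \<comment> \<open>Both endpoints are the point p itself, and each contributes half of
    \<open>f p\<close> to the boundary term.\<close>
  then have "((\<lambda>\<theta>. (of_real \<theta> - 1/2) * g' \<theta> + 1 * g \<theta>) has_integral
      (of_real 1 - 1/2) * g 1 - (of_real 0 - 1/2) * g 0) {0..1}"
    by (intro fundamental_theorem_of_calculus) auto
  moreover have "g 0 = f p" "g 1 = f p" by (simp_all add: g_def)
  ultimately have "integral {0..1} (\<lambda>\<theta>. (of_real \<theta> - 1/2) * g' \<theta> + 1 * g \<theta>) = f p"
    by (simp add: integral_unique)
  moreover have "integral {0..1} (\<lambda>\<theta>. (of_real \<theta> - 1/2) * g' \<theta> + 1 * g \<theta>) =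
      integral {0..1} (\<lambda>\<theta>. 2 * pi * \<i> * (of_real \<theta> - 1/2) * eu i f (scale i (cis (2 * pi * \<theta>)) p))
      + integral {0..1} (\<lambda>\<theta>. 1 * g \<theta>)"
  proof (subst Henstock_Kurzweil_Integration.integral_add[symmetric])
    show "(\<lambda>\<theta>. 2 * pi * \<i> * (of_real \<theta> - 1/2) * eu i f (scale i (cis (2 * pi * \<theta>)) p)) integrable_on {0..1}"
      by (rule circle_int_integrable[OF _ eu_O[OF f] p]) (intro continuous_intros)
    show "(\<lambda>\<theta>. 1 * g \<theta>) integrable_on {0..1}"
      unfolding g_def by (rule circle_int_integrable[OF _ f p]) (intro continuous_intros)
  qed (simp only: g'_def mult_ac)
  ultimately show "(antieu i (eu i f) + avg i f) p = f p"
    using p by (simp add: antieu_def circle_int_def g_def)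
qed (use O_an_zero[OF f] in \<open>auto simp: circle_int_def antieu_def\<close>)

lemma integral_rep_avg: "integral_rep (avg i)"
  by (intro integral_rep_circ continuous_intros)

lemma integral_rep_antieu: "integral_rep (antieu i)"
  unfolding antieu_def by (intro integral_rep_circ continuous_intros)

lemma avg_add: "f \<in> OU \<Longrightarrow> g \<in> OU \<Longrightarrow> avg i (f + g) = avg i f + avg i g"
  by (intro circle_int_add continuous_intros)

text \<open>The punctured plane is connected, so a vanishing Euler derivative gives invariance under
  all nonzero factors, not only under rotations.\<close>

lemma eu_zero_scale:
  assumes c: "c \<in> OU" "eu i c = 0" and p: "p \<in> TS" and s: "\<sigma> \<noteq> 0"
  shows "c (scale i \<sigma> p) = c p"
proof -
  have D: "((\<lambda>\<sigma>. c (scale i \<sigma> p)) has_field_derivative 0) (at \<sigma>)" if "\<sigma> \<noteq> 0" for \<sigma>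
    using DERIV_scale[OF c(1) p that, of i] c(2) by simp
  have "connected (- {0::complex})"
    by (rule connected_punctured_universe) simp
  then obtain k where "\<And>x. x \<in> - {0} \<Longrightarrow> c (scale i x p) = k"
  proof (rule DERIV_zero_connected_constant[of _ "{}"])
    show "continuous_on (- {0}) (\<lambda>\<sigma>. c (scale i \<sigma> p))"
      using D by (intro continuous_at_imp_continuous_on) (auto intro: DERIV_isCont)
    show "\<forall>x\<in>- {0} - {}. ((\<lambda>\<sigma>. c (scale i \<sigma> p)) has_field_derivative 0) (at x)"
      using D by auto
  qed auto
  from this[of \<sigma>] this[of 1] s show ?thesis by simp
qed

text \<open>Functions of Z alone: they are the constants for the fibrewise derivatives and
  averages.\<close>

definition base_fun :: "'n fn \<Rightarrow> bool" where
  "base_fun c \<longleftrightarrow> c \<in> OU \<and> (\<forall>k. eu k c = 0)"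

lemma base_fun_avg_mult: "base_fun c \<Longrightarrow> avg i (c * f) = c * avg i f"
  unfolding base_fun_def by (rule circle_int_mult_invariant) (auto intro: eu_zero_scale)

lemma base_fun_ind: "base_fun unit_fun"
  using unit_fun_props by (simp add: base_fun_def)

lemma avg_ind: "avg i unit_fun = unit_fun"
  by (rule fn_eqI) (auto simp: circle_int_def unit_fun_def scale_TS)

lemma base_fun_avg: "base_fun c \<Longrightarrow> avg i c = c"
  using base_fun_avg_mult[of c i unit_fun] by (simp add: avg_ind unit_fun_mult base_fun_def)

text \<open>The point z is moved to z' by rescaling one coordinate at a time.\<close>

lemma base_fun_const_on_torus:
  assumes c: "base_fun c" and z: "(Z, z) \<in> TS" and z': "(Z, z') \<in> TS"
  shows "c (Z, z) = c (Z, z')"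
proof -
  have "c (Z, \<chi> k. if k \<in> S then z' $ k else z $ k) = c (Z, z)" if "finite S" for S
    using that
  proof (induction S)
    case (insert i S)
    let ?p = "(Z, \<chi> k. if k \<in> S then z' $ k else z $ k)"
    have p: "?p \<in> TS" using z z' by (auto simp: total_space_def)
    have nz: "z $ i \<noteq> 0" "z' $ i \<noteq> 0" using z z' by (auto simp: total_space_def)
    have "(Z, \<chi> k. if k \<in> insert i S then z' $ k else z $ k) = scale i (z' $ i / z $ i) ?p"
      using insert(2) nz by (auto simp: scale_def move_def vec_eq_iff)
    then show ?case
      using eu_zero_scale[of c i ?p "z' $ i / z $ i"] c p nz insert(3)
      by (simp add: base_fun_def)
  qed simp
  from this[of UNIV] show ?thesis by simp
qed

lemma fold_avg_O: "f \<in> OU \<Longrightarrow> fold avg xs f \<in> OU"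
  by (induction xs arbitrary: f) (auto intro: integral_rep_O integral_rep_avg)

lemma fold_avg_add: "f \<in> OU \<Longrightarrow> g \<in> OU \<Longrightarrow> fold avg xs (f + g) = fold avg xs f + fold avg xs g"
  by (induction xs arbitrary: f g) (auto simp: avg_add intro: integral_rep_O integral_rep_avg)

lemma fold_avg_0: "fold avg xs 0 = 0"
  using fold_avg_add[OF zero_O zero_O, of xs] by simp

lemma fold_avg_eu_comm: "f \<in> OU \<Longrightarrow> eu k (fold avg xs f) = fold avg xs (eu k f)"
  by (induction xs arbitrary: f)
    (simp_all add: integral_rep_comm[OF integral_rep_avg] integral_rep_O[OF integral_rep_avg])

lemma fold_avg_eu: "f \<in> OU \<Longrightarrow> k \<in> set xs \<Longrightarrow> fold avg xs (eu k f) = 0"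
proof (induction xs arbitrary: f)
  case (Cons x xs)
  show ?case
  proof (cases "x = k")
    case True
    then show ?thesis using Cons.prems by (simp add: avg_eu fold_avg_0)
  next
    case False
    then have "fold avg (x # xs) (eu k f) = fold avg xs (eu k (avg x f))"
      using Cons.prems by (simp add: integral_rep_comm[OF integral_rep_avg])
    with False Cons.IH[of "avg x f"] Cons.prems show ?thesis
      by (auto intro: integral_rep_O integral_rep_avg)
  qed
qed simp

lemma fold_avg_mult: "base_fun c \<Longrightarrow> fold avg xs (c * f) = c * fold avg xs f"
  by (induction xs arbitrary: f) (auto simp: base_fun_avg_mult)

lemma fold_avg_base: "base_fun c \<Longrightarrow> fold avg xs c = c"
  by (induction xs) (auto simp: base_fun_avg)

lemma O_an_uminus:
  assumes "f \<in> OU"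
  shows "- f \<in> OU" "eu i (- f) = - eu i f" "pz i (- f) = - pz i f"
  using const_fun_mult_O[where c="-1", OF assms] by (simp_all add: fun_Compl_def)

lemma O_an_diff:
  assumes "f \<in> OU" "g \<in> OU"
  shows "f - g \<in> OU" "eu i (f - g) = eu i f - eu i g" "pz i (f - g) = pz i f - pz i g"
  using O_an_add[OF assms(1) O_an_uminus(1)[OF assms(2)]] O_an_uminus[OF assms(2)]
  by simp_all

lemma fold_avg_diff: "f \<in> OU \<Longrightarrow> g \<in> OU \<Longrightarrow> fold avg xs (f - g) = fold avg xs f - fold avg xs g"
  using fold_avg_add[of "f - g" g xs] by (simp add: O_an_diff)

text \<open>In each step the \<open>k\<close>-th average of \<open>w j\<close> is split off by means of \<open>antieu k (w k)\<close>.\<close>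

lemma fold_avg_primitive:
  assumes w: "\<And>j. w j \<in> OU" and closed: "\<And>i j. eu i (w j) = eu j (w i)"
  shows "\<exists>h\<in>OU. \<forall>j. eu j h = w j - fold avg xs (w j)"
proof (induction xs)
  case Nil
  show ?case by (rule bexI[OF _ zero_O]) (simp add: euler_0[unfolded zero_fun_def] zero_fun_def)
next
  case (Cons k xs)
  then obtain h where h: "h \<in> OU" "\<And>j. eu j h = w j - fold avg xs (w j)" by blast
  have O: "antieu k (w k) \<in> OU" using integral_rep_O[OF integral_rep_antieu w] .
  define h' where "h' = h + fold avg xs (antieu k (w k))"
  have "eu j h' = w j - fold avg (k # xs) (w j)" for j
  proof -
    have "antieu k (eu k (w j)) = w j - avg k (w j)"
      using antieu_eu[OF w, of k j] by (simp add: eq_diff_eq)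
    \<comment> \<open>By closedness the j-th Euler derivative of \<open>antieu k (w k)\<close> is
      \<open>antieu k (eu k (w j))\<close>. The correction therefore contributes exactly the
      difference between the old remainder and the one averaged over the k-th circle as
      well.\<close>
    then have "eu j (fold avg xs (antieu k (w k))) = fold avg xs (w j - avg k (w j))"
      using fold_avg_eu_comm[OF O, of j xs] closed[of j k] integral_rep_comm(1)[OF integral_rep_antieu w, of j k k]
      by simp
    also have "\<dots> = fold avg xs (w j) - fold avg xs (avg k (w j))"
      by (rule fold_avg_diff) (auto intro: w integral_rep_O integral_rep_avg)
    finally show ?thesis
      using h fold_avg_O[OF O] by (simp add: h'_def O_an_add)
  qed
  moreover have "h' \<in> OU" unfolding h'_def by (intro O_an_add h fold_avg_O O)
  ultimately show ?case by blast
qed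

text \<open>The part of degree 0 in z, kept as a function on the total space. Only the set of
  circles in the chosen list matters, since averaging twice over a circle is the same as averaging
  once.\<close>

definition mean :: "'n fn \<Rightarrow> 'n fn" where
  "mean = fold avg (SOME xs. set xs = UNIV)"

lemma set_some_UNIV: "set (SOME xs. set xs = (UNIV::'n set)) = UNIV"
  by (rule someI_ex) (simp add: finite_list)

lemma mean_O: "f \<in> OU \<Longrightarrow> mean f \<in> OU"
  unfolding mean_def by (rule fold_avg_O)
lemma mean_add: "f \<in> OU \<Longrightarrow> g \<in> OU \<Longrightarrow> mean (f + g) = mean f + mean g"
  unfolding mean_def by (rule fold_avg_add)
lemma mean_diff: "f \<in> OU \<Longrightarrow> g \<in> OU \<Longrightarrow> mean (f - g) = mean f - mean g"
  unfolding mean_def by (rule fold_avg_diff)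
lemma mean_0: "mean 0 = 0"
  unfolding mean_def by (rule fold_avg_0)
lemma mean_eu: "f \<in> OU \<Longrightarrow> mean (eu k f) = 0"
  unfolding mean_def by (rule fold_avg_eu) (auto simp: set_some_UNIV)
lemma eu_mean: "f \<in> OU \<Longrightarrow> eu k (mean f) = 0"
  using mean_eu[of f k] fold_avg_eu_comm[of f k] by (simp add: mean_def)
lemma mean_mult: "base_fun c \<Longrightarrow> mean (c * f) = c * mean f"
  unfolding mean_def by (rule fold_avg_mult)
lemma mean_base: "base_fun c \<Longrightarrow> mean c = c"
  unfolding mean_def by (rule fold_avg_base)
lemma base_fun_mean: "f \<in> OU \<Longrightarrow> base_fun (mean f)"
  by (simp add: base_fun_def mean_O eu_mean)

text \<open>A Poincare lemma for the commuting operators \<open>eu j\<close>, in which the mean is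
  the only obstruction.\<close>

lemma primitive:
  assumes "\<And>j. w j \<in> OU" "\<And>i j. eu i (w j) = eu j (w i)"
  obtains h where "h \<in> OU" "\<And>j. eu j h = w j - mean (w j)"
  using fold_avg_primitive[OF assms] unfolding mean_def by blast

end

section \<open>Comparison of the mean with the Laurent coefficient of degree 0\<close>

abbreviation unit_measure :: "real measure" where "unit_measure \<equiv> restrict_space lborel {0..1}"
abbreviation torus_measure :: "('n::finite \<Rightarrow> real) measure" where
  "torus_measure \<equiv> (\<Pi>\<^sub>M k\<in>UNIV. unit_measure)"

lemma finite_measure_unit: "finite_measure unit_measure"
  by standard (simp add: space_restrict_space emeasure_restrict_space)

lemma product_sigma_finite_unit: "product_sigma_finite (\<lambda>_. unit_measure)"
proof -
  interpret finite_measure unit_measure by (rule finite_measure_unit)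
  show ?thesis by standard
qed

lemma emeasure_torus: "emeasure (torus_measure :: ('n::finite \<Rightarrow> real) measure) (space torus_measure) = 1"
proof -
  interpret product_sigma_finite "\<lambda>_::'n. unit_measure" by (rule product_sigma_finite_unit)
  show ?thesis
    unfolding space_PiM by (subst emeasure_PiM) (auto simp: space_restrict_space emeasure_restrict_space sets_restrict_space)
qed

lemma finite_measure_torus: "finite_measure (torus_measure :: ('n::finite \<Rightarrow> real) measure)"
  by standard (simp add: emeasure_torus)

lemma measurable_torus_pt: "(torus_pt :: ('n::finite \<Rightarrow> real) \<Rightarrow> _) \<in> borel_measurable torus_measure"
proof -
  have "(\<lambda>\<theta>. axis k (cis (2 * pi * \<theta> k)) :: complex^'n) \<in> borel_measurable torus_measure" for k
  proof -
    have m: "(\<lambda>\<theta>. \<theta> k) \<in> measurable torus_measure unit_measure"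
      by (rule measurable_component_singleton) simp
    have "(\<lambda>x. axis k (cis (2 * pi * x)) :: complex^'n) \<in> borel_measurable borel"
      by (intro borel_measurable_continuous_onI bounded_linear.continuous_on[OF bounded_linear_axis] continuous_intros)
    then have "(\<lambda>x. axis k (cis (2 * pi * x)) :: complex^'n) \<in> borel_measurable unit_measure"
      by (intro measurable_restrict_space1) simp
    from measurable_compose[OF m this] show ?thesis .
  qed
  then have "(\<lambda>\<theta>. \<Sum>k\<in>UNIV. axis k (cis (2 * pi * \<theta> k)) :: complex^'n) \<in> borel_measurable torus_measure"
    by (intro borel_measurable_sum)
  moreover have "(\<lambda>\<theta>. \<Sum>k\<in>UNIV. axis k (cis (2 * pi * \<theta> k)) :: complex^'n) = torus_pt"
    by (auto simp: torus_pt_def vec_eq_iff axis_def fun_eq_iff if_distrib[of "\<lambda>v. v $ _"] cong: if_cong)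
  ultimately show ?thesis by simp
qed

lemma compact_torus: "compact {z::complex^'n::finite. \<forall>k. norm (z $ k) = 1}"
  unfolding compact_eq_bounded_closed
proof
  have "norm z \<le> real CARD('n)" if "\<forall>k. norm (z $ k) = 1" for z :: "complex^'n"
    using L2_set_le_sum[of UNIV "\<lambda>k. norm (z $ k)"] that by (simp add: norm_vec_def)
  then show "bounded {z::complex^'n. \<forall>k. norm (z $ k) = 1}"
    unfolding bounded_iff by blast
  show "closed {z::complex^'n. \<forall>k. norm (z $ k) = 1}"
    unfolding Collect_all_eq by (intro closed_INT ballI closed_Collect_eq continuous_intros)
qed

lemma laurent_coeff_0: "laurent_coeff f 0 Z = (LINT \<theta>|torus_measure. f (Z, torus_pt \<theta>))"
  by (simp add: laurent_coeff_def laurent_monom_def)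

context open_base begin

lemma torus_TS: "Z \<in> U \<Longrightarrow> (Z, torus_pt \<theta>) \<in> TS"
  by (simp add: TS_iff torus_pt_def)

lemma torus_integrable:
  assumes f: "f \<in> OU" and Z: "Z \<in> U"
  shows "integrable torus_measure (\<lambda>\<theta>. f (Z, torus_pt \<theta>))"
proof -
  define T where "T = {z::complex^'n. \<forall>k. norm (z $ k) = 1}"
  have T: "compact T" unfolding T_def by (rule compact_torus)
  have nz: "z $ i \<noteq> 0" if "\<forall>k. norm (z $ k) = 1" for z :: "complex^'n" and i
    using that by (metis norm_zero zero_neq_one)
  have "continuous_on T (\<lambda>z. f (Z, z))"
    by (rule continuous_on_compose2[OF O_an_cont[OF f]])
      (use Z nz in \<open>auto intro!: continuous_intros simp: T_def total_space_def\<close>)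
  note c = this
  then have "bounded ((\<lambda>z. f (Z, z)) ` T)"
    by (rule compact_imp_bounded[OF compact_continuous_image[OF _ T]])
  then obtain B where B: "\<And>z. z \<in> T \<Longrightarrow> norm (f (Z, z)) \<le> B"
    unfolding bounded_iff by blast
  have tT: "torus_pt \<theta> \<in> T" for \<theta> by (simp add: T_def torus_pt_def)
  \<comment> \<open>Continuity holds on the total space only; cutting off to the compact torus gives
    a Borel function of all z with the same values at \<open>torus_pt\<close>.\<close>
  have "(\<lambda>z. indicator T z *\<^sub>R f (Z, z)) \<in> borel_measurable borel"
    using T c by (intro borel_measurable_continuous_on_indicator borel_compact)
  from measurable_compose[OF measurable_torus_pt this]
  have "(\<lambda>\<theta>. f (Z, torus_pt \<theta>)) \<in> borel_measurable torus_measure"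
    using tT by simp
  then show ?thesis
    using B[OF tT] by (intro finite_measure.integrable_const_bound[OF finite_measure_torus, of _ B]) auto
qed

text \<open>Integrating over the i-th angle first turns the inner integral into
  \<open>avg i (eu i f)\<close>, which is zero.\<close>

lemma laurent_coeff_eu:
  assumes f: "f \<in> OU" and Z: "Z \<in> U"
  shows "laurent_coeff (eu i f) 0 Z = 0"
proof -
  interpret product_sigma_finite "\<lambda>_::'n. unit_measure" by (rule product_sigma_finite_unit)
  define h where "h = (\<lambda>\<theta>. eu i f (Z, torus_pt \<theta>))"
  have I: "insert i (UNIV - {i}) = UNIV" by auto
  have "laurent_coeff (eu i f) 0 Z = integral\<^sup>L (Pi\<^sub>M (insert i (UNIV - {i})) (\<lambda>_. unit_measure)) h"
    by (simp add: laurent_coeff_0 h_def insert_absorb)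
  also have "\<dots> = (LINT x|Pi\<^sub>M (UNIV - {i}) (\<lambda>_. unit_measure). (LINT y|unit_measure. h (x(i := y))))"
    by (rule product_integral_insert) (use torus_integrable[OF eu_O[OF f] Z] in \<open>auto simp: h_def insert_absorb\<close>)
  also have "(\<lambda>x. LINT y|unit_measure. h (x(i := y))) = (\<lambda>x. 0)"
  proof
    fix x :: "'n \<Rightarrow> real"
    \<comment> \<open>Angle 0 puts the i-th coordinate at 1, from where the rotation by
      \<open>cis (2 * pi * y)\<close> reaches the point with angle y.\<close>
    define p where "p = (Z, torus_pt (x(i := 0)))"
    have p: "p \<in> TS" unfolding p_def by (rule torus_TS[OF Z])
    have h: "h (x(i := y)) = 1 * eu i f (scale i (cis (2 * pi * y)) p)" for y
      by (auto simp: h_def p_def scale_def move_def torus_pt_def vec_eq_iff intro!: arg_cong[of _ _ "eu i f"])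
    have "continuous_on {0..1} (\<lambda>y. h (x(i := y)))"
      unfolding h unfolding scale_def
      by (rule continuous_on_integrand1[OF circle_int_admissible O_an_cont[OF eu_O[OF f]] p]) (rule continuous_on_const)
    then have "set_integrable lborel {0..1} (\<lambda>y. h (x(i := y)))"
      unfolding set_integrable_def by (intro borel_integrable_compact) auto
    from set_borel_integral_eq_integral(2)[OF this]
    have "(LINT y|unit_measure. h (x(i := y))) = integral {0..1} (\<lambda>y. h (x(i := y)))"
      by (simp add: integral_restrict_space set_lebesgue_integral_def)
    also have "\<dots> = avg i (eu i f) p" unfolding h using p by (simp add: circle_int_def)
    finally show "(LINT y|unit_measure. h (x(i := y))) = 0" by (simp add: avg_eu[OF f])
  qed
  finally show ?thesis by (simp only: Bochner_Integration.integral_zero)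
qed

lemma laurent_coeff_add:
  "f \<in> OU \<Longrightarrow> g \<in> OU \<Longrightarrow> Z \<in> U \<Longrightarrow> laurent_coeff (f + g) 0 Z = laurent_coeff f 0 Z + laurent_coeff g 0 Z"
  by (simp add: laurent_coeff_0 torus_integrable)

text \<open>f and \<open>avg k f\<close> differ by the Euler derivative of
  \<open>antieu k f\<close>, which has no coefficient of degree 0.\<close>

lemma laurent_coeff_fold_avg:
  assumes "f \<in> OU" "Z \<in> U"
  shows "laurent_coeff (fold avg xs f) 0 Z = laurent_coeff f 0 Z"
  using assms(1)
proof (induction xs arbitrary: f)
  case (Cons k xs)
  have O: "avg k f \<in> OU" "antieu k f \<in> OU"
    using Cons.prems by (auto intro: integral_rep_O integral_rep_avg integral_rep_antieu)
  have "f = eu k (antieu k f) + avg k f"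
    using antieu_eu[OF Cons.prems, of k] integral_rep_comm(1)[OF integral_rep_antieu Cons.prems, of k k] by simp
  then have "laurent_coeff f 0 Z = laurent_coeff (avg k f) 0 Z"
    using laurent_coeff_add[OF eu_O[OF O(2)] O(1) assms(2), of k] laurent_coeff_eu[OF O(2) assms(2), of k] by simp
  with Cons.IH[OF O(1)] show ?case by (simp only: fold_simps)
qed simp

text \<open>\<open>mean f\<close> does not vary along the fibre, so its value is its own integral
  over the torus, which is that of f.\<close>

lemma mean_eq_0:
  assumes f: "f \<in> OU" and l: "\<And>Z. Z \<in> U \<Longrightarrow> laurent_coeff f 0 Z = 0"
  shows "mean f = 0"
proof (rule fn_eqI)
  fix p assume p: "p \<in> TS"
  obtain Z z where pe: "p = (Z, z)" by (cases p)
  then have Z: "Z \<in> U" using p by (simp add: TS_iff)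
  have "mean f (Z, torus_pt \<theta>) = mean f p" for \<theta>
    using base_fun_const_on_torus[OF base_fun_mean[OF f] torus_TS[OF Z]] p pe by simp
  then have "laurent_coeff (mean f) 0 Z = mean f p"
    using emeasure_torus[where 'n='n] by (simp add: laurent_coeff_0 measure_def)
  moreover have "laurent_coeff (mean f) 0 Z = 0"
    unfolding mean_def using laurent_coeff_fold_avg[OF f Z] l[OF Z] by simp
  ultimately show "mean f p = 0 p" by simp
qed (use O_an_zero[OF mean_O[OF f]] in auto)

end

section \<open>Formal series in \<open>t\<close>\<close>

text \<open>A lower bound for the order in t that the zero series satisfies for every
  \<open>a\<close>, whereas \<open>fls_subdegree 0\<close> is 0.\<close>

definition ord_ge :: "'a::zero fls \<Rightarrow> int \<Rightarrow> bool" where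
  "ord_ge F a \<longleftrightarrow> (\<forall>k<a. fls_nth F k = 0)"

lemma ord_ge_mono: "ord_ge F a \<Longrightarrow> b \<le> a \<Longrightarrow> ord_ge F b"
  by (auto simp: ord_ge_def)

lemma ord_ge_nth: "ord_ge F a \<Longrightarrow> k < a \<Longrightarrow> fls_nth F k = 0"
  by (auto simp: ord_ge_def)

lemma ord_ge_subdegree: "ord_ge F (fls_subdegree F)"
  by (simp add: ord_ge_def)

lemma ord_ge_0 [simp]: "ord_ge 0 a"
  by (simp add: ord_ge_def)

lemma ord_ge_add:
  fixes F :: "'a::comm_monoid_add fls"
  shows "ord_ge F a \<Longrightarrow> ord_ge G a \<Longrightarrow> ord_ge (F + G) a"
  by (simp add: ord_ge_def)

lemma ord_ge_uminus:
  fixes F :: "'a::ab_group_add fls"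
  shows "ord_ge F a \<Longrightarrow> ord_ge (- F) a"
  by (simp add: ord_ge_def)

lemma ord_ge_diff:
  fixes F :: "'a::ab_group_add fls"
  shows "ord_ge F a \<Longrightarrow> ord_ge G a \<Longrightarrow> ord_ge (F - G) a"
  by (simp add: ord_ge_def)

lemma ord_ge_sum:
  fixes F :: "'b \<Rightarrow> 'a::comm_monoid_add fls"
  shows "(\<And>i. i \<in> A \<Longrightarrow> ord_ge (F i) a) \<Longrightarrow> ord_ge (sum F A) a"
  by (simp add: ord_ge_def fls_nth_sum)

lemma ord_ge_Suc: "ord_ge F a \<Longrightarrow> fls_nth F a = 0 \<Longrightarrow> ord_ge F (a + 1)"
  by (auto simp: ord_ge_def) (metis order_le_less zless_add1_eq)

lemma ord_ge_all_0:
  fixes F :: "'a::zero fls"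
  assumes "ord_ge F a" and "\<And>n. n \<ge> a \<Longrightarrow> ord_ge F n \<Longrightarrow> fls_nth F n = 0"
  shows "F = 0"
proof (rule fls_eqI)
  fix n
  have "ord_ge F (a + int k)" for k
  proof (induction k)
    case (Suc k)
    then show ?case using ord_ge_Suc[of F "a + int k"] assms(2)[of "a + int k"] by (simp add: algebra_simps)
  qed (use assms in simp)
  from ord_ge_nth[OF this[of "nat (n - a + 1)"], of n] show "fls_nth F n = fls_nth 0 n" by simp
qed

lemma times_nth_vb:
  fixes F G :: "'a::comm_ring_1 fls"
  assumes "ord_ge F a" "ord_ge G b"
  shows "fls_nth (F * G) n = (\<Sum>i\<in>{a..n-b}. fls_nth F i * fls_nth G (n - i))"
proof (cases "F = 0 \<or> G = 0")
  case False
  have "a \<le> fls_subdegree F" "b \<le> fls_subdegree G"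
    using assms False by (auto intro!: fls_subdegree_geI simp: ord_ge_def)
  then show ?thesis
    unfolding fls_times_nth(2)
    by (intro sum.mono_neutral_left) (auto simp: not_le dest: fls_eq0_below_subdegree)
qed auto

lemma ord_ge_times:
  fixes F G :: "'a::comm_ring_1 fls"
  assumes "ord_ge F a" "ord_ge G b"
  shows "ord_ge (F * G) (a + b)"
  unfolding ord_ge_def times_nth_vb[OF assms] by auto

lemma times_nth_lead:
  fixes F G :: "'a::comm_ring_1 fls"
  assumes "ord_ge F a" "ord_ge G b" "n = a + b"
  shows "fls_nth (F * G) n = fls_nth F a * fls_nth G b"
  by (simp add: times_nth_vb[OF assms(1,2)] assms(3))

lemma times_nth_next:
  fixes F G :: "'a::comm_ring_1 fls"
  assumes "ord_ge F a" "ord_ge G b" "n = a + b + 1"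
  shows "fls_nth (F * G) n = fls_nth F a * fls_nth G (b + 1) + fls_nth F (a + 1) * fls_nth G b"
proof -
  have "{a..n - b} = {a, a + 1}" using assms(3) by auto
  then show ?thesis by (simp add: times_nth_vb[OF assms(1,2)] assms(3))
qed

lemma ord_ge_deriv:
  fixes F :: "'a::comm_ring_1 fls"
  shows "ord_ge F a \<Longrightarrow> ord_ge (fls_deriv F) (a - 1)"
  by (simp add: ord_ge_def)

definition tmon :: "int \<Rightarrow> 'a::comm_ring_1 \<Rightarrow> 'a fls" where
  "tmon n c = fls_X_intpow n * fls_const c"

lemma tmon_nth: "fls_nth (tmon n c) k = (if k = n then c else 0)"
  by (simp add: tmon_def fls_X_intpow_times_conv_shift)

lemma tmon_times_nth: "fls_nth (tmon n c * F) k = c * fls_nth F (k - n)"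
proof -
  have "tmon n c * F = fls_X_intpow n * (fls_const c * F)"
    by (simp only: tmon_def mult.assoc)
  also have "\<dots> = fls_shift (- n) (fls_const c * F)"
    by (rule fls_X_intpow_times_conv_shift)
  finally show ?thesis by simp
qed

lemma ord_ge_mon: "ord_ge (tmon n c) n"
  by (simp add: ord_ge_def tmon_nth)

lemma of_int_fun_apply: "(of_int n :: 'a \<Rightarrow> 'b::comm_ring_1) p = of_int n"
  by (cases n) (auto simp: of_nat_fun_apply)

context open_base begin

abbreviation "FF \<equiv> formal_functions U"
abbreviation "ee i \<equiv> fls_map (eu i)"

lemma FF_I: "(\<And>k. fls_nth F k \<in> OU) \<Longrightarrow> F \<in> FF"
  by (simp add: formal_functions_def)

lemma FF_nth: "F \<in> FF \<Longrightarrow> fls_nth F k \<in> OU"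
  by (simp add: formal_functions_def)

lemma O_an_sum: "(\<And>i. i \<in> A \<Longrightarrow> f i \<in> OU) \<Longrightarrow> sum f A \<in> OU"
  by (induction A rule: infinite_finite_induct) (simp_all add: zero_O O_an_add)

lemma of_int_mult_O: "f \<in> OU \<Longrightarrow> of_int n * f \<in> OU"
  "f \<in> OU \<Longrightarrow> eu i (of_int n * f) = of_int n * eu i f"
  "f \<in> OU \<Longrightarrow> pz i (of_int n * f) = of_int n * pz i f"
proof -
  have *: "of_int n * f = (\<lambda>p. of_int n * f p)" for f :: "'n fn"
    by (simp add: fun_eq_iff of_int_fun_apply)
  show "f \<in> OU \<Longrightarrow> of_int n * f \<in> OU"
    "f \<in> OU \<Longrightarrow> eu i (of_int n * f) = of_int n * eu i f"
    "f \<in> OU \<Longrightarrow> pz i (of_int n * f) = of_int n * pz i f"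
    unfolding * by (simp_all only: const_fun_mult_O)
qed

lemma FF_add: "F \<in> FF \<Longrightarrow> G \<in> FF \<Longrightarrow> F + G \<in> FF"
  and FF_diff: "F \<in> FF \<Longrightarrow> G \<in> FF \<Longrightarrow> F - G \<in> FF"
  and FF_uminus: "F \<in> FF \<Longrightarrow> - F \<in> FF"
  and FF_0: "0 \<in> FF"
  by (auto intro!: FF_I simp: FF_nth O_an_add O_an_diff O_an_uminus zero_O)

lemma FF_sum: "(\<And>i. i \<in> A \<Longrightarrow> F i \<in> FF) \<Longrightarrow> sum F A \<in> FF"
  by (induction A rule: infinite_finite_induct) (simp_all add: FF_0 FF_add)

lemma FF_mult: "F \<in> FF \<Longrightarrow> G \<in> FF \<Longrightarrow> F * G \<in> FF"
  by (rule FF_I) (auto simp: times_nth_vb[OF ord_ge_subdegree ord_ge_subdegree] intro!: O_an_sum O_an_mult FF_nth)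

lemma FF_mon: "c \<in> OU \<Longrightarrow> tmon n c \<in> FF"
  by (auto intro!: FF_I simp: tmon_nth zero_O)

lemma unit_fun_times: "F \<in> FF \<Longrightarrow> tmon 0 unit_fun * F = F"
  by (rule fls_eqI) (simp add: tmon_times_nth unit_fun_mult FF_nth)

definition derivation :: "('n fn \<Rightarrow> 'n fn) \<Rightarrow> bool" where
  "derivation \<delta> \<longleftrightarrow> \<delta> 0 = 0 \<and> (\<forall>f\<in>OU. \<delta> f \<in> OU) \<and> (\<forall>f\<in>OU. \<forall>g\<in>OU. \<delta> (f + g) = \<delta> f + \<delta> g) \<and>
     (\<forall>f\<in>OU. \<forall>g\<in>OU. \<delta> (f * g) = f * \<delta> g + \<delta> f * g)"

lemma pz_0: "pz i 0 = 0"
  using O_an_add(3)[OF zero_O zero_O, of i] by simp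

lemma derivation_eu: "derivation (eu i)" and derivation_pz: "derivation (pz i)"
  by (simp_all add: derivation_def euler_0 pz_0 eu_O pz_O O_an_add O_an_mult)

lemma derivation_sum:
  assumes "derivation \<delta>" "\<And>i. i \<in> A \<Longrightarrow> f i \<in> OU"
  shows "\<delta> (sum f A) = (\<Sum>i\<in>A. \<delta> (f i))"
  using assms(2)
proof (induction A rule: infinite_finite_induct)
  case (insert x A)
  have "f x \<in> OU" "sum f A \<in> OU" using insert.prems by (auto intro: O_an_sum)
  then have "\<delta> (f x + sum f A) = \<delta> (f x) + \<delta> (sum f A)"
    using assms(1) unfolding derivation_def by blast
  moreover have "\<delta> (sum f A) = (\<Sum>i\<in>A. \<delta> (f i))"
    by (rule insert.IH) (use insert.prems in auto)
  ultimately show ?case by (simp only: sum.insert[OF insert.hyps])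
qed (use assms(1) in \<open>auto simp: derivation_def\<close>)

lemma fls_map_derivation:
  assumes d: "derivation \<delta>"
  shows fls_map_nth': "fls_nth (fls_map \<delta> F) k = \<delta> (fls_nth F k)"
    and FF_fls_map: "F \<in> FF \<Longrightarrow> fls_map \<delta> F \<in> FF"
    and fls_map_add: "F \<in> FF \<Longrightarrow> G \<in> FF \<Longrightarrow> fls_map \<delta> (F + G) = fls_map \<delta> F + fls_map \<delta> G"
    and ord_ge_fls_map: "ord_ge F a \<Longrightarrow> ord_ge (fls_map \<delta> F) a"
    and fls_map_mult: "F \<in> FF \<Longrightarrow> G \<in> FF \<Longrightarrow> fls_map \<delta> (F * G) = F * fls_map \<delta> G + fls_map \<delta> F * G"
proof -
  note d' = d[unfolded derivation_def]
  show nth: "fls_nth (fls_map \<delta> F) k = \<delta> (fls_nth F k)" for F k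
    using d' by (simp add: fls_map_nth)
  show ord_ge: "ord_ge F a \<Longrightarrow> ord_ge (fls_map \<delta> F) a" for F a
    using d' by (simp add: ord_ge_def nth)
  show "F \<in> FF \<Longrightarrow> fls_map \<delta> F \<in> FF"
    using d' by (auto intro!: FF_I simp: nth FF_nth)
  show "F \<in> FF \<Longrightarrow> G \<in> FF \<Longrightarrow> fls_map \<delta> (F + G) = fls_map \<delta> F + fls_map \<delta> G"
    using d' by (auto intro!: fls_eqI simp: nth FF_nth)
  show "fls_map \<delta> (F * G) = F * fls_map \<delta> G + fls_map \<delta> F * G" if F: "F \<in> FF" and G: "G \<in> FF"
  proof (rule fls_eqI)
    fix n
    let ?I = "{fls_subdegree F..n - fls_subdegree G}"
    note v = ord_ge_subdegree[of F] ord_ge_subdegree[of G]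
    have "fls_nth (fls_map \<delta> (F * G)) n = (\<Sum>i\<in>?I. \<delta> (fls_nth F i * fls_nth G (n - i)))"
      unfolding nth times_nth_vb[OF v] by (rule derivation_sum[OF d]) (simp add: O_an_mult FF_nth F G)
    also have "\<dots> = (\<Sum>i\<in>?I. fls_nth F i * \<delta> (fls_nth G (n - i)) + \<delta> (fls_nth F i) * fls_nth G (n - i))"
      using d' by (intro sum.cong refl) (simp add: FF_nth F G)
    finally show "fls_nth (fls_map \<delta> (F * G)) n = fls_nth (F * fls_map \<delta> G + fls_map \<delta> F * G) n"
      by (simp add: times_nth_vb[OF v(1) ord_ge[OF v(2)]] times_nth_vb[OF ord_ge[OF v(1)] v(2)] nth sum.distrib)
  qed
qed

lemmas ee_nth = fls_map_nth'[OF derivation_eu]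
  and FF_ee = FF_fls_map[OF derivation_eu]
  and ee_add = fls_map_add[OF derivation_eu]
  and ord_ge_ee = ord_ge_fls_map[OF derivation_eu]
  and ee_mult = fls_map_mult[OF derivation_eu]

text \<open>Derivations playing the role of \<open>\<partial>\<^sub>t\<close>, \<open>\<partial>/\<partial>Z\<^sub>j\<close> or \<open>0\<close>.\<close>

definition base_der :: "('n fn fls \<Rightarrow> 'n fn fls) \<Rightarrow> bool" where
  "base_der d \<longleftrightarrow> (\<forall>F\<in>FF. d F \<in> FF) \<and> (\<forall>F\<in>FF. \<forall>G\<in>FF. d (F + G) = d F + d G) \<and>
     (\<forall>F\<in>FF. \<forall>G\<in>FF. d (F * G) = F * d G + d F * G) \<and> (\<forall>F\<in>FF. \<forall>i. d (ee i F) = ee i (d F)) \<and>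
     (\<forall>F\<in>FF. \<forall>a. ord_ge F a \<longrightarrow> ord_ge (d F) (a - 1))"

lemma FF_deriv: "F \<in> FF \<Longrightarrow> fls_deriv F \<in> FF"
  by (rule FF_I) (simp add: of_int_mult_O FF_nth del: of_int_add)

lemma base_der_deriv: "base_der fls_deriv"
  unfolding base_der_def
proof (intro conjI ballI allI impI)
  show "fls_deriv (ee i F) = ee i (fls_deriv F)" if "F \<in> FF" for F i
    by (rule fls_eqI) (simp add: ee_nth of_int_mult_O FF_nth that del: of_int_add)
qed (simp_all add: FF_deriv ord_ge_deriv fls_deriv_mult)

lemma base_der_pz: "base_der (fls_map (pz j))"
  unfolding base_der_def
proof (intro conjI ballI allI impI)
  show "fls_map (pz j) (ee i F) = ee i (fls_map (pz j) F)" if "F \<in> FF" for F i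
    by (rule fls_eqI) (simp add: ee_nth fls_map_nth'[OF derivation_pz] pz_eu FF_nth that)
  show "ord_ge (fls_map (pz j) F) (a - 1)" if "ord_ge F a" for F a
    using ord_ge_mono[OF ord_ge_fls_map[OF derivation_pz that]] by simp
qed (simp_all add: FF_fls_map fls_map_add fls_map_mult derivation_pz)

lemma base_der_0: "base_der (\<lambda>_. 0)"
  by (auto simp: base_der_def FF_0 fls_eq_iff ee_nth euler_0)

lemma base_derD:
  assumes "base_der d"
  shows "F \<in> FF \<Longrightarrow> d F \<in> FF" "F \<in> FF \<Longrightarrow> G \<in> FF \<Longrightarrow> d (F + G) = d F + d G"
    "F \<in> FF \<Longrightarrow> G \<in> FF \<Longrightarrow> d (F * G) = F * d G + d F * G"
    "F \<in> FF \<Longrightarrow> d (ee i F) = ee i (d F)" "F \<in> FF \<Longrightarrow> ord_ge F a \<Longrightarrow> ord_ge (d F) (a - 1)"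
  using assms by (auto simp: base_der_def)

lemma ee_ee: "F \<in> FF \<Longrightarrow> ee i (ee j F) = ee j (ee i F)"
  by (rule fls_eqI) (simp add: ee_nth eu_eu FF_nth)

definition FV :: "'n vseries set" where "FV = {X. \<forall>i. X $ i \<in> FF}"

lemma FV_nth: "X \<in> FV \<Longrightarrow> X $ i \<in> FF" by (simp add: FV_def)

abbreviation "va \<equiv> vact U"

lemma FF_va: "X \<in> FV \<Longrightarrow> F \<in> FF \<Longrightarrow> va X F \<in> FF"
  unfolding vact_def by (intro FF_sum FF_mult FF_ee FV_nth)

lemma va_add: "F \<in> FF \<Longrightarrow> G \<in> FF \<Longrightarrow> va X (F + G) = va X F + va X G"
  by (simp add: vact_def ee_add distrib_left sum.distrib)

lemma va_mult: "F \<in> FF \<Longrightarrow> G \<in> FF \<Longrightarrow> va X (F * G) = F * va X G + va X F * G"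
  by (simp add: vact_def ee_mult distrib_left sum.distrib sum_distrib_left sum_distrib_right mult_ac)

lemma ord_ge_va: "(\<And>i. ord_ge (X $ i) a) \<Longrightarrow> ord_ge F b \<Longrightarrow> ord_ge (va X F) (a + b)"
  unfolding vact_def by (intro ord_ge_sum ord_ge_times ord_ge_ee)

lemma va_nth_lead:
  assumes "\<And>i. ord_ge (X $ i) a" "ord_ge F b" "n = a + b"
  shows "fls_nth (va X F) n = (\<Sum>i\<in>UNIV. fls_nth (X $ i) a * eu i (fls_nth F b))"
  unfolding vact_def fls_nth_sum
  by (intro sum.cong refl) (simp only: times_nth_lead[OF assms(1) ord_ge_ee[OF assms(2)] assms(3)] ee_nth)

lemma va_nth_next:
  assumes "\<And>i. ord_ge (X $ i) a" "ord_ge F b" "n = a + b + 1"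
  shows "fls_nth (va X F) n = (\<Sum>i\<in>UNIV. fls_nth (X $ i) a * eu i (fls_nth F (b + 1))
    + fls_nth (X $ i) (a + 1) * eu i (fls_nth F b))"
  unfolding vact_def fls_nth_sum
  by (intro sum.cong refl) (simp only: times_nth_next[OF assms(1) ord_ge_ee[OF assms(2)] assms(3)] ee_nth)

lemma va_diff_left: "va (X - Y) F = va X F - va Y F"
  by (simp add: vact_def left_diff_distrib sum_subtractf)
lemma va_uminus_left: "va (- X) F = - va X F"
  by (simp add: vact_def sum_negf)

end

section \<open>Flat coordinates\<close>

lemma tmon_mult_mon: "tmon m c * tmon n d = tmon (m + n) (c * d)"
  by (rule fls_eqI) (auto simp: tmon_times_nth tmon_nth)

lemma deriv_mon: "fls_deriv (tmon n c) = tmon (n - 1) (of_int n * c)"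
  by (rule fls_eqI) (auto simp: tmon_nth)

context open_base begin

text \<open>A lift with base part \<open>d\<close>. Taking \<open>d\<close> to be the derivative in
  t, the derivative in Z_j, or 0 treats both kinds of lifts and their vertical commutators
  alike.\<close>

definition conn :: "('n fn fls \<Rightarrow> 'n fn fls) \<Rightarrow> 'n vseries \<Rightarrow> 'n fn fls \<Rightarrow> 'n fn fls" where
  "conn d X F = d F + va X F"

context
  fixes d X assumes d: "base_der d" and X: "X \<in> FV"
begin

lemma FF_conn: "F \<in> FF \<Longrightarrow> conn d X F \<in> FF"
  unfolding conn_def by (intro FF_add FF_va X base_derD(1)[OF d])

lemma conn_add: "F \<in> FF \<Longrightarrow> G \<in> FF \<Longrightarrow> conn d X (F + G) = conn d X F + conn d X G"
  unfolding conn_def by (simp add: base_derD(2)[OF d] va_add)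

lemma conn_mult: "F \<in> FF \<Longrightarrow> G \<in> FF \<Longrightarrow> conn d X (F * G) = F * conn d X G + conn d X F * G"
  unfolding conn_def by (simp add: base_derD(3)[OF d] va_mult algebra_simps)

end

lemma ee_mon: "ee k (tmon n c) = tmon n (eu k c)"
  by (rule fls_eqI) (simp add: ee_nth tmon_nth euler_0)

lemma pz_mon: "fls_map (pz k) (tmon n c) = tmon n (pz k c)"
  by (rule fls_eqI) (simp add: fls_map_nth'[OF derivation_pz] tmon_nth pz_0)

lemma tmon_0: "tmon n 0 = 0"
  by (rule fls_eqI) (simp add: tmon_nth)

lemma va_base: "base_fun c \<Longrightarrow> va X (tmon n c) = 0"
  by (simp add: vact_def ee_mon base_fun_def tmon_0)

lemma va_zc: "va X (tmon 0 (z_coord i)) = X $ i * tmon 0 (z_coord i)"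
proof -
  have "va X (tmon 0 (z_coord i)) = (\<Sum>k\<in>UNIV. if k = i then X $ k * tmon 0 (z_coord i) else 0)"
    unfolding vact_def ee_mon z_coord_props by (intro sum.cong refl) (simp add: tmon_0)
  then show ?thesis by simp
qed

lemma z_coord_cancel:
  assumes "F \<in> FF" "G \<in> FF" "tmon 0 (z_coord i) * F = tmon 0 (z_coord i) * G"
  shows "F = G"
proof -
  have "tmon 0 (z_inv i) * (tmon 0 (z_coord i) * F) = F" if "F \<in> FF" for F
    using unit_fun_times[OF that] by (simp add: mult.assoc[symmetric] tmon_mult_mon z_inv_zc)
  from this[OF assms(1)] this[OF assms(2)] assms(3) show ?thesis by metis
qed

lemma mean_sum: "(\<And>i. i \<in> A \<Longrightarrow> f i \<in> OU) \<Longrightarrow> mean (sum f A) = (\<Sum>i\<in>A. mean (f i))"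
proof (induction A rule: infinite_finite_induct)
  case (insert x A)
  have "f x \<in> OU" "sum f A \<in> OU" using insert.prems by (auto intro: O_an_sum)
  from mean_add[OF this] have "mean (f x + sum f A) = mean (f x) + mean (sum f A)" .
  moreover have "mean (sum f A) = (\<Sum>i\<in>A. mean (f i))"
    by (rule insert.IH) (use insert.prems in auto)
  ultimately show ?case by (simp only: sum.insert[OF insert.hyps])
qed (simp_all add: mean_0)

lemma base_fun_Zc: "base_fun (Z_coord k)"
  by (simp add: base_fun_def Z_coord_props)

text \<open>The t^-2 part of \<nabla>_t acts on a coefficient in this way when all
  \<open>f k\<close> are equal to it; hence that part never contributes to means.\<close>

lemma mean_sum_eu:
  assumes "\<And>k. f k \<in> OU"
  shows "mean (\<Sum>k\<in>UNIV. Z_coord k * eu k (f k)) = 0"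
proof -
  have "mean (\<Sum>k\<in>UNIV. Z_coord k * eu k (f k)) = (\<Sum>k\<in>UNIV. mean (Z_coord k * eu k (f k)))"
    by (rule mean_sum) (intro O_an_mult Z_coord_props eu_O assms)
  also have "\<dots> = 0"
    by (intro sum.neutral ballI) (simp only: mean_mult[OF base_fun_Zc] mean_eu[OF assms] mult_zero_right)
  finally show ?thesis .
qed

end

text \<open>The properties of an almost standard flat connection on which the solution of the linear
  systems rests. \<open>X\<close> and \<open>Y j\<close> are its vertical parts, cut off to the
  total space; \<open>X_mean\<close> and \<open>Y_mean\<close> express \<delta> = 0 and \<alpha> =
  0.\<close>

locale flat_data = open_base U for U :: "(complex^'n::finite) set" +
  fixes X :: "'n vseries" and Y :: "'n \<Rightarrow> 'n vseries"
  assumes X_FV: "X \<in> FV" and Y_FV: "Y j \<in> FV"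
    and X_vb: "ord_ge (X $ i) (-2)" and Y_vb: "ord_ge (Y j $ i) (-1)"
    and X_lead: "fls_nth (X $ i) (-2) = Z_coord i"
    and Y_lead: "fls_nth (Y j $ i) (-1) = (if i = j then - unit_fun else 0)"
    and X_mean: "mean (fls_nth (X $ i) (-1)) = 0"
    and Y_mean: "mean (fls_nth (Y j $ i) 0) = 0"
    and flat_tZ: "F \<in> FF \<Longrightarrow> conn fls_deriv X (conn (fls_map (pz j)) (Y j) F)
       = conn (fls_map (pz j)) (Y j) (conn fls_deriv X F)"
    and flat_ZZ: "F \<in> FF \<Longrightarrow> conn (fls_map (pz k)) (Y k) (conn (fls_map (pz j)) (Y j) F)
       = conn (fls_map (pz j)) (Y j) (conn (fls_map (pz k)) (Y k) F)"
begin

abbreviation "nt \<equiv> conn fls_deriv X"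
abbreviation "nz j \<equiv> conn (fls_map (pz j)) (Y j)"

text \<open>The factors by which the standard connection multiplies z_i: Z_i / t^2 for the lift of
  d/dt and, in \<open>Mc\<close>, minus the Kronecker symbol over t for the lift of d/dZ_j.\<close>

definition Lc :: "'n \<Rightarrow> 'n fn fls" where "Lc i = tmon (-2) (Z_coord i)"
definition Mc :: "'n \<Rightarrow> 'n \<Rightarrow> 'n fn fls" where "Mc i j = tmon (-1) (if i = j then - unit_fun else 0)"

text \<open>\<open>T i\<close> and \<open>S i j\<close> are the conjugates by \<open>z\<^sub>i\<close> of \<open>\<nabla>\<^sub>t - Z\<^sub>i / t\<^sup>2\<close> and
  \<open>\<nabla>\<^sub>Z\<^sub>j + \<delta>\<^sub>i\<^sub>j / t\<close>: \<open>z\<^sub>i u\<close> is transformed by \<open>\<nabla>\<close> in the way \<open>z\<^sub>i\<close> is transformed by the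
  standard connection iff \<open>T i u = 0\<close> and \<open>S i j u = 0\<close> for all \<open>j\<close>.\<close>

definition T :: "'n \<Rightarrow> 'n fn fls \<Rightarrow> 'n fn fls" where "T i u = nt u + (X $ i - Lc i) * u"
definition S :: "'n \<Rightarrow> 'n \<Rightarrow> 'n fn fls \<Rightarrow> 'n fn fls" where "S i j u = nz j u + (Y j $ i - Mc i j) * u"

lemmas nt_add = conn_add[OF base_der_deriv X_FV] and nz_add = conn_add[OF base_der_pz Y_FV]
  and nt_mult = conn_mult[OF base_der_deriv X_FV] and nz_mult = conn_mult[OF base_der_pz Y_FV]
  and FF_nt = FF_conn[OF base_der_deriv X_FV] and FF_nz = FF_conn[OF base_der_pz Y_FV]

lemma base_Mc: "base_fun (if i = j then - unit_fun else 0)"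
  using unit_fun_props zero_O O_an_uminus[OF unit_fun_props(1)] euler_0 by (auto simp: base_fun_def)

lemma FF_Lc: "Lc i \<in> FF" and FF_Mc: "Mc i j \<in> FF"
  using base_Mc[of i j] unfolding Lc_def Mc_def by (auto intro!: FF_mon Z_coord_props simp: base_fun_def)

lemma FF_T: "u \<in> FF \<Longrightarrow> T i u \<in> FF" and FF_S: "u \<in> FF \<Longrightarrow> S i j u \<in> FF"
  unfolding T_def S_def
  by (intro FF_add FF_nt FF_nz FF_mult FF_diff FF_Lc FF_Mc FV_nth[OF X_FV] FV_nth[OF Y_FV]; assumption)+

lemma T_add: "u \<in> FF \<Longrightarrow> v \<in> FF \<Longrightarrow> T i (u + v) = T i u + T i v"
  and S_add: "u \<in> FF \<Longrightarrow> v \<in> FF \<Longrightarrow> S i j (u + v) = S i j u + S i j v"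
  unfolding T_def S_def by (simp_all only: nt_add nz_add distrib_left add_ac)

lemma nt_zc: "u \<in> FF \<Longrightarrow> nt (tmon 0 (z_coord i) * u) = tmon 0 (z_coord i) * (T i u + Lc i * u)"
proof -
  assume u: "u \<in> FF"
  have "nt (tmon 0 (z_coord i)) = X $ i * tmon 0 (z_coord i)"
    by (simp only: conn_def va_zc deriv_mon) (simp add: tmon_0)
  then show ?thesis
    by (simp add: nt_mult FF_mon z_coord_props u T_def algebra_simps)
qed

lemma nz_zc: "u \<in> FF \<Longrightarrow> nz j (tmon 0 (z_coord i) * u) = tmon 0 (z_coord i) * (S i j u + Mc i j * u)"
proof -
  assume u: "u \<in> FF"
  have "nz j (tmon 0 (z_coord i)) = Y j $ i * tmon 0 (z_coord i)"
    by (simp only: conn_def va_zc pz_mon z_coord_props tmon_0 add_0_left)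
  then show ?thesis
    by (simp add: nz_mult FF_mon z_coord_props u S_def algebra_simps)
qed

lemma T_base: "base_fun c \<Longrightarrow> u \<in> FF \<Longrightarrow> T i (tmon n c * u) = tmon n c * T i u + fls_deriv (tmon n c) * u"
proof -
  assume c: "base_fun c" and u: "u \<in> FF"
  have "tmon n c \<in> FF" using c by (simp add: FF_mon base_fun_def)
  moreover have "nt (tmon n c) = fls_deriv (tmon n c)" by (simp add: conn_def va_base[OF c])
  ultimately show ?thesis using u by (simp add: T_def nt_mult algebra_simps)
qed

lemma S_base: "base_fun c \<Longrightarrow> u \<in> FF \<Longrightarrow> S i j (tmon n c * u) = tmon n c * S i j u + tmon n (pz j c) * u"
proof -
  assume c: "base_fun c" and u: "u \<in> FF"
  have "tmon n c \<in> FF" using c by (simp add: FF_mon base_fun_def)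
  moreover have "nz j (tmon n c) = tmon n (pz j c)" by (simp add: conn_def va_base[OF c] pz_mon)
  ultimately show ?thesis using u by (simp add: S_def nz_mult algebra_simps)
qed

text \<open>Flatness is applied to z_i u. The scalars \<open>Lc i\<close> and \<open>Mc i j\<close>
  add no curvature, because the Z_j-derivative of Z_i / t^2 equals the t-derivative of
  \<open>Mc i j\<close>.\<close>

lemma T_S_comm:
  assumes u: "u \<in> FF"
  shows "T i (S i j u) = S i j (T i u)"
proof (rule z_coord_cancel[where i = i])
  let ?z = "tmon 0 (z_coord i)"
  note ff = FF_T FF_S FF_mult FF_add FF_Lc FF_Mc u
  have 1: "nt (nz j (?z * u)) = ?z * (T i (S i j u + Mc i j * u) + Lc i * (S i j u + Mc i j * u))"
    by (subst nz_zc[OF u], rule nt_zc) (intro ff)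
  have 2: "nz j (nt (?z * u)) = ?z * (S i j (T i u + Lc i * u) + Mc i j * (T i u + Lc i * u))"
    by (subst nt_zc[OF u], rule nz_zc) (intro ff)
  have 3: "T i (S i j u + Mc i j * u) = T i (S i j u) + (Mc i j * T i u + fls_deriv (Mc i j) * u)"
    unfolding Mc_def by (subst T_add) (auto intro!: FF_S FF_mult u FF_Mc[unfolded Mc_def] simp only: T_base[OF base_Mc u])
  have 4: "S i j (T i u + Lc i * u) = S i j (T i u) + (Lc i * S i j u + tmon (-2) (pz j (Z_coord i)) * u)"
    unfolding Lc_def by (subst S_add) (auto intro!: FF_T FF_mult u FF_Lc[unfolded Lc_def] simp only: S_base[OF base_fun_Zc u])
  have 5: "fls_deriv (Mc i j) = tmon (-2) (pz j (Z_coord i))"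
    unfolding Mc_def deriv_mon Z_coord_props by (rule fls_eqI) (simp add: tmon_nth)
  have "?z \<in> FF" by (intro FF_mon z_coord_props)
  then have "nt (nz j (?z * u)) = nz j (nt (?z * u))"
    by (intro flat_tZ FF_mult u)
  then show "?z * T i (S i j u) = ?z * S i j (T i u)"
    unfolding 1 2 3 4 5 by (simp add: algebra_simps)
qed (intro FF_T FF_S u)+

lemma S_S_comm:
  assumes u: "u \<in> FF"
  shows "S i k (S i j u) = S i j (S i k u)"
proof (rule z_coord_cancel[where i = i])
  let ?z = "tmon 0 (z_coord i)"
  note ff = FF_T FF_S FF_mult FF_add FF_Lc FF_Mc u
  have 1: "nz k (nz j (?z * u)) = ?z * (S i k (S i j u + Mc i j * u) + Mc i k * (S i j u + Mc i j * u))" for k j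
    by (subst nz_zc[OF u], rule nz_zc) (intro ff)
  have "pz k (if i = j then - unit_fun else 0) = 0" for k j
    by (simp only: O_an_uminus[OF unit_fun_props(1)] unit_fun_props pz_0 split: if_split) simp
  then have 3: "S i k (S i j u + Mc i j * u) = S i k (S i j u) + Mc i j * S i k u" for k j
    unfolding Mc_def by (subst S_add) (auto intro!: FF_S FF_mult u FF_Mc[unfolded Mc_def] simp only: S_base[OF base_Mc u] tmon_0 mult_zero_left add_0_right)
  have "?z \<in> FF" by (intro FF_mon z_coord_props)
  then have "nz k (nz j (?z * u)) = nz j (nz k (?z * u))"
    by (intro flat_ZZ FF_mult u)
  then show "?z * S i k (S i j u) = ?z * S i j (S i k u)"
    unfolding 1 3 by (simp add: algebra_simps)
qed (intro FF_S u)+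

text \<open>Subtracting the factor of the standard connection removes the leading pole and exposes
  the coefficient that \<open>X_mean\<close> speaks of.\<close>

lemma X_rem: "ord_ge (X $ i - Lc i) (-1)" "fls_nth (X $ i - Lc i) (-1) = fls_nth (X $ i) (-1)"
proof -
  have "ord_ge (X $ i - Lc i) (-2)" unfolding Lc_def by (intro ord_ge_diff X_vb ord_ge_mon)
  from ord_ge_Suc[OF this] show "ord_ge (X $ i - Lc i) (-1)"
    by (simp add: X_lead Lc_def tmon_nth)
  show "fls_nth (X $ i - Lc i) (-1) = fls_nth (X $ i) (-1)"
    by (simp add: Lc_def tmon_nth)
qed

lemma Y_rem: "ord_ge (Y j $ i - Mc i j) 0" "fls_nth (Y j $ i - Mc i j) 0 = fls_nth (Y j $ i) 0"
proof -
  have "ord_ge (Y j $ i - Mc i j) (-1)" unfolding Mc_def by (intro ord_ge_diff Y_vb ord_ge_mon)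
  from ord_ge_Suc[OF this] show "ord_ge (Y j $ i - Mc i j) 0"
    by (simp add: Y_lead Mc_def tmon_nth)
  show "fls_nth (Y j $ i - Mc i j) 0 = fls_nth (Y j $ i) 0"
    by (simp add: Mc_def tmon_nth)
qed

lemma Y_sum: "f \<in> OU \<Longrightarrow> (\<Sum>k\<in>UNIV. fls_nth (Y j $ k) (-1) * eu k f) = - eu j f"
proof -
  assume f: "f \<in> OU"
  have "(\<Sum>k\<in>UNIV. fls_nth (Y j $ k) (-1) * eu k f) = (\<Sum>k\<in>UNIV. if k = j then - eu k f else 0)"
    by (intro sum.cong refl) (auto simp: Y_lead unit_fun_mult eu_O[OF f])
  then show ?thesis by simp
qed

lemma T_lead:
  assumes u: "u \<in> FF" "ord_ge u a"
  shows "ord_ge (T i u) (a - 2)" "fls_nth (T i u) (a - 2) = (\<Sum>k\<in>UNIV. Z_coord k * eu k (fls_nth u a))"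
proof -
  have 1: "ord_ge (fls_deriv u) (a - 1)" "ord_ge ((X $ i - Lc i) * u) (a - 1)" "ord_ge (va X u) (a - 2)"
    using ord_ge_deriv[OF u(2)] ord_ge_times[OF X_rem(1) u(2)] ord_ge_va[OF X_vb u(2)] by simp_all
  show "ord_ge (T i u) (a - 2)"
    unfolding T_def conn_def using 1 by (intro ord_ge_add) (auto elim: ord_ge_mono)
  show "fls_nth (T i u) (a - 2) = (\<Sum>k\<in>UNIV. Z_coord k * eu k (fls_nth u a))"
  proof -
    have n: "a - 2 = -2 + a" "a - 2 < a - 1" by simp_all
    show ?thesis
      unfolding T_def conn_def fls_plus_nth ord_ge_nth[OF 1(1) n(2)] ord_ge_nth[OF 1(2) n(2)] va_nth_lead[OF X_vb u(2) n(1)]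
      by (simp only: X_lead add_0_left add_0_right)
  qed
qed

text \<open>When the leading coefficient does not depend on z, the order drops by one only. The
  derivative in t then contributes the factor a, and the t^-1 part of \<open>X\<close> enters by
  multiplication alone, since as a vector field it annihilates that coefficient.\<close>

lemma T_next:
  assumes u: "u \<in> FF" "ord_ge u a" and e: "\<And>k. eu k (fls_nth u a) = 0"
  shows "ord_ge (T i u) (a - 1)"
    "fls_nth (T i u) (a - 1) = of_int a * fls_nth u a + (\<Sum>k\<in>UNIV. Z_coord k * eu k (fls_nth u (a + 1)))
      + fls_nth (X $ i) (-1) * fls_nth u a"
proof -
  have "fls_nth (T i u) (a - 2) = 0"
    by (simp only: T_lead[OF u] e mult_zero_right sum.neutral_const)
  from ord_ge_Suc[OF T_lead(1)[OF u] this] show "ord_ge (T i u) (a - 1)" by simp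
  have "fls_nth (va X u) (a - 1) = (\<Sum>k\<in>UNIV. Z_coord k * eu k (fls_nth u (a + 1)))"
  proof -
    have n: "a - 1 = -2 + a + 1" by simp
    show ?thesis
      unfolding va_nth_next[OF X_vb u(2) n] by (simp only: X_lead e mult_zero_right add_0_right)
  qed
  moreover have "fls_nth ((X $ i - Lc i) * u) (a - 1) = fls_nth (X $ i) (-1) * fls_nth u a"
    by (subst times_nth_lead[OF X_rem(1) u(2)]) (simp, simp only: X_rem(2))
  ultimately show "fls_nth (T i u) (a - 1) = of_int a * fls_nth u a + (\<Sum>k\<in>UNIV. Z_coord k * eu k (fls_nth u (a + 1)))
      + fls_nth (X $ i) (-1) * fls_nth u a"
    unfolding T_def conn_def fls_plus_nth by simp
qed

lemma S_lead:
  assumes u: "u \<in> FF" "ord_ge u a"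
  shows "ord_ge (S i j u) (a - 1)" "fls_nth (S i j u) (a - 1) = - eu j (fls_nth u a)"
proof -
  have 1: "ord_ge (fls_map (pz j) u) a" "ord_ge ((Y j $ i - Mc i j) * u) a" "ord_ge (va (Y j) u) (a - 1)"
    using ord_ge_fls_map[OF derivation_pz u(2)] ord_ge_times[OF Y_rem(1) u(2)] ord_ge_va[OF Y_vb u(2)] by simp_all
  show "ord_ge (S i j u) (a - 1)"
    unfolding S_def conn_def using 1 by (intro ord_ge_add) (auto elim: ord_ge_mono)
  show "fls_nth (S i j u) (a - 1) = - eu j (fls_nth u a)"
  proof -
    have n: "a - 1 = -1 + a" "a - 1 < a" by simp_all
    show ?thesis
      unfolding S_def conn_def fls_plus_nth ord_ge_nth[OF 1(1) n(2)] ord_ge_nth[OF 1(2) n(2)] va_nth_lead[OF Y_vb u(2) n(1)]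
      by (simp only: Y_sum[OF FF_nth[OF u(1)]] add_0_left add_0_right)
  qed
qed

lemma S_next:
  assumes u: "u \<in> FF" "ord_ge u a" and e: "\<And>k. eu k (fls_nth u a) = 0"
  shows "ord_ge (S i j u) a"
    "fls_nth (S i j u) a = pz j (fls_nth u a) - eu j (fls_nth u (a + 1)) + fls_nth (Y j $ i) 0 * fls_nth u a"
proof -
  have "fls_nth (S i j u) (a - 1) = 0"
    by (simp only: S_lead[OF u] e minus_zero)
  from ord_ge_Suc[OF S_lead(1)[OF u] this] show "ord_ge (S i j u) a" by simp
  have "fls_nth (va (Y j) u) a = - eu j (fls_nth u (a + 1))"
  proof -
    have n: "a = -1 + a + 1" by simp
    show ?thesis
      unfolding va_nth_next[OF Y_vb u(2) n] 
      by (simp only: Y_sum[OF FF_nth[OF u(1)]] e mult_zero_right add_0_right)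
  qed
  moreover have "fls_nth ((Y j $ i - Mc i j) * u) a = fls_nth (Y j $ i) 0 * fls_nth u a"
    by (subst times_nth_lead[OF Y_rem(1) u(2)]) (simp, simp only: Y_rem(2))
  ultimately show "fls_nth (S i j u) a = pz j (fls_nth u a) - eu j (fls_nth u (a + 1)) + fls_nth (Y j $ i) 0 * fls_nth u a"
    unfolding S_def conn_def fls_plus_nth fls_map_nth'[OF derivation_pz] by simp
qed

end

section \<open>Solution of the linear systems order by order in t\<close>

context open_base begin

text \<open>Completeness in the t-adic sense; the common bound \<open>b\<close> keeps the pole of
  the limit finite.\<close>

lemma FF_limit:
  assumes FF: "\<And>m. G m \<in> FF" and step: "\<And>m. ord_ge (G (Suc m) - G m) (int m)" and b: "\<And>m. ord_ge (G m) b"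
  obtains F where "F \<in> FF" "\<And>m. ord_ge (F - G m) (int m)" "ord_ge F b"
proof -
  have tail: "ord_ge (G (m + k) - G m) (int m)" for m k
  proof (induction k)
    case (Suc k)
    have "ord_ge (G (Suc (m + k)) - G (m + k)) (int m)"
      using ord_ge_mono[OF step[of "m + k"], of "int m"] by simp
    from ord_ge_add[OF this Suc] show ?case by simp
  qed simp
  \<comment> \<open>The coefficient of t^n no longer changes from the term with index n + 1 on; for
    negative n \<open>nat\<close> gives \<open>G 0\<close>, whose polar part is already
    final.\<close>
  define F where "F = Abs_fls (\<lambda>n. fls_nth (G (nat (n + 1))) n)"
  have nth: "fls_nth F n = fls_nth (G (nat (n + 1))) n" for n
    unfolding F_def by (rule nth_Abs_fls_lower_bound[of b]) (use b in \<open>auto simp: ord_ge_def\<close>)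
  have "ord_ge (F - G m) (int m)" for m
    unfolding ord_ge_def
  proof (intro allI impI)
    fix n assume n: "n < int m"
    define k where "k = nat (n + 1)"
    show "fls_nth (F - G m) n = 0"
    proof (cases "n \<ge> 0")
      case True
      have "k \<le> m" "n < int k" using n True by (auto simp: k_def)
      then have "fls_nth (G m - G k) n = 0"
        using ord_ge_nth[OF tail[of k "m - k"], of n] by simp
      then show ?thesis by (simp add: nth k_def)
    next
      case False
      then have "k = 0" by (simp add: k_def)
      then have "fls_nth (G m - G k) n = 0"
        using ord_ge_nth[OF tail[of 0 m], of n] False by simp
      then show ?thesis by (simp add: nth k_def)
    qed
  qed
  moreover have "F \<in> FF" by (rule FF_I) (simp add: nth FF_nth FF)
  moreover have "ord_ge F b" using b by (simp add: ord_ge_def nth)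
  ultimately show ?thesis using that by blast
qed

end

context flat_data begin

text \<open>The offset between the two bounds reflects the effect of corrections: both t^m c with c
  independent of z and t^(m+1) s change \<open>T i u\<close> from order m - 1 on and
  \<open>S i j u\<close> from order m on.\<close>

definition residual :: "'n \<Rightarrow> int \<Rightarrow> 'n fn fls \<Rightarrow> bool" where
  "residual i m u \<longleftrightarrow> u \<in> FF \<and> ord_ge (T i u) (m - 1) \<and> (\<forall>j. ord_ge (S i j u) m)"

lemma residualD:
  assumes "residual i m u"
  shows "u \<in> FF" "ord_ge (T i u) (m - 1)" "ord_ge (S i j u) m"
    "fls_nth (T i u) (m - 1) \<in> OU" "fls_nth (S i j u) m \<in> OU"
  using assms FF_T FF_S FF_nth unfolding residual_def by blast+

text \<open>Let a and b_j be the leading residuals. Commutation of the S_j makes the family b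
  closed, and s is a primitive of b minus its mean. Commutation of T with S_j shows that the leading
  residual of T after the correction is annihilated by every \<open>eu j\<close>, so it is its own
  mean.\<close>

lemma kill_nonconstant:
  assumes r: "residual i m u"
  obtains s where "s \<in> OU" "residual i m (u + tmon (m + 1) s)"
    "fls_nth (T i (u + tmon (m + 1) s)) (m - 1) = mean (fls_nth (T i u) (m - 1))"
    "\<And>j. fls_nth (S i j (u + tmon (m + 1) s)) m = mean (fls_nth (S i j u) m)"
proof -
  note u = residualD(1)[OF r] and vT = residualD(2)[OF r] and vS = residualD(3)[OF r]
  define a where "a = fls_nth (T i u) (m - 1)"
  define b where "b j = fls_nth (S i j u) m" for j
  have aO: "a \<in> OU" and bO: "b j \<in> OU" for j
    using residualD(4,5)[OF r] by (simp_all add: a_def b_def)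
  have m1: "m - 1 - 1 = m - 2" by simp
  have ab: "(\<Sum>k\<in>UNIV. Z_coord k * eu k (b j)) = - eu j a" for j
  proof -
    have "fls_nth (T i (S i j u)) (m - 2) = (\<Sum>k\<in>UNIV. Z_coord k * eu k (b j))"
      unfolding b_def by (rule T_lead(2)[OF FF_S[OF u] vS])
    moreover have "fls_nth (S i j (T i u)) (m - 2) = - eu j a"
      unfolding a_def by (rule S_lead(2)[OF FF_T[OF u] vT, unfolded m1])
    ultimately show ?thesis using T_S_comm[OF u, of i j] by simp
  qed
  have bb: "eu k (b j) = eu j (b k)" for j k
  proof -
    have "fls_nth (S i k (S i j u)) (m - 1) = - eu k (b j)" for j k
      unfolding b_def by (rule S_lead(2)[OF FF_S[OF u] vS])
    from this[of k j] this[of j k] show ?thesis using S_S_comm[OF u, of i k j] by simp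
  qed
  obtain s where s: "s \<in> OU" "\<And>j. eu j s = b j - mean (b j)"
    using primitive[of b] bO bb by metis
  define \<Delta> where "\<Delta> = tmon (m + 1) s"
  have D: "\<Delta> \<in> FF" "ord_ge \<Delta> (m + 1)" "fls_nth \<Delta> (m + 1) = s"
    by (simp_all add: \<Delta>_def FF_mon s ord_ge_mon tmon_nth)
  have TD: "ord_ge (T i \<Delta>) (m - 1)" "fls_nth (T i \<Delta>) (m - 1) = (\<Sum>k\<in>UNIV. Z_coord k * eu k s)"
    using T_lead[OF D(1,2), of i] D(3) by simp_all
  have SD: "ord_ge (S i j \<Delta>) m" "fls_nth (S i j \<Delta>) m = - eu j s" for j
    using S_lead[OF D(1,2), of i j] D(3) by simp_all
  define q where "q = a + (\<Sum>k\<in>UNIV. Z_coord k * eu k s)"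
  have sumO: "(\<Sum>k\<in>UNIV. Z_coord k * eu k s) \<in> OU"
    by (intro O_an_sum O_an_mult Z_coord_props eu_O s)
  have qO: "q \<in> OU" unfolding q_def by (intro O_an_add aO sumO)
  \<comment> \<open>\<open>eu j\<close> turns the sum in q into the left side of \<open>ab\<close>,
    so it cancels \<open>eu j a\<close>.\<close>
  have "eu j q = 0" for j
  proof -
    have "eu j (\<Sum>k\<in>UNIV. Z_coord k * eu k s) = (\<Sum>k\<in>UNIV. eu j (Z_coord k * eu k s))"
      by (rule derivation_sum[OF derivation_eu]) (intro O_an_mult Z_coord_props eu_O s)
    also have "\<dots> = (\<Sum>k\<in>UNIV. Z_coord k * eu k (b j))"
    proof (rule sum.cong[OF refl])
      fix k
      have "eu j (eu k s) = eu k (eu j s)" by (rule eu_eu[OF s(1)])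
      also have "\<dots> = eu k (b j) - eu k (mean (b j))"
        unfolding s(2) by (rule O_an_diff) (intro bO mean_O)+
      also have "\<dots> = eu k (b j)" by (simp only: eu_mean[OF bO] diff_zero)
      finally show "eu j (Z_coord k * eu k s) = Z_coord k * eu k (b j)"
        by (simp only: O_an_mult(2)[OF Z_coord_props(1) eu_O[OF s(1)]] Z_coord_props(2) mult_zero_left add_0_right)
    qed
    finally show ?thesis
      unfolding q_def by (simp only: O_an_add(2)[OF aO sumO] ab) simp
  qed
  then have "base_fun q" by (simp add: base_fun_def qO)
  then have "q = mean q" by (simp only: mean_base)
  also have "\<dots> = mean a + mean (\<Sum>k\<in>UNIV. Z_coord k * eu k s)"
    unfolding q_def by (rule mean_add[OF aO sumO])
  also have "\<dots> = mean a" by (simp only: mean_sum_eu[of "\<lambda>_. s", OF s(1)] add_0_right)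
  finally have q: "q = mean a" .
  show ?thesis
  proof (rule that[OF s(1)])
    show "residual i m (u + tmon (m + 1) s)"
      unfolding residual_def \<Delta>_def[symmetric] T_add[OF u D(1)] S_add[OF u D(1)]
      by (intro conjI allI FF_add u D ord_ge_add vT vS TD SD)
    show "fls_nth (T i (u + tmon (m + 1) s)) (m - 1) = mean (fls_nth (T i u) (m - 1))"
      unfolding \<Delta>_def[symmetric] T_add[OF u D(1)] fls_plus_nth TD a_def[symmetric] q_def[symmetric] by (rule q)
    show "fls_nth (S i j (u + tmon (m + 1) s)) m = mean (fls_nth (S i j u) m)" for j
      unfolding \<Delta>_def[symmetric] S_add[OF u D(1)] fls_plus_nth SD b_def[symmetric] s(2) by simp
  qed
qed

lemma raise_order:
  assumes r: "residual i m u" and a: "mean (fls_nth (T i u) (m - 1)) = 0"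
    and b: "\<And>j. mean (fls_nth (S i j u) m) = 0"
  obtains s where "s \<in> OU" "residual i (m + 1) (u + tmon (m + 1) s)"
proof -
  obtain s where s: "s \<in> OU" "residual i m (u + tmon (m + 1) s)"
    "fls_nth (T i (u + tmon (m + 1) s)) (m - 1) = mean (fls_nth (T i u) (m - 1))"
    "\<And>j. fls_nth (S i j (u + tmon (m + 1) s)) m = mean (fls_nth (S i j u) m)"
    using kill_nonconstant[OF r] by blast
  have "ord_ge (T i (u + tmon (m + 1) s)) (m - 1 + 1)"
    by (rule ord_ge_Suc[OF residualD(2)[OF s(2)]]) (simp only: s a)
  moreover have "ord_ge (S i j (u + tmon (m + 1) s)) (m + 1)" for j
    by (rule ord_ge_Suc[OF residualD(3)[OF s(2)]]) (simp only: s b)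
  ultimately have "residual i (m + 1) (u + tmon (m + 1) s)"
    using residualD(1)[OF s(2)] by (simp add: residual_def)
  with s(1) show ?thesis by (rule that)
qed

lemma base_fun_mult_cst: "base_fun c \<Longrightarrow> base_fun (const_fun x * c)"
  using O_an_mult[OF const_fun_props(1)[where c = x]] const_fun_props by (auto simp: base_fun_def)

text \<open>Once the leading residuals \<open>a\<close> of \<open>T\<close> and \<open>b\<^sub>j\<close> of \<open>S\<close> have been made independent of \<open>z\<close>, the
  commutation of \<open>T\<close> and \<open>S\<close> gives \<open>m b\<^sub>j = \<partial>a / \<partial>Z\<^sub>j\<close>. Adding \<open>t\<^sup>m c\<close> with \<open>c = - a / m\<close> then replaces
  them by multiples of \<open>c\<close> by functions of mean zero, which \<open>raise_order\<close> can remove.\<close>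

lemma residual_step:
  assumes r: "residual i m u" and m: "m \<ge> 1"
  obtains v where "residual i (m + 1) v" "ord_ge (v - u) m"
proof -
  obtain s where s: "s \<in> OU" "residual i m (u + tmon (m + 1) s)"
    "fls_nth (T i (u + tmon (m + 1) s)) (m - 1) = mean (fls_nth (T i u) (m - 1))"
    "\<And>j. fls_nth (S i j (u + tmon (m + 1) s)) m = mean (fls_nth (S i j u) m)"
    using kill_nonconstant[OF r] by blast
  define u1 where "u1 = u + tmon (m + 1) s"
  note r1 = s(2)[folded u1_def]
  note u1 = residualD(1)[OF r1] and vT = residualD(2)[OF r1] and vS = residualD(3)[OF r1]
  define a where "a = fls_nth (T i u1) (m - 1)"
  define b where "b j = fls_nth (S i j u1) m" for j
  have ba: "base_fun a" and bb: "base_fun (b j)" for j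
    using s(3,4) residualD(4,5)[OF r] by (simp_all add: a_def b_def u1_def base_fun_mean)
  then have aO: "a \<in> OU" and bO: "b j \<in> OU" and ea: "eu k a = 0" and eb: "eu k (b j) = 0" for j k
    by (simp_all add: base_fun_def)
  define x where "x = fls_nth (X $ i) (-1)"
  define y where "y j = fls_nth (Y j $ i) 0" for j
  have xO: "x \<in> OU" and yO: "y j \<in> OU" for j
    by (simp_all add: x_def y_def FF_nth FV_nth X_FV Y_FV)
  have mx: "mean x = 0" and my: "mean (y j) = 0" for j by (simp_all add: x_def y_def X_mean Y_mean)
  have mean_mult': "mean (f * c) = 0" if "base_fun c" "f \<in> OU" "mean f = 0" for f c
    using mean_mult[OF that(1), of f] that(3) by (simp only: mult.commute[of f] mult_zero_right)
  \<comment> \<open>The coefficient of t^(m-1) in the commutation of T and S_j, after taking means: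
    Euler derivatives have mean zero, and so do the products of x and y_j with functions of
    Z.\<close>
  have mb: "of_int m * b j = pz j a" for j
  proof -
    define b' where "b' = fls_nth (S i j u1) (m + 1)"
    define a' where "a' = fls_nth (T i u1) m"
    have O': "b' \<in> OU" "a' \<in> OU" by (simp_all add: b'_def a'_def FF_nth FF_S FF_T u1)
    have eb': "eu k (fls_nth (S i j u1) m) = 0" for k using eb by (simp only: b_def)
    have ea': "eu k (fls_nth (T i u1) (m - 1)) = 0" for k using ea by (simp only: a_def)
    have mm: "m - 1 + 1 = m" by simp
    have "of_int m * b j + (\<Sum>k\<in>UNIV. Z_coord k * eu k b') + x * b j = pz j a - eu j a' + y j * a"
      using T_next(2)[OF FF_S[OF u1] vS eb', of i] S_next(2)[OF FF_T[OF u1] vT ea', of i j] T_S_comm[OF u1, of i j]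
      unfolding mm a_def b_def a'_def b'_def x_def y_def by simp
    then have "mean (of_int m * b j + (\<Sum>k\<in>UNIV. Z_coord k * eu k b') + x * b j) = mean (pz j a - eu j a' + y j * a)"
      by (rule arg_cong)
    moreover have "mean (of_int m * b j + (\<Sum>k\<in>UNIV. Z_coord k * eu k b') + x * b j) =
       mean (of_int m * b j) + mean (\<Sum>k\<in>UNIV. Z_coord k * eu k b') + mean (x * b j)"
      by (subst mean_add, (intro O_an_add of_int_mult_O bO O_an_sum O_an_mult Z_coord_props eu_O O' xO)+,
          subst mean_add, (intro O_an_add of_int_mult_O bO O_an_sum O_an_mult Z_coord_props eu_O O' xO refl)+)
    moreover have "mean (pz j a - eu j a' + y j * a) = mean (pz j a) - mean (eu j a') + mean (y j * a)"
      by (subst mean_add, (intro O_an_diff O_an_mult pz_O eu_O aO O' yO)+,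
          subst mean_diff, (intro pz_O eu_O aO O' refl)+)
    moreover have "base_fun (of_int m * b j)"
      unfolding base_fun_def by (simp only: of_int_mult_O[OF bO] eb mult_zero_right simp_thms)
    moreover have "base_fun (pz j a)"
      unfolding base_fun_def by (simp only: pz_O[OF aO] pz_eu[OF aO, symmetric] ea pz_0 simp_thms)
    ultimately show ?thesis
      by (simp only: mean_base mean_sum_eu[of "\<lambda>_. b'", OF O'(1)] mean_mult'[OF bb xO mx] mean_mult'[OF ba yO my]
          mean_eu[OF O'(2)] add_0_right diff_zero)
  qed
  define c where "c = const_fun (- (1 / of_int m)) * a"
  have bc: "base_fun c" unfolding c_def by (rule base_fun_mult_cst[OF ba])
  have cO: "c \<in> OU" and ec: "eu k c = 0" for k using bc by (simp_all add: base_fun_def)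
  have mc: "of_int m * c = - a"
  proof (rule fn_eqI)
    show "(of_int m * c) p = (- a) p" if "p \<in> TS" for p
      using m that by (simp add: c_def const_fun_def of_int_fun_apply)
  qed (simp_all add: c_def O_an_zero[OF aO])
  \<comment> \<open>By \<open>mb\<close> the same c that cancels a also cancels every b_j.\<close>
  have pc: "pz j c = - b j" for j
  proof (rule fn_eqI)
    fix p assume p: "p \<in> TS"
    have "pz j c p = - (1 / of_int m) * pz j a p"
      using p by (simp add: c_def O_an_mult(3)[OF const_fun_props(1) aO] const_fun_props const_fun_def)
    also have "pz j a p = of_int m * b j p" using mb[of j] by (metis of_int_fun_apply times_fun_apply)
    finally show "pz j c p = (- b j) p" using m by simp
  qed (simp_all add: pz_zero O_an_zero[OF bO])
  define \<Delta> where "\<Delta> = tmon m c"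
  have D: "\<Delta> \<in> FF" "ord_ge \<Delta> m" "fls_nth \<Delta> m = c" "fls_nth \<Delta> (m + 1) = 0" 
    by (simp_all add: \<Delta>_def FF_mon cO ord_ge_mon tmon_nth)
  have eD: "eu k (fls_nth \<Delta> m) = 0" for k by (simp only: D ec)
  have TD: "ord_ge (T i \<Delta>) (m - 1)" "fls_nth (T i \<Delta>) (m - 1) = - a + x * c"
    using T_next[OF D(1,2) eD, of i]
    by (simp_all only: D mc x_def euler_0 mult_zero_right sum.neutral_const add_0_right)
  have SD: "ord_ge (S i j \<Delta>) m" "fls_nth (S i j \<Delta>) m = - b j + y j * c" for j
    using S_next[OF D(1,2) eD, of i j] by (simp_all only: D pc y_def euler_0 diff_zero)
  define u2 where "u2 = u1 + \<Delta>"
  have r2: "residual i m u2"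
    unfolding residual_def u2_def T_add[OF u1 D(1)] S_add[OF u1 D(1)]
    by (intro conjI allI FF_add u1 D ord_ge_add vT vS TD SD)
  have "fls_nth (T i u2) (m - 1) = x * c"
    unfolding u2_def T_add[OF u1 D(1)] fls_plus_nth TD a_def[symmetric] by simp
  moreover have "fls_nth (S i j u2) m = y j * c" for j
    unfolding u2_def S_add[OF u1 D(1)] fls_plus_nth SD b_def[symmetric] by simp
  ultimately obtain s' where s': "s' \<in> OU" "residual i (m + 1) (u2 + tmon (m + 1) s')"
    using raise_order[OF r2] mean_mult'[OF bc xO mx] mean_mult'[OF bc yO my] by metis
  have "u2 + tmon (m + 1) s' - u = tmon (m + 1) s + \<Delta> + tmon (m + 1) s'"
    by (simp add: u2_def u1_def)
  moreover have "ord_ge \<dots> m"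
    using ord_ge_mono[OF ord_ge_mon, of m "m + 1"] D(2) by (intro ord_ge_add) auto
  ultimately have "ord_ge (u2 + tmon (m + 1) s' - u) m" by (simp only:)
  then show ?thesis by (rule that[OF s'(2)])
qed

lemma T_S_of_ind:
  shows "T i (tmon 0 unit_fun) = X $ i - Lc i" "S i j (tmon 0 unit_fun) = Y j $ i - Mc i j"
proof -
  have F: "X $ i - Lc i \<in> FF" "Y j $ i - Mc i j \<in> FF"
    by (intro FF_diff FV_nth X_FV Y_FV FF_Lc FF_Mc)+
  show "T i (tmon 0 unit_fun) = X $ i - Lc i"
    using unit_fun_times[OF F(1)] by (simp add: T_def conn_def va_base[OF base_fun_ind] deriv_mon tmon_0 mult.commute)
  show "S i j (tmon 0 unit_fun) = Y j $ i - Mc i j"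
    using unit_fun_times[OF F(2)] by (simp add: S_def conn_def va_base[OF base_fun_ind] pz_mon unit_fun_props tmon_0 mult.commute)
qed

text \<open>At order 0 no correction independent of z is available, since u is normalized to 1, so
  the means of the leading residuals of 1 have to vanish by themselves, as \<open>X_mean\<close> and
  \<open>Y_mean\<close> say. All later steps have m \<ge> 1.\<close>

lemma flat_solution:
  obtains u where "u \<in> FF" "ord_ge (u - tmon 0 unit_fun) 1" "T i u = 0" "\<And>j. S i j u = 0"
proof -
  have r0: "residual i 0 (tmon 0 unit_fun)"
    unfolding residual_def T_S_of_ind using X_rem(1) Y_rem(1) unit_fun_props by (simp add: FF_mon)
  obtain s where s: "s \<in> OU" "residual i (0 + 1) (tmon 0 unit_fun + tmon (0 + 1) s)"
  proof (rule raise_order[OF r0])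
    show "mean (fls_nth (T i (tmon 0 unit_fun)) (0 - 1)) = 0"
      unfolding T_S_of_ind diff_0 X_rem(2) by (rule X_mean)
    show "mean (fls_nth (S i j (tmon 0 unit_fun)) 0) = 0" for j
      unfolding T_S_of_ind Y_rem(2) by (rule Y_mean)
  qed
  define P where "P m u \<longleftrightarrow> residual i (int m + 1) u \<and> ord_ge (u - tmon 0 unit_fun) 1" for m u
  have "\<exists>G. \<forall>m. P m (G m) \<and> ord_ge (G (Suc m) - G m) (int m)"
  proof (rule dependent_nat_choice)
    have "ord_ge (tmon 0 unit_fun + tmon 1 s - tmon 0 unit_fun) 1" by (simp add: ord_ge_mon)
    then show "\<exists>u. P 0 u" using s(2) unfolding P_def by auto
  next
    fix u m assume P: "P m u"
    then obtain v where v: "residual i (int m + 1 + 1) v" "ord_ge (v - u) (int m + 1)"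
      using residual_step[of i "int m + 1" u] unfolding P_def by auto
    have "ord_ge ((v - u) + (u - tmon 0 unit_fun)) 1"
      using ord_ge_mono[OF v(2), of 1] P unfolding P_def by (intro ord_ge_add) auto
    then have "P (Suc m) v" using v(1) unfolding P_def by (simp add: algebra_simps)
    moreover have "ord_ge (v - u) (int m)" by (rule ord_ge_mono[OF v(2)]) simp
    ultimately show "\<exists>v. P (Suc m) v \<and> ord_ge (v - u) (int m)" by blast
  qed
  then obtain G where G: "\<And>m. residual i (int m + 1) (G m)" "\<And>m. ord_ge (G m - tmon 0 unit_fun) 1"
    "\<And>m. ord_ge (G (Suc m) - G m) (int m)" unfolding P_def by blast
  have GF: "G m \<in> FF" for m using residualD(1)[OF G(1)] .
  have "ord_ge (G m) 0" for m
  proof -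
    have "ord_ge (G m - tmon 0 unit_fun) 0" by (rule ord_ge_mono[OF G(2)]) simp
    from ord_ge_add[OF this ord_ge_mon[of 0 unit_fun]] show ?thesis by simp
  qed
  from FF_limit[of G, OF GF G(3) this] obtain u where u: "u \<in> FF" "\<And>m. ord_ge (u - G m) (int m)" by blast
  have uG: "u = G m + (u - G m)" "u - G m \<in> FF" for m using u GF by (simp_all add: FF_diff)
  \<comment> \<open>T and S_j lower the order by at most 2, so the residuals of the limit are
    controlled by those of the approximations.\<close>
  have "ord_ge (T i u) (int m - 2)" "ord_ge (S i j u) (int m - 2)" for m j
  proof -
    have "ord_ge (T i (G m)) (int m - 2)" "ord_ge (S i j (G m)) (int m - 2)"
      using ord_ge_mono[OF residualD(2)[OF G(1)[of m]], of "int m - 2"]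
        ord_ge_mono[OF residualD(3)[OF G(1)[of m]], of "int m - 2" j] by simp_all
    moreover have "ord_ge (T i (u - G m)) (int m - 2)" "ord_ge (S i j (u - G m)) (int m - 2)"
      using T_lead(1)[OF uG(2) u(2), of i m] ord_ge_mono[OF S_lead(1)[OF uG(2) u(2)], of "int m - 2" m i j] by simp_all
    ultimately have "ord_ge (T i (G m) + T i (u - G m)) (int m - 2)" "ord_ge (S i j (G m) + S i j (u - G m)) (int m - 2)"
      by (blast intro: ord_ge_add)+
    then show "ord_ge (T i u) (int m - 2)" "ord_ge (S i j u) (int m - 2)"
      using T_add[OF GF uG(2), of i m m] S_add[OF GF uG(2), of i j m m] uG(1)[of m] by simp_all
  qed
  note v = this
  have zero: "F = 0" if "\<And>m. ord_ge F (int m - 2)" for F :: "'n fn fls"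
  proof (rule fls_eqI)
    show "fls_nth F n = fls_nth 0 n" for n
      using ord_ge_nth[OF that[of "nat (n + 3)"], of n] by simp
  qed
  have "ord_ge (u - G 1) 1" using u(2)[of 1] by simp
  from ord_ge_add[OF this G(2)[of 1]] have "ord_ge (u - tmon 0 unit_fun) 1" by simp
  with that[OF u(1)] zero[OF v(1)] zero[OF v(2)] show ?thesis by blast
qed

text \<open>If c t^n is the leading term, S_j makes c independent of z, and then the mean of the
  coefficient of t^(n-1) in \<open>T i u\<close> gives n c = 0 with n \<ge> 1.\<close>

lemma flat_solution_zero:
  assumes u: "u \<in> FF" "ord_ge u 1" and T: "T i u = 0" and S: "\<And>j. S i j u = 0"
  shows "u = 0"
proof (rule ord_ge_all_0[OF u(2)])
  fix n assume n: "1 \<le> n" and v: "ord_ge u n"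
  let ?c = "fls_nth u n"
  have c: "?c \<in> OU" "fls_nth u (n + 1) \<in> OU" using u by (simp_all add: FF_nth)
  have e: "eu k ?c = 0" for k using S_lead(2)[OF u(1) v, of i k] S[of k] by simp
  have xO: "fls_nth (X $ i) (-1) \<in> OU" by (simp add: FF_nth FV_nth X_FV)
  have bc: "base_fun ?c" using c e by (simp add: base_fun_def)
  have bm: "base_fun (of_int n * ?c)"
    unfolding base_fun_def by (simp only: of_int_mult_O[OF c(1)] e mult_zero_right simp_thms)
  have "of_int n * ?c + (\<Sum>k\<in>UNIV. Z_coord k * eu k (fls_nth u (n + 1))) + ?c * fls_nth (X $ i) (-1) = 0"
    using T_next(2)[OF u(1) v e, of i] T by (simp add: mult.commute)
  then have "mean (of_int n * ?c + (\<Sum>k\<in>UNIV. Z_coord k * eu k (fls_nth u (n + 1))) + ?c * fls_nth (X $ i) (-1)) = 0"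
    by (simp only: mean_0)
  moreover have "mean (of_int n * ?c + (\<Sum>k\<in>UNIV. Z_coord k * eu k (fls_nth u (n + 1))) + ?c * fls_nth (X $ i) (-1))
     = mean (of_int n * ?c) + mean (\<Sum>k\<in>UNIV. Z_coord k * eu k (fls_nth u (n + 1))) + mean (?c * fls_nth (X $ i) (-1))"
    by (subst mean_add, (intro O_an_add of_int_mult_O c O_an_sum O_an_mult Z_coord_props eu_O xO)+,
        subst mean_add, (intro O_an_add of_int_mult_O c O_an_sum O_an_mult Z_coord_props eu_O xO refl)+)
  ultimately have "of_int n * ?c = 0"
    by (simp only: mean_base[OF bm] mean_sum_eu[of "\<lambda>_. fls_nth u (n + 1)", OF c(2)] mean_mult[OF bc] X_mean mult_zero_right add_0_right)
  then have "of_int n * ?c p = 0" for p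
    by (metis of_int_fun_apply times_fun_apply zero_fun_apply)
  then show "?c = 0" using n by (simp add: fun_eq_iff)
qed

end

section \<open>Exponentials\<close>

lemma sum_square_triangle:
  fixes c :: "nat \<Rightarrow> nat \<Rightarrow> 'a::comm_monoid_add"
  assumes "\<And>i j. i + j \<ge> N \<Longrightarrow> c i j = 0"
  shows "(\<Sum>i<N. \<Sum>j<N. c i j) = (\<Sum>k<N. \<Sum>i\<le>k. c i (k - i))"
proof -
  have "(\<Sum>i<N. \<Sum>j<N. c i j) = (\<Sum>(i,j)\<in>{..<N} \<times> {..<N}. c i j)"
    by (rule sum.cartesian_product)
  also have "\<dots> = (\<Sum>(i,j)\<in>{(i,j). i + j < N}. c i j)"
    by (intro sum.mono_neutral_right) (auto intro!: assms simp: not_less)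
  also have "\<dots> = (\<Sum>k<N. \<Sum>i\<le>k. c i (k - i))"
    by (rule sum.triangle_reindex)
  finally show ?thesis .
qed

lemma fun_sum_apply: "(sum f A :: 'a \<Rightarrow> 'b::comm_monoid_add) p = (\<Sum>i\<in>A. f i p)"
  by (induction A rule: infinite_finite_induct) auto

context open_base begin

lemma Lie_H_iff: "\<eta> \<in> Lie_H U \<longleftrightarrow> \<eta> \<in> FV \<and> (\<forall>i. ord_ge (\<eta> $ i) 1)"
proof
  assume "\<eta> \<in> Lie_H U"
  then obtain h where h: "\<eta> = vfield_series h" "h 0 = 0" "\<And>l. l \<ge> 1 \<Longrightarrow> h l \<in> g_an U"
    by (auto simp: Lie_H_def)
  have nth: "fls_nth (\<eta> $ i) n = (if n < 1 then 0 else h (nat n) $ i)" for i n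
    using h(2) by (auto simp: h(1) vfield_series_def nat_eq_iff)
  show "\<eta> \<in> FV \<and> (\<forall>i. ord_ge (\<eta> $ i) 1)"
    using h(3) zero_O by (auto simp: FV_def ord_ge_def nth g_an_def intro!: FF_I)
next
  assume *: "\<eta> \<in> FV \<and> (\<forall>i. ord_ge (\<eta> $ i) 1)"
  define h where "h l = (\<chi> i. fls_nth (\<eta> $ i) (int l))" for l
  have "\<eta> = vfield_series h"
    unfolding vec_eq_iff
  proof
    fix i show "\<eta> $ i = vfield_series h $ i"
      by (rule fls_eqI) (use * in \<open>auto simp: vfield_series_def h_def ord_ge_def\<close>)
  qed
  moreover have "h 0 = 0" using * by (auto simp: h_def vec_eq_iff ord_ge_def)
  moreover have "h l \<in> g_an U" for l
    using * by (auto simp: h_def g_an_def FV_def FF_nth)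
  ultimately show "\<eta> \<in> Lie_H U" unfolding Lie_H_def by blast
qed

lemma Lie_HD: "\<eta> \<in> Lie_H U \<Longrightarrow> \<eta> \<in> FV" "\<eta> \<in> Lie_H U \<Longrightarrow> ord_ge (\<eta> $ i) 1"
  by (auto simp: Lie_H_iff)

lemma Lie_H_uminus: "\<eta> \<in> Lie_H U \<Longrightarrow> - \<eta> \<in> Lie_H U"
  by (auto simp: Lie_H_iff FV_def FF_uminus ord_ge_uminus)

definition scal :: "complex \<Rightarrow> 'n fn fls \<Rightarrow> 'n fn fls" where "scal c F = tmon 0 (const_fun c) * F"

lemma FF_sc: "F \<in> FF \<Longrightarrow> scal c F \<in> FF"
  unfolding scal_def by (intro FF_mult FF_mon const_fun_props)

lemma scal_nth: "F \<in> FF \<Longrightarrow> fls_nth (scal c F) n p = c * fls_nth F n p"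
  using O_an_zero[OF FF_nth, of F p n] by (simp add: scal_def tmon_times_nth const_fun_def)

lemma base_fun_cst: "base_fun (const_fun c)"
  by (simp add: base_fun_def const_fun_props)

lemma va_base_mult: "base_fun c \<Longrightarrow> F \<in> FF \<Longrightarrow> va X (tmon n c * F) = tmon n c * va X F"
  by (subst va_mult) (auto simp: va_base FF_mon base_fun_def)

lemma va_sc: "F \<in> FF \<Longrightarrow> va X (scal c F) = scal c (va X F)"
  unfolding scal_def by (rule va_base_mult[OF base_fun_cst])

text \<open>The model is the family of \<open>i\<close>-fold commutators of \<open>\<eta>\<close> with a connection, whose pole of
  order \<open>2\<close> accounts for the shift by \<open>-2\<close>.\<close>

definition raising :: "(nat \<Rightarrow> 'n fn fls \<Rightarrow> 'n fn fls) \<Rightarrow> bool" where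
  "raising P \<longleftrightarrow> (\<forall>i. \<forall>F\<in>FF. P i F \<in> FF \<and> (\<forall>G\<in>FF. P i (F + G) = P i F + P i G) \<and>
     (\<forall>c. P i (scal c F) = scal c (P i F)) \<and> (\<forall>a. ord_ge F a \<longrightarrow> ord_ge (P i F) (a + int i - 2)))"

lemma raisingD:
  assumes "raising P" "F \<in> FF"
  shows "P i F \<in> FF" "G \<in> FF \<Longrightarrow> P i (F + G) = P i F + P i G" "P i (scal c F) = scal c (P i F)"
    "ord_ge F a \<Longrightarrow> ord_ge (P i F) (a + int i - 2)"
  using assms unfolding raising_def by blast+

lemma raising_sum:
  assumes P: "raising P" and F: "\<And>k. F k \<in> FF"
  shows "P i (\<Sum>k<(N::nat). F k) = (\<Sum>k<N. P i (F k))"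
proof (induction N)
  case 0
  have "P i (0 + 0) = P i 0 + P i 0" by (rule raisingD(2)[OF P]) (rule FF_0)+
  then show ?case by simp
next
  case (Suc N)
  have "P i ((\<Sum>k<N. F k) + F N) = P i (\<Sum>k<N. F k) + P i (F N)"
    by (rule raisingD(2)[OF P FF_sum[OF F] F])
  then show ?case using Suc by simp
qed

context
  fixes \<eta> :: "'n vseries" assumes \<eta>: "\<eta> \<in> Lie_H U"
begin

lemma FF_pow: "F \<in> FF \<Longrightarrow> (va \<eta> ^^ k) F \<in> FF"
  by (induction k) (auto intro: FF_va Lie_HD \<eta>)

lemma ord_ge_pow: "ord_ge F a \<Longrightarrow> ord_ge ((va \<eta> ^^ k) F) (a + int k)"
proof (induction k)
  case (Suc k)
  from ord_ge_va[OF Lie_HD(2)[OF \<eta>] Suc.IH[OF Suc.prems]] show ?case by (simp add: algebra_simps)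
qed simp

lemma vexp_nth_vb:
  assumes "ord_ge F a" "int N > n - a"
  shows "fls_nth (vexp U \<eta> F) n p = (\<Sum>k<N. fls_nth ((va \<eta> ^^ k) F) n p / fact k)"
proof (cases "F = 0")
  \<comment> \<open>The zero series satisfies every bound \<open>a\<close>, but its
    \<open>fls_subdegree\<close> is 0, so \<open>vexp_nth\<close> is used with a number of terms of
    its own.\<close>
  case True
  have "ee i 0 = 0" for i by (simp add: fls_eq_iff ee_nth euler_0)
  then have "va \<eta> 0 = 0" by (simp add: vact_def)
  then have z: "(va \<eta> ^^ k) 0 = 0" for k by (induction k) auto
  have "int (nat (n + 1)) > n - fls_subdegree (0 :: 'n fn fls)" by simp
  from vexp_nth[OF \<eta> this] show ?thesis by (simp add: True z fun_sum_apply)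
next
  case False
  then have "a \<le> fls_subdegree F" using assms(1) by (auto intro!: fls_subdegree_geI simp: ord_ge_def)
  then have "int N > n - fls_subdegree F" using assms(2) by simp
  from vexp_nth[OF \<eta> this] show ?thesis by (simp add: fun_sum_apply)
qed

lemma ord_ge_vexp: "ord_ge F a \<Longrightarrow> ord_ge (vexp U \<eta> F) a"
proof -
  assume v: "ord_ge F a"
  have "fls_nth (vexp U \<eta> F) n = 0" if "n < a" for n
    by (rule ext) (use vexp_nth_vb[OF v, of n 0] that in simp)
  then show ?thesis by (simp add: ord_ge_def)
qed

lemma FF_vexp: "F \<in> FF \<Longrightarrow> vexp U \<eta> F \<in> FF"
proof (rule FF_I)
  fix n assume F: "F \<in> FF"
  define N where "N = nat (n - fls_subdegree F + 1)"
  have N: "int N > n - fls_subdegree F" by (simp add: N_def)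
  have "fls_nth (vexp U \<eta> F) n = (\<Sum>k<N. (\<lambda>p. (1 / fact k) * fls_nth ((va \<eta> ^^ k) F) n p))"
    by (rule ext) (simp add: vexp_nth_vb[OF ord_ge_subdegree N] fun_sum_apply)
  also have "\<dots> \<in> OU" by (intro O_an_sum const_fun_mult_O FF_nth FF_pow F)
  finally show "fls_nth (vexp U \<eta> F) n \<in> OU" .
qed

lemma vexp_truncate:
  assumes F: "F \<in> FF" "ord_ge F a"
  shows "ord_ge (vexp U \<eta> F - (\<Sum>k<N. scal (1 / fact k) ((va \<eta> ^^ k) F))) (a + int N)"
  unfolding ord_ge_def
proof (intro allI impI)
  fix n assume "n < a + int N"
  then have N: "int N > n - a" by simp
  show "fls_nth (vexp U \<eta> F - (\<Sum>k<N. scal (1 / fact k) ((va \<eta> ^^ k) F))) n = 0"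
    by (rule ext) (simp add: vexp_nth_vb[OF F(2) N] fls_nth_sum fun_sum_apply scal_nth FF_pow F)
qed

text \<open>The product of \<Sum> P_i / i! with the exponential of \<eta> is regrouped by total
  degree k. P_i raises the order by i - 2 and the j-th power of \<eta> by j, so all terms with i + j
  \<ge> N lie beyond t^n; this accounts for the 2 in the bound on N.\<close>

lemma raising_vexp:
  assumes P: "raising P" and F: "F \<in> FF" "ord_ge F a" and N: "int N > n - a + 2"
  shows "(\<Sum>i<N. fls_nth (P i (vexp U \<eta> F)) n p / fact i) =
    (\<Sum>k<N. \<Sum>i\<le>k. fls_nth (P i ((va \<eta> ^^ (k - i)) F)) n p / (fact i * fact (k - i)))"
proof -
  have "fls_nth (P i (vexp U \<eta> F)) n p = (\<Sum>j<N. fls_nth (P i ((va \<eta> ^^ j) F)) n p / fact j)" for i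
  proof -
    define E where "E = (\<Sum>j<N. scal (1 / fact j) ((va \<eta> ^^ j) F))"
    have E: "E \<in> FF" unfolding E_def by (intro FF_sum FF_sc FF_pow F)
    have R: "vexp U \<eta> F - E \<in> FF" by (intro FF_diff FF_vexp E F)
    have "ord_ge (vexp U \<eta> F - E) (a + int N)" unfolding E_def by (rule vexp_truncate[OF F])
    from raisingD(4)[OF P R this, of i] N have "fls_nth (P i (vexp U \<eta> F - E)) n = 0"
      by (auto simp: ord_ge_def)
    moreover have "P i (E + (vexp U \<eta> F - E)) = P i E + P i (vexp U \<eta> F - E)"
      by (rule raisingD(2)[OF P E R])
    moreover have "P i E = (\<Sum>j<N. scal (1 / fact j) (P i ((va \<eta> ^^ j) F)))"
      unfolding E_def by (subst raising_sum[OF P]) (simp_all add: FF_sc FF_pow F raisingD(3)[OF P])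
    ultimately show ?thesis
      by (simp add: fls_nth_sum fun_sum_apply scal_nth raisingD(1)[OF P] FF_pow F)
  qed
  then have "(\<Sum>i<N. fls_nth (P i (vexp U \<eta> F)) n p / fact i) =
     (\<Sum>i<N. \<Sum>j<N. fls_nth (P i ((va \<eta> ^^ j) F)) n p / (fact i * fact j))"
    by (simp add: sum_divide_distrib field_simps)
  also have "\<dots> = (\<Sum>k<N. \<Sum>i\<le>k. fls_nth (P i ((va \<eta> ^^ (k - i)) F)) n p / (fact i * fact (k - i)))"
  proof (rule sum_square_triangle)
    fix i j assume "N \<le> i + j"
    then have "n < (a + int j) + int i - 2" using N by simp
    with raisingD(4)[OF P FF_pow[OF F(1)] ord_ge_pow[OF F(2)], of i j]
    have "fls_nth (P i ((va \<eta> ^^ j) F)) n = 0" by (auto simp: ord_ge_def)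
    then show "fls_nth (P i ((va \<eta> ^^ j) F)) n p / (fact i * fact j) = 0" by simp
  qed
  finally show ?thesis .
qed

lemma funpow_uminus: "F \<in> FF \<Longrightarrow> (va (- \<eta>) ^^ i) F = scal ((-1) ^ i) ((va \<eta> ^^ i) F)"
proof (induction i)
  case 0
  then show ?case by (simp add: scal_def unit_fun_cst[symmetric] unit_fun_times)
next
  case (Suc i)
  have "(va (- \<eta>) ^^ Suc i) F = va (- \<eta>) (scal ((-1) ^ i) ((va \<eta> ^^ i) F))"
    by (simp only: funpow.simps o_apply Suc.IH[OF Suc.prems])
  also have "\<dots> = - va \<eta> (scal ((-1) ^ i) ((va \<eta> ^^ i) F))"
    by (rule va_uminus_left)
  also have "\<dots> = - scal ((-1) ^ i) ((va \<eta> ^^ Suc i) F)"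
    by (simp add: va_sc FF_pow Suc.prems)
  also have "\<dots> = scal ((-1) ^ Suc i) ((va \<eta> ^^ Suc i) F)"
    by (intro fls_eqI ext) (simp add: scal_nth FF_va FF_pow Suc.prems Lie_HD[OF \<eta>] del: power_Suc, simp)
  finally show ?case .
qed

end

text \<open>With P_i the powers of -\<eta>, the terms of total degree k add up to (1 - 1)^k times
  the k-th power of \<eta> divided by k!.\<close>

lemma vexp_inverse:
  assumes \<eta>: "\<eta> \<in> Lie_H U" and F: "F \<in> FF"
  shows "vexp U (- \<eta>) (vexp U \<eta> F) = F"
proof (intro fls_eqI ext)
  fix n p
  note m = Lie_H_uminus[OF \<eta>]
  define a where "a = fls_subdegree F"
  have va: "ord_ge F a" unfolding a_def by (rule ord_ge_subdegree)
  define N where "N = nat (\<bar>n - a\<bar> + 3)"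
  have N: "int N > n - a + 2" "int N > n - a" "N > 0" by (auto simp: N_def)
  have P: "raising (\<lambda>i. va (- \<eta>) ^^ i)"
    unfolding raising_def
  proof (intro allI ballI conjI impI)
    fix i F assume F: "F \<in> FF"
    show "(va (- \<eta>) ^^ i) F \<in> FF" by (rule FF_pow[OF m F])
    show "(va (- \<eta>) ^^ i) (F + G) = (va (- \<eta>) ^^ i) F + (va (- \<eta>) ^^ i) G" if "G \<in> FF" for G
      using F that by (induction i) (simp_all add: va_add FF_pow[OF m])
    show "(va (- \<eta>) ^^ i) (scal c F) = scal c ((va (- \<eta>) ^^ i) F)" for c
      using F by (induction i) (simp_all add: va_sc FF_pow[OF m])
    show "ord_ge ((va (- \<eta>) ^^ i) F) (a + int i - 2)" if "ord_ge F a" for a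
      using ord_ge_mono[OF ord_ge_pow[OF m that, of i], of "a + int i - 2"] by simp
  qed
  have "fls_nth (vexp U (- \<eta>) (vexp U \<eta> F)) n p =
     (\<Sum>i<N. fls_nth ((va (- \<eta>) ^^ i) (vexp U \<eta> F)) n p / fact i)"
    by (rule vexp_nth_vb[OF m ord_ge_vexp[OF \<eta> va] N(2)])
  also have "\<dots> = (\<Sum>k<N. \<Sum>i\<le>k. fls_nth ((va (- \<eta>) ^^ i) ((va \<eta> ^^ (k - i)) F)) n p / (fact i * fact (k - i)))"
    by (rule raising_vexp[OF \<eta> P F va N(1)])
  also have "\<dots> = (\<Sum>k<N. if k = 0 then fls_nth F n p else 0)"
  proof (rule sum.cong[OF refl])
    fix k
    have "(\<Sum>i\<le>k. fls_nth ((va (- \<eta>) ^^ i) ((va \<eta> ^^ (k - i)) F)) n p / (fact i * fact (k - i))) =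
      (\<Sum>i\<le>k. (-1) ^ i * of_nat (k choose i) * (fls_nth ((va \<eta> ^^ k) F) n p / fact k))"
    proof (rule sum.cong[OF refl])
      fix i assume i: "i \<in> {..k}"
      then have "(va \<eta> ^^ i) ((va \<eta> ^^ (k - i)) F) = (va \<eta> ^^ k) F"
        by (simp flip: funpow_add comp_apply[of "va \<eta> ^^ i"])
      then have "fls_nth ((va (- \<eta>) ^^ i) ((va \<eta> ^^ (k - i)) F)) n p = (-1) ^ i * fls_nth ((va \<eta> ^^ k) F) n p"
        by (simp add: funpow_uminus[OF \<eta>] FF_pow[OF \<eta>] F scal_nth)
      then show "fls_nth ((va (- \<eta>) ^^ i) ((va \<eta> ^^ (k - i)) F)) n p / (fact i * fact (k - i)) =
         (-1) ^ i * of_nat (k choose i) * (fls_nth ((va \<eta> ^^ k) F) n p / fact k)"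
        using i by (simp add: binomial_fact field_simps)
    qed
    also have "\<dots> = (\<Sum>i\<le>k. (-1) ^ i * of_nat (k choose i)) * (fls_nth ((va \<eta> ^^ k) F) n p / fact k)"
      by (rule sum_distrib_right[symmetric])
    also have "\<dots> = (if k = 0 then fls_nth F n p else 0)"
      using choose_alternating_sum[of k, where 'a = complex] by simp
    finally show "(\<Sum>i\<le>k. fls_nth ((va (- \<eta>) ^^ i) ((va \<eta> ^^ (k - i)) F)) n p / (fact i * fact (k - i))) =
      (if k = 0 then fls_nth F n p else 0)" .
  qed
  also have "\<dots> = fls_nth F n p" using N(3) by simp
  finally show "fls_nth (vexp U (- \<eta>) (vexp U \<eta> F)) n p = fls_nth F n p" .
qed

text \<open>Vertical fields annihilate t and the functions of Z, so the exponential is linear over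
  both.\<close>

lemma vexp_base_mult:
  assumes \<eta>: "\<eta> \<in> Lie_H U" and c: "base_fun c" and F: "F \<in> FF"
  shows "vexp U \<eta> (tmon m c * F) = tmon m c * vexp U \<eta> F"
proof (intro fls_eqI ext)
  fix n p
  define a where "a = fls_subdegree F"
  have va: "ord_ge F a" unfolding a_def by (rule ord_ge_subdegree)
  define N where "N = nat (n - m - a + 1)"
  have N: "int N > n - (m + a)" "int N > n - m - a" by (auto simp: N_def)
  have p: "(va \<eta> ^^ k) (tmon m c * F) = tmon m c * (va \<eta> ^^ k) F" for k
    by (induction k) (simp_all add: va_base_mult[OF c] FF_pow[OF \<eta> F])
  show "fls_nth (vexp U \<eta> (tmon m c * F)) n p = fls_nth (tmon m c * vexp U \<eta> F) n p"
    by (simp add: vexp_nth_vb[OF \<eta> ord_ge_times[OF ord_ge_mon va] N(1)] tmon_times_nth vexp_nth_vb[OF \<eta> va N(2)] p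
        sum_distrib_left)
qed

text \<open>Each further factor \<eta> or \<eta>' raises the order by at least 1, so at order a + l
  only the linear term of the exponential sees a change of order l in the exponent.\<close>

lemma vexp_diff:
  assumes e: "\<eta> \<in> Lie_H U" "\<eta>' \<in> Lie_H U" and d: "\<And>i. ord_ge ((\<eta>' - \<eta>) $ i) l" and F: "F \<in> FF" "ord_ge F a"
    and l: "l \<ge> 1"
  shows "ord_ge (vexp U \<eta>' F - vexp U \<eta> F) (a + l)"
    "fls_nth (vexp U \<eta>' F - vexp U \<eta> F) (a + l) = fls_nth (va (\<eta>' - \<eta>) F) (a + l)"
proof -
  \<comment> \<open>With A and B the previous powers applied to F, the induction uses \<open>\<eta>'
    A - \<eta> B = \<eta>' (A - B) + (\<eta>' - \<eta>) B\<close>.\<close>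
  have pow: "ord_ge ((va \<eta>' ^^ Suc k) F - (va \<eta> ^^ Suc k) F) (a + l + int k)" for k
  proof (induction k)
    case 0
    have "va \<eta>' F - va \<eta> F = va (\<eta>' - \<eta>) F" by (simp add: va_diff_left)
    then show ?case using ord_ge_va[OF d F(2)] by (simp add: add.commute)
  next
    case (Suc k)
    let ?A = "(va \<eta>' ^^ Suc k) F" and ?B = "(va \<eta> ^^ Suc k) F"
    have FF: "?A \<in> FF" "?B \<in> FF" by (intro FF_pow e F)+
    have "va \<eta>' (?A - ?B + ?B) = va \<eta>' (?A - ?B) + va \<eta>' ?B"
      by (rule va_add[OF FF_diff[OF FF] FF(2)])
    then have "va \<eta>' ?A - va \<eta> ?B = va \<eta>' (?A - ?B) + va (\<eta>' - \<eta>) ?B"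
      by (simp add: va_diff_left del: funpow.simps)
    moreover have "ord_ge (va \<eta>' (?A - ?B)) (a + l + int (Suc k))"
      using ord_ge_va[OF Lie_HD(2)[OF e(2)] Suc] by (simp add: algebra_simps del: funpow.simps)
    moreover have "ord_ge (va (\<eta>' - \<eta>) ?B) (a + l + int (Suc k))"
      using ord_ge_va[OF d ord_ge_pow[OF e(1) F(2), of "Suc k"]] by (simp add: algebra_simps del: funpow.simps)
    ultimately show ?case using ord_ge_add by fastforce
  qed
  have eq: "fls_nth (vexp U \<eta>' F - vexp U \<eta> F) n p = fls_nth (va (\<eta>' - \<eta>) F) n p" if n: "n \<le> a + l" for n p
  proof -
    define N where "N = nat (l + 2)"
    have N: "int N > n - a" "N \<ge> 2" using n l by (auto simp: N_def)
    have "fls_nth (vexp U \<eta>' F - vexp U \<eta> F) n p =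
       (\<Sum>k<N. fls_nth ((va \<eta>' ^^ k) F - (va \<eta> ^^ k) F) n p / fact k)"
      by (simp add: vexp_nth_vb[OF e(1) F(2) N(1)] vexp_nth_vb[OF e(2) F(2) N(1)] sum_subtractf diff_divide_distrib)
    also have "\<dots> = (\<Sum>k<N. if k = 1 then fls_nth (va (\<eta>' - \<eta>) F) n p else 0)"
    proof (rule sum.cong[OF refl])
      fix k
      consider "k = 0" | "k = 1" | j where "k = Suc (Suc j)" by (metis One_nat_def not0_implies_Suc)
      then show "fls_nth ((va \<eta>' ^^ k) F - (va \<eta> ^^ k) F) n p / fact k =
         (if k = 1 then fls_nth (va (\<eta>' - \<eta>) F) n p else 0)"
      proof cases
        case 3
        then have "fls_nth ((va \<eta>' ^^ k) F - (va \<eta> ^^ k) F) n = 0"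
          using ord_ge_nth[OF pow[of "Suc j"], of n] n by simp
        then show ?thesis using 3 by (simp del: funpow.simps)
      qed (simp_all add: va_diff_left)
    qed
    also have "\<dots> = fls_nth (va (\<eta>' - \<eta>) F) n p" using N(2) by simp
    finally show ?thesis .
  qed
  show "fls_nth (vexp U \<eta>' F - vexp U \<eta> F) (a + l) = fls_nth (va (\<eta>' - \<eta>) F) (a + l)"
    by (rule ext, rule eq) simp
  have "ord_ge (va (\<eta>' - \<eta>) F) (a + l)" using ord_ge_va[OF d F(2)] by (simp add: add.commute)
  then have "fls_nth (vexp U \<eta>' F - vexp U \<eta> F) n = 0" if "n < a + l" for n
    by (intro ext) (use eq that in \<open>simp add: ord_ge_def\<close>)
  then show "ord_ge (vexp U \<eta>' F - vexp U \<eta> F) (a + l)" by (simp add: ord_ge_def)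
qed


section \<open>Commutators and conjugation of connections by exponentials\<close>

definition bracket :: "('n fn fls \<Rightarrow> 'n fn fls) \<Rightarrow> 'n vseries \<Rightarrow> 'n vseries \<Rightarrow> 'n vseries" where
  "bracket d \<eta> X = (\<chi> i. va \<eta> (X $ i) - d (\<eta> $ i) - va X (\<eta> $ i))"

lemma ee_sum_prod:
  assumes "X \<in> FV" "F \<in> FF"
  shows "ee k (va X F) = (\<Sum>i\<in>UNIV. X $ i * ee k (ee i F) + ee k (X $ i) * ee i F)"
proof -
  have "ee k (sum g A) = (\<Sum>i\<in>A. ee k (g i))" if "\<And>i. g i \<in> FF" for g :: "'n \<Rightarrow> 'n fn fls" and A
    using that
  proof (induction A rule: infinite_finite_induct)
    case (insert x A)
    have "ee k (g x + sum g A) = ee k (g x) + ee k (sum g A)"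
      by (rule ee_add) (intro FF_sum insert.prems)+
    then show ?case using insert by simp
  qed (simp_all add: fls_eq_iff ee_nth euler_0)
  note s = this
  show ?thesis
    unfolding vact_def by (subst s) (simp_all add: FF_mult FV_nth[OF assms(1)] FF_ee assms(2) ee_mult)
qed

text \<open>\<open>bracket\<close> collects the coefficients of the Lie bracket of \<eta> with the
  lift d + X. Terms with two Euler derivatives cancel because these commute; \<open>d\<close>
  commutes with them too, so the bracket is vertical.\<close>

lemma commutator:
  assumes d: "base_der d" and X: "X \<in> FV" and \<eta>: "\<eta> \<in> FV" and F: "F \<in> FF"
  shows "va \<eta> (conn d X F) = conn d X (va \<eta> F) + va (bracket d \<eta> X) F"
proof -
  have dsum: "d (va \<eta> F) = (\<Sum>i\<in>UNIV. \<eta> $ i * ee i (d F) + d (\<eta> $ i) * ee i F)"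
  proof -
    have d0: "d 0 = 0" using base_derD(2)[OF d FF_0 FF_0] by simp
    have "d (sum g A) = (\<Sum>i\<in>A. d (g i))" if "\<And>i. g i \<in> FF" for g :: "'n \<Rightarrow> 'n fn fls" and A
      using that
    proof (induction A rule: infinite_finite_induct)
      case (insert x A)
      have "d (g x + sum g A) = d (g x) + d (sum g A)"
        by (rule base_derD(2)[OF d]) (intro FF_sum insert.prems)+
      then show ?case using insert by simp
    qed (simp_all add: d0)
    note s = this
    show ?thesis
      unfolding vact_def
      by (subst s) (simp_all add: FF_mult FV_nth[OF \<eta>] FF_ee F base_derD(3,4)[OF d])
  qed
  have 1: "va \<eta> (va X F) = (\<Sum>k\<in>UNIV. \<Sum>i\<in>UNIV. \<eta> $ k * (X $ i * ee k (ee i F))) + (\<Sum>i\<in>UNIV. va \<eta> (X $ i) * ee i F)"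
    if "\<eta> \<in> FV" "X \<in> FV" for \<eta> X
  proof -
    have "va \<eta> (va X F) = (\<Sum>k\<in>UNIV. \<Sum>i\<in>UNIV. \<eta> $ k * (X $ i * ee k (ee i F)) + \<eta> $ k * (ee k (X $ i) * ee i F))"
      by (simp only: vact_def[of U \<eta>] ee_sum_prod[OF that(2) F] sum_distrib_left distrib_left)
    also have "\<dots> = (\<Sum>k\<in>UNIV. \<Sum>i\<in>UNIV. \<eta> $ k * (X $ i * ee k (ee i F))) + (\<Sum>k\<in>UNIV. \<Sum>i\<in>UNIV. \<eta> $ k * (ee k (X $ i) * ee i F))"
      by (simp only: sum.distrib)
    also have "(\<Sum>k\<in>UNIV. \<Sum>i\<in>UNIV. \<eta> $ k * (ee k (X $ i) * ee i F)) = (\<Sum>i\<in>UNIV. va \<eta> (X $ i) * ee i F)"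
      by (subst sum.swap) (simp only: vact_def[of U \<eta>] sum_distrib_right mult.assoc)
    finally show ?thesis .
  qed
  have 2: "(\<Sum>k\<in>UNIV. \<Sum>i\<in>UNIV. \<eta> $ k * (X $ i * ee k (ee i F))) = (\<Sum>k\<in>UNIV. \<Sum>i\<in>UNIV. X $ k * (\<eta> $ i * ee k (ee i F)))"
    by (subst sum.swap) (simp add: ee_ee[OF F, of _ _] mult.left_commute)
  have 3: "va (bracket d \<eta> X) F = (\<Sum>i\<in>UNIV. va \<eta> (X $ i) * ee i F) - (\<Sum>i\<in>UNIV. d (\<eta> $ i) * ee i F)
     - (\<Sum>i\<in>UNIV. va X (\<eta> $ i) * ee i F)"
    unfolding vact_def[of U "bracket d \<eta> X"] unfolding bracket_def by (simp add: left_diff_distrib sum_subtractf)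
  have 4: "va \<eta> (conn d X F) = va \<eta> (d F) + va \<eta> (va X F)"
    unfolding conn_def by (rule va_add[OF base_derD(1)[OF d F] FF_va[OF X F]])
  have 5: "d (va \<eta> F) = va \<eta> (d F) + (\<Sum>i\<in>UNIV. d (\<eta> $ i) * ee i F)"
    unfolding dsum sum.distrib by (simp only: vact_def)
  have ring: "a + (b + c) = a + e + (b + f) + (c - e - f)" for a b c e f :: "'n fn fls" by simp
  have 6: "conn d X (va \<eta> F) = d (va \<eta> F) + va X (va \<eta> F)"
    by (rule conn_def)
  let ?A = "va \<eta> (d F)" and ?B = "\<Sum>k\<in>UNIV. \<Sum>i\<in>UNIV. X $ k * (\<eta> $ i * ee k (ee i F))"
    and ?C = "\<Sum>i\<in>UNIV. va \<eta> (X $ i) * ee i F" and ?E = "\<Sum>i\<in>UNIV. d (\<eta> $ i) * ee i F"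
    and ?G = "\<Sum>i\<in>UNIV. va X (\<eta> $ i) * ee i F"
  have 7: "va \<eta> (conn d X F) = ?A + (?B + ?C)" by (simp only: 4 1[OF \<eta> X] 2)
  have 8: "conn d X (va \<eta> F) = ?A + ?E + (?B + ?G)" by (simp only: 6 5 1[OF X \<eta>])
  show ?thesis unfolding 7 8 3 by (rule ring)
qed

lemma FV_brk:
  assumes "base_der d" "X \<in> FV" "\<eta> \<in> FV"
  shows "bracket d \<eta> X \<in> FV"
proof -
  have "bracket d \<eta> X $ i \<in> FF" for i
    unfolding bracket_def vec_lambda_beta
    by (intro FF_diff FF_va FV_nth base_derD(1)[OF assms(1)] assms)
  then show ?thesis by (simp add: FV_def)
qed

text \<open>The Leibniz rule for moving n copies of \<eta> past an operator, with \<open>P k\<close>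
  as its k-fold commutator.\<close>

lemma funpow_commutators:
  assumes P: "\<And>k F. F \<in> FF \<Longrightarrow> va \<eta> (P k F) = P k (va \<eta> F) + P (Suc k) F"
    and PF: "\<And>k F. F \<in> FF \<Longrightarrow> P k F \<in> FF" and \<eta>: "\<eta> \<in> Lie_H U" and F: "F \<in> FF"
  shows "fls_nth ((va \<eta> ^^ n) (P 0 F)) m p =
    (\<Sum>k\<le>n. of_nat (n choose k) * fls_nth (P k ((va \<eta> ^^ (n - k)) F)) m p)"
proof -
  have "(va \<eta> ^^ n) (P 0 F) = (\<Sum>k\<le>n. scal (of_nat (n choose k)) (P k ((va \<eta> ^^ (n - k)) F)))"
  proof (induction n)
    case 0
    then show ?case by (simp add: scal_def unit_fun_cst[symmetric] unit_fun_times PF F)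
  next
    case (Suc n)
    define Q where "Q k = P k ((va \<eta> ^^ (Suc n - k)) F)" for k
    have QF: "Q k \<in> FF" for k unfolding Q_def by (intro PF FF_pow[OF \<eta>] F)
    have scal_add: "scal a G + scal b G = scal (a + b) G" if "G \<in> FF" for a b G
      by (intro fls_eqI ext) (simp add: scal_nth that algebra_simps)
    have scal_add': "scal a (G + H) = scal a G + scal a H" for a G H
      by (simp add: scal_def distrib_left)
    have va_sum: "va \<eta> (sum g A) = (\<Sum>i\<in>A. va \<eta> (g i))" if "\<And>i. g i \<in> FF" for g :: "nat \<Rightarrow> 'n fn fls" and A
      using that
    proof (induction A rule: infinite_finite_induct)
      case (insert x A)
      have "va \<eta> (g x + sum g A) = va \<eta> (g x) + va \<eta> (sum g A)"
        by (rule va_add) (intro FF_sum insert.prems)+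
      then show ?case using insert by simp
    qed (simp_all add: vact_def fls_eq_iff ee_nth euler_0 fls_nth_sum fls_times_nth)
    have sc0: "scal 0 G = 0" if "G \<in> FF" for G by (intro fls_eqI ext) (simp add: scal_nth that)
    have "(va \<eta> ^^ Suc n) (P 0 F) = (\<Sum>k\<le>n. va \<eta> (scal (of_nat (n choose k)) (P k ((va \<eta> ^^ (n - k)) F))))"
      by (simp only: funpow.simps o_apply Suc, rule va_sum) (intro FF_sc PF FF_pow[OF \<eta>] F)
    also have "\<dots> = (\<Sum>k\<le>n. scal (of_nat (n choose k)) (Q k) + scal (of_nat (n choose k)) (Q (Suc k)))"
    proof (rule sum.cong[OF refl])
      fix k assume k: "k \<in> {..n}"
      have "va \<eta> (P k ((va \<eta> ^^ (n - k)) F)) = Q k + Q (Suc k)"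
        using P[OF FF_pow[OF \<eta> F], of k "n - k"] k by (simp add: Q_def Suc_diff_le)
      then show "va \<eta> (scal (of_nat (n choose k)) (P k ((va \<eta> ^^ (n - k)) F))) =
         scal (of_nat (n choose k)) (Q k) + scal (of_nat (n choose k)) (Q (Suc k))"
        by (simp only: va_sc[OF PF[OF FF_pow[OF \<eta> F]]] scal_add')
    qed
    also have "\<dots> = (\<Sum>k\<le>n. scal (of_nat (n choose k)) (Q k)) + (\<Sum>k\<le>n. scal (of_nat (n choose k)) (Q (Suc k)))"
      by (rule sum.distrib)
    \<comment> \<open>A zero term with k = n + 1 is added so that the two sums can be combined by
      Pascal's rule.\<close>
    also have "(\<Sum>k\<le>n. scal (of_nat (n choose k)) (Q k)) = (\<Sum>k\<le>Suc n. scal (of_nat (n choose k)) (Q k))"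
      by (simp add: sc0 QF binomial_eq_0)
    also have "\<dots> = scal 1 (Q 0) + (\<Sum>k\<le>n. scal (of_nat (n choose Suc k)) (Q (Suc k)))"
      by (simp only: sum.atMost_Suc_shift binomial_n_0 of_nat_1)
    also have "scal 1 (Q 0) + (\<Sum>k\<le>n. scal (of_nat (n choose Suc k)) (Q (Suc k))) + (\<Sum>k\<le>n. scal (of_nat (n choose k)) (Q (Suc k)))
       = scal 1 (Q 0) + (\<Sum>k\<le>n. scal (of_nat (Suc n choose Suc k)) (Q (Suc k)))"
      by (simp add: sum.distrib[symmetric] scal_add QF add_ac)
    also have "\<dots> = (\<Sum>k\<le>Suc n. scal (of_nat (Suc n choose k)) (Q k))"
      by (simp only: sum.atMost_Suc_shift binomial_n_0 of_nat_1)
    finally show ?case unfolding Q_def .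
  qed
  then show ?thesis
    by (simp add: fls_nth_sum fun_sum_apply scal_nth PF FF_pow[OF \<eta>] F)
qed

text \<open>\<open>exp \<eta> \<circ> D = (\<Sum>k. ad \<eta>\<^sup>k D / k!) \<circ> exp \<eta>\<close>, where the commutators \<open>ad \<eta>\<^sup>k D\<close> for \<open>k \<ge> 1\<close> are vertical.\<close>

lemma vexp_conn:
  assumes \<eta>: "\<eta> \<in> Lie_H U" and d: "base_der d" and dc: "\<And>c. d (tmon 0 (const_fun c)) = 0"
    and X: "X \<in> FV" "\<And>i. ord_ge (X $ i) (-2)"
  obtains X' where "X' \<in> FV" "\<And>i. ord_ge (X' $ i) (-2)"
    "\<And>F. F \<in> FF \<Longrightarrow> vexp U \<eta> (conn d X F) = conn d X' (vexp U \<eta> F)"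
proof -
  \<comment> \<open>The base part occurs only in the connection itself; all its commutators with
    \<eta> are vertical, hence lifts with base part 0.\<close>
  define dd where "dd k = (if k = 0 then d else (\<lambda>_. 0))" for k :: nat
  have dd: "base_der (dd k)" for k using d base_der_0 by (simp add: dd_def)
  have ddc: "dd k (tmon 0 (const_fun c)) = 0" for k c using dc by (simp add: dd_def)
  define xi where "xi = rec_nat X (\<lambda>k. bracket (dd k) \<eta>)"
  have xi: "xi 0 = X" "xi (Suc k) = bracket (dd k) \<eta> (xi k)" for k by (simp_all add: xi_def)
  note e = Lie_HD[OF \<eta>]
  have xiF: "xi k \<in> FV" for k by (induction k) (simp_all add: xi X FV_brk dd e)
  have xiv: "ord_ge (xi k $ i) (int k - 2)" for k i
  proof (induction k arbitrary: i)
    case (Suc k)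
    have "ord_ge (va \<eta> (xi k $ i)) (int (Suc k) - 2)" using ord_ge_va[OF e(2) Suc] by (simp add: algebra_simps)
    moreover have "ord_ge (va (xi k) (\<eta> $ i)) (int (Suc k) - 2)" using ord_ge_va[OF Suc e(2)] by (simp add: algebra_simps)
    moreover have "ord_ge (dd k (\<eta> $ i)) (int (Suc k) - 2)"
      using ord_ge_mono[OF base_derD(5)[OF dd[of 0] FV_nth[OF e(1)] e(2)], of "-1"] by (auto simp: dd_def)
    ultimately show ?case by (simp add: xi bracket_def ord_ge_diff)
  qed (simp add: xi X)
  define P where "P k = conn (dd k) (xi k)" for k
  have PS: "P (Suc k) = va (xi (Suc k))" for k by (auto simp: P_def conn_def dd_def)
  have PF: "P k F \<in> FF" if "F \<in> FF" for k F unfolding P_def by (rule FF_conn[OF dd xiF that])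
  have Pc: "va \<eta> (P k F) = P k (va \<eta> F) + P (Suc k) F" if "F \<in> FF" for k F
    unfolding PS unfolding P_def xi(2) by (rule commutator[OF dd xiF e(1) that])
  have P: "raising P"
    unfolding raising_def
  proof (intro allI ballI conjI impI)
    fix k F assume F: "F \<in> FF"
    show "P k F \<in> FF" by (rule PF[OF F])
    show "P k (F + G) = P k F + P k G" if "G \<in> FF" for G
      unfolding P_def by (rule conn_add[OF dd xiF F that])
    show "P k (scal c F) = scal c (P k F)" for c
    proof -
      have "conn (dd k) (xi k) (tmon 0 (const_fun c)) = 0" by (simp add: conn_def ddc va_base[OF base_fun_cst])
      then show ?thesis unfolding P_def scal_def
        by (simp add: conn_mult[OF dd xiF FF_mon[OF const_fun_props(1)] F])
    qed
    show "ord_ge (P k F) (a + int k - 2)" if "ord_ge F a" for a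
    proof -
      have "ord_ge (va (xi k) F) (a + int k - 2)" using ord_ge_va[OF xiv that] by (simp add: algebra_simps)
      moreover have "ord_ge (dd k F) (a + int k - 2)"
        using ord_ge_mono[OF base_derD(5)[OF dd[of 0] F that], of "a - 2"] by (auto simp: dd_def)
      ultimately show ?thesis unfolding P_def conn_def by (intro ord_ge_add)
    qed
  qed
  \<comment> \<open>This is the sum of \<open>xi k\<close> / k!. As \<open>xi k\<close> has order at
    least k - 2, the coefficient of t^n only receives terms with k < n + 3.\<close>
  define X' where "X' = (\<chi> i. Abs_fls (\<lambda>n. (\<lambda>p. \<Sum>k<nat (n + 3). fls_nth (xi k $ i) n p / fact k)))"
  have X'_nth0: "fls_nth (X' $ i) n = (\<lambda>p. \<Sum>k<nat (n + 3). fls_nth (xi k $ i) n p / fact k)" for i n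
    unfolding X'_def by (simp, rule nth_Abs_fls_lower_bound[of "-2"]) (use xiv[of 0] in \<open>auto simp: ord_ge_def zero_fun_def intro!: sum.neutral\<close>)
  have X'_nth: "fls_nth (X' $ i) n p = (\<Sum>k<N. fls_nth (xi k $ i) n p / fact k)" if "int N > n + 2" for i n p N
  proof -
    have "fls_nth (xi k $ i) n = 0" if "k \<ge> nat (n + 3)" for k
      using ord_ge_nth[OF xiv[of k i], of n] that by linarith
    then show ?thesis
      unfolding X'_nth0 using that by (intro sum.mono_neutral_left) auto
  qed
  have X'F: "X' \<in> FV"
    unfolding FV_def
  proof (intro CollectI allI FF_I)
    fix i n
    have "fls_nth (X' $ i) n = (\<Sum>k<nat (n + 3). (\<lambda>p. (1 / fact k) * fls_nth (xi k $ i) n p))"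
      by (rule ext) (simp add: X'_nth0 fun_sum_apply)
    also have "\<dots> \<in> OU" by (intro O_an_sum const_fun_mult_O FF_nth FV_nth xiF)
    finally show "fls_nth (X' $ i) n \<in> OU" .
  qed
  have X'v: "ord_ge (X' $ i) (-2)" for i
    unfolding ord_ge_def by (auto intro!: ext simp: X'_nth[where N = 0])
  have main: "fls_nth (conn d X' G) n p = (\<Sum>i<N. fls_nth (P i G) n p / fact i)"
    if G: "G \<in> FF" "ord_ge G a" and N: "int N > n - a + 2" "N > 0" for G a n p N
  proof -
    \<comment> \<open>The part of \<open>X'\<close> lost by stopping at N terms; its order is at
      least N - 2, so its action on G does not reach the coefficient of t^n.\<close>
    define R where "R i = X' $ i - (\<Sum>k<N. scal (1 / fact k) (xi k $ i))" for i
    have "ord_ge (R i) (int N - 2)" for i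
      unfolding ord_ge_def R_def
    proof (intro allI impI ext)
      fix m p assume m: "m < int N - 2"
      then show "fls_nth (X' $ i - (\<Sum>k<N. scal (1 / fact k) (xi k $ i))) m p = 0 p"
        by (simp add: X'_nth[of m N] fls_nth_sum fun_sum_apply scal_nth FV_nth[OF xiF])
    qed
    then have "ord_ge (\<Sum>i\<in>UNIV. R i * ee i G) (int N - 2 + a)"
      by (intro ord_ge_sum ord_ge_times ord_ge_ee G)
    then have R0: "fls_nth (\<Sum>i\<in>UNIV. R i * ee i G) n = 0" using N by (simp add: ord_ge_def)
    have "va X' G = (\<Sum>i\<in>UNIV. (\<Sum>k<N. scal (1 / fact k) (xi k $ i)) * ee i G) + (\<Sum>i\<in>UNIV. R i * ee i G)"
      by (simp add: vact_def R_def left_diff_distrib sum_subtractf)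
    also have "(\<Sum>i\<in>UNIV. (\<Sum>k<N. scal (1 / fact k) (xi k $ i)) * ee i G) = (\<Sum>k<N. scal (1 / fact k) (va (xi k) G))"
      unfolding vact_def sum_distrib_right by (subst sum.swap) (simp add: scal_def sum_distrib_left mult.assoc)
    finally have "fls_nth (va X' G) n p = (\<Sum>k<N. fls_nth (va (xi k) G) n p / fact k)"
      using R0 by (simp add: fls_nth_sum fun_sum_apply scal_nth FF_va xiF G)
    moreover have "(\<Sum>k<N. fls_nth (P k G) n p / fact k) = (\<Sum>k<N. (if k = 0 then fls_nth (d G) n p else 0) + fls_nth (va (xi k) G) n p / fact k)"
      by (intro sum.cong refl) (simp add: P_def conn_def dd_def)
    ultimately show ?thesis using N(2) by (simp add: sum.distrib conn_def)
  qed
  show ?thesis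
  proof (rule that[OF X'F X'v])
    fix F assume F: "F \<in> FF"
    show "vexp U \<eta> (conn d X F) = conn d X' (vexp U \<eta> F)"
    proof (intro fls_eqI ext)
      fix n p
      define a where "a = fls_subdegree F"
      have va: "ord_ge F a" unfolding a_def by (rule ord_ge_subdegree)
      define N where "N = nat (\<bar>n - a\<bar> + 3)"
      have N: "int N > n - a + 2" "N > 0" by (auto simp: N_def)
      have "conn d X F = P 0 F" by (simp add: P_def dd_def xi)
      moreover have "ord_ge (P 0 F) (a - 2)" using raisingD(4)[OF P F va, of 0] by simp
      ultimately have "fls_nth (vexp U \<eta> (conn d X F)) n p = (\<Sum>k<N. fls_nth ((va \<eta> ^^ k) (P 0 F)) n p / fact k)"
        using vexp_nth_vb[OF \<eta>, of "P 0 F" "a - 2" n N p] N by simp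
      also have "\<dots> = (\<Sum>k<N. \<Sum>i\<le>k. fls_nth (P i ((va \<eta> ^^ (k - i)) F)) n p / (fact i * fact (k - i)))"
      proof (rule sum.cong[OF refl])
        fix k
        have "fls_nth ((va \<eta> ^^ k) (P 0 F)) n p / fact k =
           (\<Sum>i\<le>k. of_nat (k choose i) * fls_nth (P i ((va \<eta> ^^ (k - i)) F)) n p / fact k)"
          by (subst funpow_commutators[where P = P and \<eta> = \<eta>, OF Pc PF \<eta> F]) (simp_all add: sum_divide_distrib)
        also have "\<dots> = (\<Sum>i\<le>k. fls_nth (P i ((va \<eta> ^^ (k - i)) F)) n p / (fact i * fact (k - i)))"
          by (intro sum.cong refl) (simp add: binomial_fact field_simps)
        finally show "fls_nth ((va \<eta> ^^ k) (P 0 F)) n p / fact k =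
           (\<Sum>i\<le>k. fls_nth (P i ((va \<eta> ^^ (k - i)) F)) n p / (fact i * fact (k - i)))" .
      qed
      also have "\<dots> = (\<Sum>i<N. fls_nth (P i (vexp U \<eta> F)) n p / fact i)"
        by (rule raising_vexp[OF \<eta> P F va N(1), symmetric])
      also have "\<dots> = fls_nth (conn d X' (vexp U \<eta> F)) n p"
        by (rule main[OF FF_vexp[OF \<eta> F] ord_ge_vexp[OF \<eta> va] N, symmetric])
      finally show "fls_nth (vexp U \<eta> (conn d X F)) n p = fls_nth (conn d X' (vexp U \<eta> F)) n p" .
    qed
  qed
qed

section \<open>Determination by the action on the fibre coordinates\<close>

lemma ee_lead_zc:
  assumes "G \<in> FF" "ord_ge G 0" "fls_nth G 0 = z_coord i"
    and W: "W \<in> FV" "\<And>k. ord_ge (W $ k) a"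
  shows "fls_nth (va W G) a = fls_nth (W $ i) a * z_coord i"
proof -
  have "fls_nth (va W G) a = (\<Sum>k\<in>UNIV. fls_nth (W $ k) a * eu k (z_coord i))"
    by (subst va_nth_lead[OF W(2) assms(2), of a]) (simp, simp only: assms(3))
  also have "\<dots> = (\<Sum>k\<in>UNIV. if k = i then fls_nth (W $ k) a * z_coord i else 0)"
    by (intro sum.cong refl) (simp add: z_coord_props)
  finally show ?thesis by simp
qed

lemma mult_zc_eq_0:
  assumes "f \<in> OU" "f * z_coord i = 0"
  shows "f = 0"
proof -
  have "f = f * z_coord i * z_inv i" by (simp only: mult.assoc z_inv_zc unit_fun_mult(2)[OF assms(1)])
  then show ?thesis by (simp only: assms(2) mult_zero_left)
qed

text \<open>The difference W of the vertical parts annihilates every \<open>G i\<close>. Since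
  \<open>G i\<close> begins with z_i, the leading coefficient of W applied to it is that of
  \<open>W $ i\<close> times the invertible function z_i; so the coefficients of W vanish one after
  the other.\<close>

lemma conn_determined:
  assumes G: "\<And>i. G i \<in> FF" "\<And>i. ord_ge (G i) 0" "\<And>i. fls_nth (G i) 0 = z_coord i"
    and X: "X \<in> FV" "X' \<in> FV" and eq: "\<And>i. conn d X (G i) = conn d X' (G i)"
    and v: "\<And>i. ord_ge (X $ i) b" "\<And>i. ord_ge (X' $ i) b"
  shows "X = X'"
proof -
  define W where "W = X - X'"
  have W: "W \<in> FV" using X by (simp add: W_def FV_def FF_diff)
  have "va W (G i) = 0" for i using eq[of i] by (simp add: W_def va_diff_left conn_def)
  note z = this
  have "\<forall>i. ord_ge (W $ i) (b + int k)" for k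
  proof (induction k)
    case 0
    then show ?case using v by (simp add: W_def ord_ge_diff)
  next
    case (Suc k)
    have "fls_nth (W $ i) (b + int k) = 0" for i
    proof (rule mult_zc_eq_0[of _ i])
      show "fls_nth (W $ i) (b + int k) * z_coord i = 0"
        using ee_lead_zc[OF G(1,2,3) W, of "b + int k" i] Suc z[of i] by simp
    qed (intro FF_nth FV_nth W)
    then show ?case using ord_ge_Suc[of "W $ _" "b + int k"] Suc by (simp add: algebra_simps)
  qed
  note v' = this
  have "fls_nth (W $ i) n = 0" for i n
    by (rule ord_ge_nth[OF v'[of "nat (n - b + 1)", rule_format]]) simp
  then have "W = 0" by (simp add: vec_eq_iff fls_eq_iff)
  then show ?thesis by (simp add: W_def)
qed

lemma va_mon_zc: "fls_nth (va (\<chi> k. tmon l (\<kappa> k)) (tmon 0 (z_coord i))) n = (if n = l then \<kappa> i * z_coord i else 0)"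
  by (simp add: va_zc tmon_mult_mon tmon_nth)

lemma z_coord_FF: "tmon 0 (z_coord i) \<in> FF" by (intro FF_mon z_coord_props)

text \<open>Successive approximation: if the image of z_i differs from \<open>G i\<close> by r_i t^l
  to leading order, then adding -(r_i / z_i) t^l to the i-th component of \<eta> cancels this error,
  by the linearization in \<open>vexp_diff\<close>.\<close>

lemma vexp_surj:
  assumes G: "\<And>i. G i \<in> FF" "\<And>i. ord_ge (G i - tmon 0 (z_coord i)) 1"
  obtains \<eta> where "\<eta> \<in> Lie_H U" "\<And>i. vexp U \<eta> (tmon 0 (z_coord i)) = G i"
proof -
  let ?z = "\<lambda>i. tmon 0 (z_coord i)"
  \<comment> \<open>Agreement modulo t^(m+1); for m = 0 it is achieved by \<eta> = 0 because of the
    assumption on G.\<close>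
  define P where "P m \<eta> \<longleftrightarrow> \<eta> \<in> Lie_H U \<and> (\<forall>i. ord_ge (vexp U \<eta> (?z i) - G i) (int m + 1))" for m \<eta>
  have "\<exists>h. \<forall>m. P m (h m) \<and> (\<forall>i. ord_ge ((h (Suc m) - h m) $ i) (int m))"
  proof (rule dependent_nat_choice)
    have 0: "0 \<in> Lie_H U" by (simp add: Lie_H_iff FV_def FF_0)
    have "vexp U 0 (?z i) = ?z i" for i
    proof -
      have z: "(va 0 ^^ k) (?z i) = (if k = 0 then ?z i else 0)" for k
      proof (cases k)
        case (Suc j)
        have "va 0 F = 0" for F by (simp add: vact_def)
        then show ?thesis using Suc by simp
      qed simp
      have "fls_nth (vexp U 0 (?z i)) n p = fls_nth (?z i) n p" for n p
      proof -
        have "fls_nth (vexp U 0 (?z i)) n p = (\<Sum>k<Suc (nat n). fls_nth ((va 0 ^^ k) (?z i)) n p / fact k)"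
          by (rule vexp_nth_vb[OF 0 ord_ge_mon]) simp
        also have "\<dots> = (\<Sum>k<Suc (nat n). if k = 0 then fls_nth (?z i) n p else 0)"
          by (intro sum.cong refl) (simp add: z)
        finally show ?thesis by (simp del: sum.lessThan_Suc)
      qed
      then show ?thesis by (intro fls_eqI ext)
    qed
    moreover have "ord_ge (?z i - G i) 1" for i using ord_ge_uminus[OF G(2)[of i]] by simp
    ultimately show "\<exists>\<eta>. P 0 \<eta>" using 0 unfolding P_def by auto
  next
    fix \<eta> m assume P: "P m \<eta>"
    define l where "l = int m + 1"
    have e: "\<eta> \<in> Lie_H U" and v: "\<And>i. ord_ge (vexp U \<eta> (?z i) - G i) l" using P by (auto simp: P_def l_def)
    define r where "r i = fls_nth (vexp U \<eta> (?z i) - G i) l" for i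
    have rO: "r i \<in> OU" for i unfolding r_def by (intro FF_nth FF_diff FF_vexp[OF e] z_coord_FF G)
    define \<kappa> where "\<kappa> i = - (r i * z_inv i)" for i
    have \<kappa>O: "\<kappa> i \<in> OU" for i unfolding \<kappa>_def by (intro O_an_uminus O_an_mult rO z_inv_O)
    have kz: "\<kappa> i * z_coord i = - r i" for i
      by (simp only: \<kappa>_def minus_mult_left[symmetric] mult.assoc z_inv_zc unit_fun_mult(2)[OF rO])
    define K where "K = (\<chi> k. tmon l (\<kappa> k))"
    have Kv: "ord_ge (K $ k) l" for k by (simp add: K_def ord_ge_mon)
    have e': "\<eta> + K \<in> Lie_H U"
      using e \<kappa>O ord_ge_mono[OF Kv, of 1] unfolding Lie_H_iff FV_def
      by (auto simp: K_def l_def intro!: FF_add FF_mon ord_ge_add)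
    have D: "ord_ge ((\<eta> + K - \<eta>) $ i) l" for i using Kv by simp
    have l1: "l \<ge> 1" by (simp add: l_def)
    have "ord_ge (vexp U (\<eta> + K) (?z i) - G i) (l + 1)" for i
    proof (rule ord_ge_Suc)
      have *: "ord_ge (vexp U (\<eta> + K) (?z i) - vexp U \<eta> (?z i)) l"
        "fls_nth (vexp U (\<eta> + K) (?z i) - vexp U \<eta> (?z i)) l = - r i"
        using vexp_diff[OF e e' D z_coord_FF ord_ge_mon l1, of i] va_mon_zc[of l \<kappa> i l] kz[of i]
        by (simp_all add: K_def)
      from ord_ge_add[OF *(1) v[of i]] show "ord_ge (vexp U (\<eta> + K) (?z i) - G i) l" by simp
      have "fls_nth (vexp U (\<eta> + K) (?z i) - G i) l =
         fls_nth (vexp U (\<eta> + K) (?z i) - vexp U \<eta> (?z i)) l + r i" by (simp add: r_def)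
      then show "fls_nth (vexp U (\<eta> + K) (?z i) - G i) l = 0" unfolding * by simp
    qed
    then have "P (Suc m) (\<eta> + K)" using e' by (simp add: P_def l_def add.commute)
    moreover have "ord_ge ((\<eta> + K - \<eta>) $ i) (int m)" for i by (rule ord_ge_mono[OF D]) (simp add: l_def)
    ultimately show "\<exists>\<eta>'. P (Suc m) \<eta>' \<and> (\<forall>i. ord_ge ((\<eta>' - \<eta>) $ i) (int m))" by blast
  qed
  then obtain h where h: "\<And>m. h m \<in> Lie_H U" "\<And>m i. ord_ge (vexp U (h m) (?z i) - G i) (int m + 1)"
    "\<And>m i. ord_ge ((h (Suc m) - h m) $ i) (int m)" unfolding P_def by blast
  have "\<exists>F. F \<in> FF \<and> (\<forall>m. ord_ge (F - h m $ i) (int m)) \<and> ord_ge F 1" for i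
  proof -
    have "h m $ i \<in> FF" "ord_ge (h (Suc m) $ i - h m $ i) (int m)" "ord_ge (h m $ i) 1" for m
      using h(1)[of m] h(3)[of m i] by (simp_all add: Lie_H_iff FV_def)
    from FF_limit[of "\<lambda>m. h m $ i", OF this] show ?thesis by blast
  qed
  then obtain f where f: "\<And>i. f i \<in> FF" "\<And>i m. ord_ge (f i - h m $ i) (int m)" "\<And>i. ord_ge (f i) 1" by metis
  define \<eta> where "\<eta> = (\<chi> i. f i)"
  have e: "\<eta> \<in> Lie_H U" using f by (simp add: Lie_H_iff FV_def \<eta>_def)
  have "vexp U \<eta> (?z i) = G i" for i
  proof -
    have v: "ord_ge (vexp U \<eta> (?z i) - G i) (int m + 1)" for m
    proof -
      have "ord_ge ((\<eta> - h (Suc m)) $ i) (int m + 1)" for i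
        using f(2)[of i "Suc m"] by (simp add: \<eta>_def add.commute)
      from vexp_diff(1)[OF h(1) e this z_coord_FF ord_ge_mon, of i]
      have "ord_ge (vexp U \<eta> (?z i) - vexp U (h (Suc m)) (?z i)) (int m + 1)" by simp
      from ord_ge_add[OF this ord_ge_mono[OF h(2)[of "Suc m" i], of "int m + 1"]] show ?thesis by simp
    qed
    have "fls_nth (vexp U \<eta> (?z i) - G i) n = 0" for n
      using ord_ge_nth[OF v[of "nat n"], of n] by simp
    then have "vexp U \<eta> (?z i) - G i = 0" by (simp add: fls_eq_iff)
    then show ?thesis by simp
  qed
  with e show ?thesis by (rule that)
qed

text \<open>The leading coefficient of \<eta>' - \<eta> would show up, multiplied by z_i, in the
  images of the coordinates.\<close>

lemma vexp_inj:
  assumes e: "\<eta> \<in> Lie_H U" "\<eta>' \<in> Lie_H U"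
    and eq: "\<And>i. vexp U \<eta> (tmon 0 (z_coord i)) = vexp U \<eta>' (tmon 0 (z_coord i))"
  shows "\<eta> = \<eta>'"
proof -
  define W where "W = \<eta>' - \<eta>"
  have W: "W \<in> FV" using e by (simp add: W_def FV_def Lie_H_iff FF_diff)
  have "\<forall>i. ord_ge (W $ i) (1 + int k)" for k
  proof (induction k)
    case 0
    then show ?case using e by (simp add: W_def ord_ge_diff Lie_H_iff)
  next
    case (Suc k)
    then have v: "ord_ge ((\<eta>' - \<eta>) $ i) (1 + int k)" for i by (simp add: W_def)
    have "fls_nth (W $ i) (1 + int k) = 0" for i
    proof (rule mult_zc_eq_0[of _ i])
      have "fls_nth (va W (tmon 0 (z_coord i))) (1 + int k) = 0"
        using vexp_diff(2)[OF e v z_coord_FF ord_ge_mon, of i] eq[of i] by (simp add: W_def)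
      moreover have "fls_nth (va W (tmon 0 (z_coord i))) (1 + int k) = fls_nth (W $ i) (1 + int k) * z_coord i"
        by (rule ee_lead_zc[OF z_coord_FF ord_ge_mon _ W]) (use Suc in \<open>auto simp: tmon_nth\<close>)
      ultimately show "fls_nth (W $ i) (1 + int k) * z_coord i = 0" by simp
    qed (intro FF_nth FV_nth W)
    then show ?case using ord_ge_Suc[of "W $ _" "1 + int k"] Suc by (simp add: algebra_simps)
  qed
  note v' = this
  have "fls_nth (W $ i) n = 0" for i n
    by (rule ord_ge_nth[OF v'[of "nat n", rule_format]]) simp
  then have "W = 0" by (simp add: vec_eq_iff fls_eq_iff)
  then show ?thesis by (simp add: W_def)
qed

end

section \<open>The gauge equivalence\<close>

context flat_data begin

lemma flat_coordinate:
  assumes "u \<in> FF" "T i u = 0" "\<And>j. S i j u = 0"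
  shows "nt (tmon 0 (z_coord i) * u) = Lc i * (tmon 0 (z_coord i) * u)"
    "nz j (tmon 0 (z_coord i) * u) = Mc i j * (tmon 0 (z_coord i) * u)"
  by (simp_all add: nt_zc nz_zc assms mult.left_commute)

text \<open>The quotient of G by z_i solves the same linear system as u and also begins with 1, so
  the difference is O(t) and \<open>flat_solution_zero\<close> applies.\<close>

lemma flat_coordinate_unique:
  assumes G: "G \<in> FF" "ord_ge G 0" "fls_nth G 0 = z_coord i"
    and nt: "nt G = Lc i * G" and nz: "\<And>j. nz j G = Mc i j * G"
    and u: "u \<in> FF" "ord_ge (u - tmon 0 unit_fun) 1" "T i u = 0" "\<And>j. S i j u = 0"
  shows "G = tmon 0 (z_coord i) * u"
proof -
  let ?z = "tmon 0 (z_coord i)"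
  define v where "v = tmon 0 (z_inv i) * G"
  have v: "v \<in> FF" unfolding v_def by (intro FF_mult FF_mon z_inv_O G)
  have zv: "?z * v = G"
    using unit_fun_times[OF G(1)] by (simp add: v_def mult.assoc[symmetric] tmon_mult_mon z_inv_zc)
  have "?z * T i v = ?z * 0"
    using nt_zc[OF v, of i] nt by (simp add: zv distrib_left mult.left_commute[of _ "Lc i"])
  then have Tv: "T i v = 0" by (rule z_coord_cancel[OF FF_T[OF v] FF_0])
  have "?z * S i j v = ?z * 0" for j
    using nz_zc[OF v, of j i] nz by (simp add: zv distrib_left mult.left_commute[of _ "Mc i j"])
  then have Sv: "S i j v = 0" for j by (rule z_coord_cancel[OF FF_S[OF v] FF_0])
  define w where "w = v - u"
  have w: "w \<in> FF" unfolding w_def by (intro FF_diff v u)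
  have "T i (w + u) = T i w + T i u" "\<And>j. S i j (w + u) = S i j w + S i j u"
    by (rule T_add S_add; intro w u)+
  then have Tw: "T i w = 0" and Sw: "\<And>j. S i j w = 0" by (simp_all add: w_def Tv Sv u)
  have v0: "ord_ge v 0" using ord_ge_times[OF ord_ge_mon G(2), of 0 "z_inv i"] by (simp add: v_def)
  have "fls_nth v 0 = unit_fun" by (simp add: v_def tmon_times_nth G(3) z_inv_zc)
  then have v1: "ord_ge (v - tmon 0 unit_fun) (0 + 1)"
    using ord_ge_diff[OF v0 ord_ge_mon, of unit_fun] by (intro ord_ge_Suc) (simp_all add: tmon_nth)
  have "ord_ge ((v - tmon 0 unit_fun) - (u - tmon 0 unit_fun)) 1"
    by (rule ord_ge_diff[OF _ u(2)]) (use v1 in simp)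
  then have "ord_ge w 1" by (simp add: w_def)
  then have "w = 0" by (rule flat_solution_zero[OF w _ Tw Sw])
  then show ?thesis using zv by (simp add: w_def)
qed

end

context open_base begin

lemma vexp_lead:
  assumes "\<eta> \<in> Lie_H U" "ord_ge F a"
  shows "fls_nth (vexp U \<eta> F) a = fls_nth F a"
  by (rule ext) (use vexp_nth_vb[OF assms, where n = a and N = 1] in simp)

text \<open>The components of the standard connection do not vanish outside the total space and
  therefore do not lie in \<open>FF\<close>.\<close>

definition clip :: "'n vseries \<Rightarrow> 'n vseries" where
  "clip X = (\<chi> i. tmon 0 unit_fun * X $ i)"

lemma va_clip: "va (clip X) F = va X F"
proof -
  have "tmon 0 unit_fun * ee i F = ee i F" for i
    by (rule fls_eqI, rule fn_eqI) (simp_all add: tmon_times_nth ee_nth unit_fun_def eu_zero)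
  then show ?thesis
    unfolding vact_def clip_def by (simp add: mult.assoc mult.left_commute[of "tmon 0 unit_fun"])
qed

lemma nabla_conn:
  "nabla_t U C F = conn fls_deriv (clip (vert_t C)) F"
  "nabla_Z U C j F = conn (fls_map (pz j)) (clip (vert_Z C j)) F"
  by (simp_all add: nabla_t_def nabla_Z_def conn_def va_clip)

lemma clip_standard:
  "clip (vert_t standard_connection) $ i = tmon (-2) (Z_coord i)"
  "clip (vert_Z standard_connection j) $ i = tmon (-1) (if i = j then - unit_fun else 0)"
proof -
  have "unit_fun * (\<lambda>(Z, z). Z $ i) = Z_coord i"
    by (auto simp: fun_eq_iff unit_fun_def Z_coord_def)
  then show "clip (vert_t standard_connection) $ i = tmon (-2) (Z_coord i)"
    by (simp only: clip_def standard_connection_def connection.select_convs vec_lambda_beta tmon_def[symmetric]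
        tmon_mult_mon add_0_left)
  have "- fls_X_intpow (-1) = tmon (-1) (-1 :: 'n fn)" "0 = tmon (-1) (0 :: 'n fn)"
    by (simp_all add: tmon_def)
  then show "clip (vert_Z standard_connection j) $ i = tmon (-1) (if i = j then - unit_fun else 0)"
    by (auto simp: clip_def standard_connection_def tmon_mult_mon)
qed

lemma FV_standard: "clip (vert_t standard_connection) \<in> FV" "clip (vert_Z standard_connection j) \<in> FV"
  by (auto simp: FV_def clip_standard tmon_0 intro!: FF_mon FF_0 Z_coord_props O_an_uminus unit_fun_props)

lemma ord_ge_standard: "ord_ge (clip (vert_t standard_connection) $ i) (-2)" "ord_ge (clip (vert_Z standard_connection j) $ i) (-2)"
  unfolding clip_standard by (rule ord_ge_mon, rule ord_ge_mono[OF ord_ge_mon]) simp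

lemma nabla_standard_zc:
  "nabla_t U standard_connection (tmon 0 (z_coord i)) = tmon (-2) (Z_coord i) * tmon 0 (z_coord i)"
  "nabla_Z U standard_connection j (tmon 0 (z_coord i)) = tmon (-1) (if i = j then - unit_fun else 0) * tmon 0 (z_coord i)"
  by (simp_all only: nabla_conn conn_def va_zc clip_standard deriv_mon pz_mon z_coord_props tmon_0 add_0_left of_int_0 mult_zero_left)

end

text \<open>The invariants are Laurent coefficients at points of U; \<open>mean_eq_0\<close>
  converts their vanishing into that of the fibrewise means required by the locale.\<close>

lemma flat_data_connection:
  fixes U :: "(complex^'n) set"
  assumes "domain_of_holomorphy U" "flat_connection U C" "almost_standard U C"
    and del: "\<forall>i. \<forall>Z\<in>U. delta C i Z = 0" and al: "\<forall>i. \<forall>Z\<in>U. alpha C i Z = (\<lambda>h. 0)"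
  shows "flat_data U (open_base.clip U (vert_t C)) (\<lambda>j. open_base.clip U (vert_Z C j))"
proof -
  interpret open_base U
    by standard (use assms(1) in \<open>simp add: domain_of_holomorphy_def\<close>)
  obtain u v w where uvw: "u \<in> g_an U" "\<And>m. v m \<in> g_an U" "\<And>j m. w j m \<in> g_an U"
    "vert_t C = vert_t standard_connection + (\<chi> i. fls_X_intpow (-1) * fls_const (u $ i)) + vfield_series v"
    "\<And>j. vert_Z C j = vert_Z standard_connection j + vfield_series (w j)"
    using assms(3) unfolding almost_standard_def by blast
  have O: "u $ i \<in> OU" "v m $ i \<in> OU" "w j m $ i \<in> OU" for i m j
    using uvw(1-3) by (auto simp: g_an_def)
  have ser: "tmon 0 unit_fun * vfield_series x $ i = vfield_series x $ i" if "\<And>m. x m $ i \<in> OU" for x i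
    by (rule fls_eqI) (simp add: tmon_times_nth vfield_series_def unit_fun_mult that)
  have X: "clip (vert_t C) $ i = tmon (-2) (Z_coord i) + tmon (-1) (u $ i) + vfield_series v $ i" for i
  proof -
    have "vert_t C $ i = vert_t standard_connection $ i + tmon (-1) (u $ i) + vfield_series v $ i"
      by (simp only: uvw(4) vector_add_component vec_lambda_beta tmon_def)
    then show ?thesis
      using clip_standard(1)[of i] by (simp add: clip_def distrib_left ser O tmon_mult_mon unit_fun_mult)
  qed
  have Y: "clip (vert_Z C j) $ i = tmon (-1) (if i = j then - unit_fun else 0) + vfield_series (w j) $ i" for i j
    using clip_standard(2)[of j i]
    by (simp add: clip_def uvw(5) distrib_left ser O)
  have ser_nth: "fls_nth (vfield_series x $ i) n = (if n < 0 then 0 else x (nat n) $ i)" for x :: "nat \<Rightarrow> 'n vfield" and i n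
    by (simp add: vfield_series_def)
  have serF: "vfield_series x $ i \<in> FF" if "\<And>m. x m $ i \<in> OU" for x i
    by (rule FF_I) (simp add: ser_nth that zero_O)
  have st0: "fls_nth (vert_t standard_connection $ i) (-1) = (0 :: 'n fn)"
    "fls_nth (vert_Z standard_connection j $ i) 0 = (0 :: 'n fn)" for i j :: 'n
    by (simp_all add: standard_connection_def fls_X_intpow_times_conv_shift)
  have du: "fls_nth (vert_t C $ i) (-1) = u $ i" for i
    by (simp add: uvw(4) st0 ser_nth fls_X_intpow_times_conv_shift)
  have dw: "fls_nth (vert_Z C j $ i) 0 = w j 0 $ i" for i j
    by (simp add: uvw(5) st0 ser_nth)
  have mu: "mean (u $ i) = 0" for i
    by (rule mean_eq_0[OF O(1)]) (use del in \<open>simp add: delta_def du\<close>)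
  have "a_coeff C i j Z = 0" if "Z \<in> U" for i j Z
  proof -
    have "alpha C i Z (axis j 1) = 0" using al that by simp
    moreover have "alpha C i Z (axis j 1) = a_coeff C i j Z"
      by (simp add: alpha_def axis_def sum_times_if_eq)
    ultimately show ?thesis by simp
  qed
  then have mw: "mean (w j 0 $ i) = 0" for i j
    by (intro mean_eq_0[OF O(3)]) (simp add: a_coeff_def dw)
  show ?thesis
  proof (unfold_locales)
    show "clip (vert_t C) \<in> FV"
    proof -
      have "clip (vert_t C) $ i \<in> FF" for i
        unfolding X by (intro FF_add FF_mon Z_coord_props O serF)
      then show ?thesis by (simp add: FV_def)
    qed
    show "clip (vert_Z C j) \<in> FV" for j
    proof -
      have "(if i = j then - unit_fun else 0) \<in> OU" for i
        using O_an_uminus(1)[OF unit_fun_props(1)] zero_O by simp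
      then have "clip (vert_Z C j) $ i \<in> FF" for i
        unfolding Y by (intro FF_add FF_mon O serF)
      then show ?thesis by (simp add: FV_def)
    qed
    show "ord_ge (clip (vert_t C) $ i) (-2)" for i
      by (simp add: X ord_ge_def tmon_nth ser_nth)
    show "ord_ge (clip (vert_Z C j) $ i) (-1)" for i j
      by (simp add: Y ord_ge_def tmon_nth ser_nth)
    show "fls_nth (clip (vert_t C) $ i) (-2) = Z_coord i" for i
      by (simp add: X tmon_nth ser_nth)
    show "fls_nth (clip (vert_Z C j) $ i) (-1) = (if i = j then - unit_fun else 0)" for i j
      by (simp add: Y tmon_nth ser_nth)
    have "fls_nth (clip (vert_t C) $ i) (-1) = u $ i" for i
      by (simp add: X tmon_nth ser_nth)
    then show "mean (fls_nth (clip (vert_t C) $ i) (-1)) = 0" for i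
      by (simp only: mu)
    have "fls_nth (clip (vert_Z C j) $ i) 0 = w j 0 $ i" for i j
      by (simp add: Y tmon_nth ser_nth)
    then show "mean (fls_nth (clip (vert_Z C j) $ i) 0) = 0" for i j
      by (simp only: mw)
    show "conn fls_deriv (clip (vert_t C)) (conn (fls_map (pz j)) (clip (vert_Z C j)) F) =
      conn (fls_map (pz j)) (clip (vert_Z C j)) (conn fls_deriv (clip (vert_t C)) F)" if "F \<in> FF" for F j
      using assms(2) that unfolding flat_connection_def nabla_conn by blast
    show "conn (fls_map (pz k)) (clip (vert_Z C k)) (conn (fls_map (pz j)) (clip (vert_Z C j)) F) =
      conn (fls_map (pz j)) (clip (vert_Z C j)) (conn (fls_map (pz k)) (clip (vert_Z C k)) F)" if "F \<in> FF" for F j k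
      using assms(2) that unfolding flat_connection_def nabla_conn by blast
  qed
qed

theorem theorem5p3p1:
  fixes U :: "(complex^'n) set" and C :: "'n connection"
  assumes "domain_of_holomorphy U"
    and "flat_connection U C"
    and "almost_standard U C"
    and "\<forall>i. \<forall>Z\<in>U. delta C i Z = 0"
    and "\<forall>i. \<forall>Z\<in>U. alpha C i Z = (\<lambda>h. 0)"
  shows "\<exists>!g. g \<in> gauge_group U \<and> gauge_transforms U g C standard_connection"
proof -
  interpret open_base U
    by standard (use assms(1) in \<open>simp add: domain_of_holomorphy_def\<close>)
  interpret flat_data U "clip (vert_t C)" "\<lambda>j. clip (vert_Z C j)"
    by (rule flat_data_connection[OF assms])
  let ?st = "standard_connection :: 'n connection"
  let ?z = "\<lambda>i. tmon 0 (z_coord i)"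
  have "\<exists>u. u \<in> FF \<and> ord_ge (u - tmon 0 unit_fun) 1 \<and> T i u = 0 \<and> (\<forall>j. S i j u = 0)" for i
    using flat_solution[of i] by blast
  then obtain u where u: "\<And>i. u i \<in> FF" "\<And>i. ord_ge (u i - tmon 0 unit_fun) 1" "\<And>i. T i (u i) = 0" "\<And>i j. S i j (u i) = 0"
    by metis
  define G where "G i = ?z i * u i" for i
  have GF: "G i \<in> FF" for i unfolding G_def by (intro FF_mult z_coord_FF u)
  have Gz: "ord_ge (G i - ?z i) 1" for i
  proof -
    have "?z i * tmon 0 unit_fun = ?z i" using unit_fun_times[OF z_coord_FF[of i]] by (simp add: mult.commute)
    then have "G i - ?z i = ?z i * (u i - tmon 0 unit_fun)" by (simp add: G_def right_diff_distrib)
    then show ?thesis using ord_ge_times[OF ord_ge_mon u(2), of 0 "z_coord i" i] by simp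
  qed
  obtain \<eta> where \<eta>: "\<eta> \<in> Lie_H U" and \<eta>G: "\<And>i. vexp U \<eta> (?z i) = G i"
    using vexp_surj[of G, OF GF Gz] by blast
  note m\<eta> = Lie_H_uminus[OF \<eta>]
  have G0: "ord_ge (G i) 0" "fls_nth (G i) 0 = z_coord i" for i
    unfolding \<eta>G[symmetric] using ord_ge_vexp[OF \<eta> ord_ge_mon] vexp_lead[OF \<eta> ord_ge_mon] by (simp_all add: tmon_nth)
  have Gt: "nt (G i) = tmon (-2) (Z_coord i) * G i" and GZ: "nz j (G i) = tmon (-1) (if i = j then - unit_fun else 0) * G i" for i j
    unfolding G_def by (rule flat_coordinate[OF u(1,3,4), unfolded Lc_def Mc_def])+
  have dc: "fls_deriv (tmon 0 (const_fun c)) = 0" "fls_map (pz j) (tmon 0 (const_fun c)) = 0" for c j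
    by (simp_all only: deriv_mon pz_mon const_fun_props of_int_0 mult_zero_left tmon_0)
  have Et: "vexp U \<eta> (nabla_t U ?st F) = nabla_t U C (vexp U \<eta> F)" if F: "F \<in> FF" for F
  proof -
    obtain X' where X': "X' \<in> FV" "\<And>i. ord_ge (X' $ i) (-2)"
      "\<And>F. F \<in> FF \<Longrightarrow> vexp U \<eta> (nabla_t U ?st F) = conn fls_deriv X' (vexp U \<eta> F)"
      using vexp_conn[OF \<eta> base_der_deriv dc(1) FV_standard(1) ord_ge_standard(1)] unfolding nabla_conn by blast
    \<comment> \<open>The standard lift multiplies z_i by Z_i / t^2, over which the exponential is
      linear. So the conjugated lift multiplies \<open>G i\<close> by the same factor, as \<nabla>
      does by \<open>Gt\<close>.\<close>
    have "conn fls_deriv X' (G i) = nt (G i)" for i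
      using X'(3)[OF z_coord_FF[of i]] vexp_base_mult[OF \<eta> base_fun_Zc z_coord_FF, of "-2" i i]
      by (simp only: nabla_standard_zc \<eta>G Gt)
    from conn_determined[OF GF G0 X'(1) X_FV this X'(2) X_vb] X'(3)[OF F]
    show ?thesis by (simp only: nabla_conn)
  qed
  have EZ: "vexp U \<eta> (nabla_Z U ?st j F) = nabla_Z U C j (vexp U \<eta> F)" if F: "F \<in> FF" for F j
  proof -
    obtain X' where X': "X' \<in> FV" "\<And>i. ord_ge (X' $ i) (-2)"
      "\<And>F. F \<in> FF \<Longrightarrow> vexp U \<eta> (nabla_Z U ?st j F) = conn (fls_map (pz j)) X' (vexp U \<eta> F)"
      using vexp_conn[OF \<eta> base_der_pz dc(2) FV_standard(2) ord_ge_standard(2), of j j] unfolding nabla_conn by blast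
    have "conn (fls_map (pz j)) X' (G i) = nz j (G i)" for i
      using X'(3)[OF z_coord_FF[of i]] vexp_base_mult[OF \<eta> base_Mc z_coord_FF, of "-1" i j i]
      by (simp only: nabla_standard_zc \<eta>G GZ)
    moreover have "ord_ge (clip (vert_Z C j) $ i) (-2)" for i by (rule ord_ge_mono[OF Y_vb]) simp
    ultimately have "X' = clip (vert_Z C j)"
      using conn_determined[OF GF G0 X'(1) Y_FV, of "fls_map (pz j)" j "-2"] X'(2) by blast
    with X'(3)[OF F] show ?thesis by (simp only: nabla_conn)
  qed
  have FFn: "nabla_t U C F \<in> FF" "nabla_Z U C j F \<in> FF" if "F \<in> FF" for F j
    unfolding nabla_conn by (intro FF_nt FF_nz that)+
  have FFs: "nabla_t U ?st F \<in> FF" "nabla_Z U ?st j F \<in> FF" if "F \<in> FF" for F j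
    unfolding nabla_conn by (intro FF_conn base_der_deriv base_der_pz FV_standard that)+
  \<comment> \<open>The exponential of \<eta> carries the standard connection to \<nabla>, so the
    gauge transformation sought is its inverse.\<close>
  define g where "g = restrict (vexp U (- \<eta>)) FF"
  have g: "g F = vexp U (- \<eta>) F" if "F \<in> FF" for F using that by (simp add: g_def)
  have "gauge_transforms U g C ?st"
    unfolding gauge_transforms_def
  proof (intro ballI conjI allI)
    fix F j assume F: "F \<in> FF"
    define H where "H = vexp U (- \<eta>) F"
    have H: "H \<in> FF" unfolding H_def by (rule FF_vexp[OF m\<eta> F])
    have EH: "vexp U \<eta> H = F" using vexp_inverse[OF m\<eta> F] by (simp add: H_def)
    have "vexp U (- \<eta>) (nabla_t U C (vexp U \<eta> H)) = nabla_t U ?st H"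
      "vexp U (- \<eta>) (nabla_Z U C j (vexp U \<eta> H)) = nabla_Z U ?st j H"
      by (simp_all only: Et[OF H, symmetric] EZ[OF H, symmetric] vexp_inverse[OF \<eta>] FFs[OF H])
    then show "g (nabla_t U C F) = nabla_t U ?st (g F)" "g (nabla_Z U C j F) = nabla_Z U ?st j (g F)"
      by (simp_all only: g[OF F] g[OF FFn(1)[OF F]] g[OF FFn(2)[OF F]] H_def[symmetric] EH)
  qed
  moreover have "g \<in> gauge_group U" unfolding gauge_group_def g_def using m\<eta> by blast
  moreover have "g' = g" if g': "g' \<in> gauge_group U" "gauge_transforms U g' C ?st" for g'
  proof -
    obtain h where h: "h \<in> Lie_H U" "g' = restrict (vexp U h) FF"
      using g'(1) unfolding gauge_group_def by blast
    note mh = Lie_H_uminus[OF h(1)]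
    have ht: "vexp U h (nabla_t U C F) = nabla_t U ?st (vexp U h F)"
      and hZ: "vexp U h (nabla_Z U C j F) = nabla_Z U ?st j (vexp U h F)" if "F \<in> FF" for F j
      using g'(2) that FFn[OF that] unfolding gauge_transforms_def h(2) by auto
    \<comment> \<open>For any other solution with exponent h, the images of the z_i under its
      inverse satisfy the same flat equations and begin with z_i, which fixes them. Then -h and
      \<eta> have exponentials that agree on coordinates.\<close>
    have "vexp U (- h) (?z i) = G i" for i
      unfolding G_def
    proof (rule flat_coordinate_unique[OF _ _ _ _ _ u])
      define K where "K = vexp U (- h) (?z i)"
      have K: "K \<in> FF" unfolding K_def by (rule FF_vexp[OF mh z_coord_FF])
      have hK: "vexp U h K = ?z i" using vexp_inverse[OF mh z_coord_FF] by (simp add: K_def)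
      have "nabla_t U C K = vexp U (- h) (tmon (-2) (Z_coord i) * ?z i)"
        using vexp_inverse[OF h(1) FFn(1)[OF K]] by (simp only: ht[OF K] hK nabla_standard_zc)
      then show "nt K = Lc i * K"
        by (simp only: nabla_conn Lc_def K_def vexp_base_mult[OF mh base_fun_Zc z_coord_FF])
      have "nabla_Z U C j K = vexp U (- h) (tmon (-1) (if i = j then - unit_fun else 0) * ?z i)" for j
        using vexp_inverse[OF h(1) FFn(2)[OF K, of j]] by (simp only: hZ[OF K] hK nabla_standard_zc)
      then show "nz j K = Mc i j * K" for j
        by (simp only: nabla_conn Mc_def K_def vexp_base_mult[OF mh base_Mc z_coord_FF])
      show "K \<in> FF" by (rule K)
      show "ord_ge K 0" unfolding K_def by (rule ord_ge_vexp[OF mh ord_ge_mon])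
      show "fls_nth K 0 = z_coord i" unfolding K_def vexp_lead[OF mh ord_ge_mon] by (simp add: tmon_nth)
    qed
    then have "- h = \<eta>" by (intro vexp_inj[OF mh \<eta>]) (simp only: \<eta>G)
    then have "h = - \<eta>" by (metis minus_minus)
    then show ?thesis by (simp add: h(2) g_def)
  qed
  ultimately show ?thesis by blast
qed

end
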